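(* Let $R=\mathbb Z[\alpha_1,\ldots,\alpha_s]$ be a finitely generated integral domain of characteristic zero (with fixed generators $\alpha_1,\dots,\alpha_s$) and let $K=\operatorname{Frac}(R)$. Fix $g\in R\setminus\{0\}$ and a finite set of rational primes (the excluded primes). There are an element $h\in R\setminus\{0\}$, the localization $R'=R[1/(gh)]$, and (i) a prime $p\geq3$; (ii) a complete rank-one nonarchimedean field $\mathcal K$ with valuation $v$, normalized by $v(p)=1$, and with finite residue field; (iii) an injective homomorphism $\iota:K\hookrightarrow\mathcal K$; such that $p$ is not excluded, $\iota(R')$ lies in the valuation ring $\mathcal K^\circ$, and, for some constant $A>0$ depending only on the chosen presentation and localization, $$v\bigl(\iota(\xi)\bigr)\leq A\,\operatorname{comp}_R(\xi)\qquad(\xi\in K^\times).$$ The elements $g$ and $h$, and hence every element of the multiplicative set used to define $R'$, map to units of $\mathcal K^\circ$.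
   Context: Valuations are additive and real-valued: $v:\mathcal K\to\mathbb R\cup\{+\infty\}$ with $v(a)=+\infty$ exactly for $a=0$, $v(ab)=v(a)+v(b)$, $v(a+b)\geq\min\{v(a),v(b)\}$. Rank one means nontrivial with value group contained in $\mathbb R$; discreteness is not assumed. The associated absolute value is $|a|=p^{-v(a)}$, and completeness is with respect to it. $\mathcal K^\circ=\{a:|a|\leq1\}$ is the valuation ring, and the residue field is $\mathcal K^\circ$ modulo its maximal ideal $\{a:|a|<1\}$. Presentation complexity. Put $\boldsymbol\alpha=(\alpha_1,\ldots,\alpha_s)$. For nonzero $P\in\mathbb Z[X_1,\ldots,X_s]$ with total degree $\deg P$ and coefficient $\ell^1$-norm $\|P\|_1$ (ordinary absolute values of the integer coefficients), set $$\sigma(P)=(1+\deg P)\log(2+\deg P)+\log(1+\|P\|_1).$$ For $\xi\in K^\times$ define $$\operatorname{comp}_R(\xi)=\min_{\xi=P(\boldsymbol\alpha)/Q(\boldsymbol\alpha)}\max\{\sigma(P),\sigma(Q)\},$$ over $P,Q\in\mathbb Z[X_1,\ldots,X_s]$ with $Q(\boldsymbol\alpha)\ne0$; put $\operatorname{comp}_R(0)=0$. *)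

theory Defs
  imports
    "HOL-Library.Poly_Mapping"
    "HOL-Computational_Algebra.Fraction_Field"
    "HOL-Algebra.QuotRing"
    "HOL-Algebra.Algebraic_Closure_Type"
    "HOL-Analysis.Abstract_Metric_Spaces"
    "HOL-Library.Extended_Real"
begin

section \<open>Integer polynomials in several variables\<close>

text \<open>
  A polynomial in \<open>\<int>[X\<^sub>0, X\<^sub>1, \<dots>]\<close> is a finitely supported map from exponent vectors to integers.
  The variables \<open>X\<^sub>1, \<dots>, X\<^sub>s\<close> of the text are numbered from \<open>0\<close> to \<open>s - 1\<close>.
\<close>

type_synonym int_mpoly = "(nat \<Rightarrow>\<^sub>0 nat) \<Rightarrow>\<^sub>0 int"

definition mpolys :: "nat \<Rightarrow> int_mpoly set" where
  "mpolys s = {P. \<forall>m \<in> Poly_Mapping.keys P. Poly_Mapping.keys m \<subseteq> {..<s}}"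

definition mono_deg :: "(nat \<Rightarrow>\<^sub>0 nat) \<Rightarrow> nat" where
  "mono_deg m = (\<Sum>i \<in> Poly_Mapping.keys m. Poly_Mapping.lookup m i)"

text \<open>The inserted \<open>0\<close> only matters for the zero polynomial, where it gives degree \<open>0\<close>.\<close>

definition tot_deg :: "int_mpoly \<Rightarrow> nat" where
  "tot_deg P = Max (insert 0 (mono_deg ` Poly_Mapping.keys P))"

definition l1_norm :: "int_mpoly \<Rightarrow> int" where
  "l1_norm P = (\<Sum>m \<in> Poly_Mapping.keys P. \<bar>Poly_Mapping.lookup P m\<bar>)"

definition mpoly_eval :: "(nat \<Rightarrow> 'r::comm_ring_1) \<Rightarrow> int_mpoly \<Rightarrow> 'r" where
  "mpoly_eval \<alpha> P =
    (\<Sum>m \<in> Poly_Mapping.keys P. of_int (Poly_Mapping.lookup P m) *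
      (\<Prod>i \<in> Poly_Mapping.keys m. \<alpha> i ^ Poly_Mapping.lookup m i))"

definition Z_adjoin :: "nat \<Rightarrow> (nat \<Rightarrow> 'r::comm_ring_1) \<Rightarrow> 'r set" where
  "Z_adjoin s \<alpha> = mpoly_eval \<alpha> ` mpolys s"


section \<open>Presentation complexity\<close>

definition poly_size :: "int_mpoly \<Rightarrow> real" where
  "poly_size P = (1 + real (tot_deg P)) * ln (2 + real (tot_deg P)) + ln (1 + real_of_int (l1_norm P))"

definition presentations ::
    "nat \<Rightarrow> (nat \<Rightarrow> 'r::idom) \<Rightarrow> 'r fract \<Rightarrow> (int_mpoly \<times> int_mpoly) set" where
  "presentations s \<alpha> \<xi> =
    {(P, Q). P \<in> mpolys s \<and> Q \<in> mpolys s \<and> mpoly_eval \<alpha> Q \<noteq> 0 \<and>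
             \<xi> = Fraction_Field.Fract (mpoly_eval \<alpha> P) (mpoly_eval \<alpha> Q)}"

text \<open>The minimum is attained; see \<open>comp_R_is_minimum\<close> below.\<close>

definition comp_R :: "nat \<Rightarrow> (nat \<Rightarrow> 'r::idom) \<Rightarrow> 'r fract \<Rightarrow> real" where
  "comp_R s \<alpha> \<xi> =
    (if \<xi> = 0 then 0
     else (LEAST c. \<exists>(P, Q) \<in> presentations s \<alpha> \<xi>. c = max (poly_size P) (poly_size Q)))"

lemma finite_poly_size_values: "finite {c. \<exists>P. c = poly_size P \<and> c \<le> B}"
proof -
  let ?f = "\<lambda>(d::nat, n::nat). (1 + real d) * ln (2 + real d) + ln (1 + real n)"
  let ?D = "nat \<lceil>B / ln 2\<rceil>" and ?N = "nat \<lceil>exp B\<rceil>"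
  have "{c. \<exists>P. c = poly_size P \<and> c \<le> B} \<subseteq> ?f ` ({..?D} \<times> {..?N})"
  proof clarify
    fix P assume le: "poly_size P \<le> B"
    define d where "d = tot_deg P"
    define n where "n = nat (l1_norm P)"
    have "l1_norm P \<ge> 0" unfolding l1_norm_def by (intro sum_nonneg) auto
    then have n: "real n = real_of_int (l1_norm P)" by (simp add: n_def)
    have eq: "poly_size P = (1 + real d) * ln (2 + real d) + ln (1 + real n)"
      unfolding poly_size_def n d_def by simp
    have l2: "ln (2 + real d) \<ge> ln 2" by simp
    have pos: "ln (2::real) > 0" by simp
    have a: "(1 + real d) * ln (2 + real d) \<ge> real d * ln 2"
      using l2 pos by (intro mult_mono) auto
    have a0: "real d * ln 2 \<ge> 0" using pos by simp
    have b0: "ln (1 + real n) \<ge> 0" by simp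
    have "real d * ln 2 \<le> B" using a b0 le eq by linarith
    then have "real d \<le> B / ln 2" using pos by (simp add: field_simps)
    then have d: "d \<le> ?D" by linarith
    have "ln (1 + real n) \<le> B" using a a0 le eq by linarith
    then have "1 + real n \<le> exp B" by (simp add: ln_le_cancel_iff flip: ln_le_cancel_iff[of _ "exp B"])
    then have "n \<le> ?N" by linarith
    then show "poly_size P \<in> ?f ` ({..?D} \<times> {..?N})"
      using d eq by (auto intro!: image_eqI[of _ _ "(d, n)"])
  qed
  then show ?thesis by (rule finite_subset) auto
qed

lemma ex_least_real:
  fixes S :: "real set"
  assumes "x \<in> S" and "\<And>B. finite {y \<in> S. y \<le> B}"
  shows "\<exists>c \<in> S. \<forall>y \<in> S. c \<le> y"
proof -
  let ?T = "{y \<in> S. y \<le> x}"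
  have "finite ?T" "x \<in> ?T" using assms by auto
  then have "Min ?T \<in> ?T" "\<forall>y \<in> ?T. Min ?T \<le> y"
    by (metis Min_in empty_iff, simp)
  then show ?thesis by (intro bexI[of _ "Min ?T"]) force+
qed

lemma comp_R_is_minimum:
  fixes \<alpha> :: "nat \<Rightarrow> 'r::idom"
  assumes "Z_adjoin s \<alpha> = UNIV" and "\<xi> \<noteq> 0"
  shows "\<exists>(P, Q) \<in> presentations s \<alpha> \<xi>. comp_R s \<alpha> \<xi> = max (poly_size P) (poly_size Q)"
    and "(P, Q) \<in> presentations s \<alpha> \<xi> \<Longrightarrow> comp_R s \<alpha> \<xi> \<le> max (poly_size P) (poly_size Q)"
proof -
  define S where "S = {c. \<exists>(P, Q) \<in> presentations s \<alpha> \<xi>. c = max (poly_size P) (poly_size Q)}"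
  obtain a b where ab: "\<xi> = Fraction_Field.Fract a b" "b \<noteq> 0" by (cases \<xi>) auto
  have "a \<in> mpoly_eval \<alpha> ` mpolys s" "b \<in> mpoly_eval \<alpha> ` mpolys s"
    using assms(1) unfolding Z_adjoin_def by auto
  then obtain P0 Q0 where "(P0, Q0) \<in> presentations s \<alpha> \<xi>"
    using ab unfolding presentations_def by blast
  then have "max (poly_size P0) (poly_size Q0) \<in> S" unfolding S_def by blast
  moreover have "finite {y \<in> S. y \<le> B}" for B
    by (rule finite_subset[OF _ finite_poly_size_values[of B]])
       (auto simp: S_def max_def split: if_splits)
  ultimately obtain c where c: "c \<in> S" "\<forall>y \<in> S. c \<le> y" using ex_least_real by blast
  have "(LEAST c. c \<in> S) = c" using c by (intro Least_equality) auto
  then have "comp_R s \<alpha> \<xi> = c" using assms(2) unfolding comp_R_def S_def by simp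
  then show "\<exists>(P, Q) \<in> presentations s \<alpha> \<xi>. comp_R s \<alpha> \<xi> = max (poly_size P) (poly_size Q)"
    and "(P, Q) \<in> presentations s \<alpha> \<xi> \<Longrightarrow> comp_R s \<alpha> \<xi> \<le> max (poly_size P) (poly_size Q)"
    using c unfolding S_def by auto
qed


section \<open>Localization at one element\<close>

text \<open>The ring \<open>R[1/x]\<close>, realised inside \<open>Frac(R)\<close>; here \<open>R\<close> is the whole type.\<close>

definition localization :: "'r::idom \<Rightarrow> 'r fract set" where
  "localization x = {Fraction_Field.Fract a (x ^ n) | a n. True}"


section \<open>Valued fields\<close>

text \<open>
  The values lie in \<open>\<real> \<union> {+\<infinity>}\<close>: the assumption \<open>v_not_MInf\<close> removes the value \<open>-\<infinity>\<close> of \<open>ereal\<close>.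
\<close>

locale rank_one_valued_field = Ring.field F
  for F :: "('a, 'b) ring_scheme" (structure) +
  fixes v :: "'a \<Rightarrow> ereal"
  assumes v_not_MInf: "x \<in> carrier F \<Longrightarrow> v x \<noteq> -\<infinity>"
    and v_PInf_iff: "x \<in> carrier F \<Longrightarrow> v x = \<infinity> \<longleftrightarrow> x = \<zero>"
    and v_mult: "x \<in> carrier F \<Longrightarrow> y \<in> carrier F \<Longrightarrow> v (x \<otimes> y) = v x + v y"
    and v_add: "x \<in> carrier F \<Longrightarrow> y \<in> carrier F \<Longrightarrow> v (x \<oplus> y) \<ge> min (v x) (v y)"
    and v_nontrivial: "\<exists>x \<in> carrier F - {\<zero>}. v x \<noteq> 0"

text \<open>The absolute value \<open>p\<^bsup>-v(a)\<^esup>\<close>.\<close>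

definition vabs :: "nat \<Rightarrow> ('a \<Rightarrow> ereal) \<Rightarrow> 'a \<Rightarrow> real" where
  "vabs p v a = (if v a = \<infinity> then 0 else real p powr (- real_of_ereal (v a)))"

definition valuation_ring :: "('a, 'b) ring_scheme \<Rightarrow> nat \<Rightarrow> ('a \<Rightarrow> ereal) \<Rightarrow> ('a, 'b) ring_scheme" where
  "valuation_ring F p v = F\<lparr>carrier := {a \<in> carrier F. vabs p v a \<le> 1}\<rparr>"

definition valuation_ideal :: "('a, 'b) ring_scheme \<Rightarrow> nat \<Rightarrow> ('a \<Rightarrow> ereal) \<Rightarrow> 'a set" where
  "valuation_ideal F p v = {a \<in> carrier F. vabs p v a < 1}"

definition residue_field :: "('a, 'b) ring_scheme \<Rightarrow> nat \<Rightarrow> ('a \<Rightarrow> ereal) \<Rightarrow> 'a set ring" where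
  "residue_field F p v = valuation_ring F p v Quot valuation_ideal F p v"

text \<open>
  The library's metric spaces ask for a distance that is symmetric and nonnegative on the whole
  type, so the distance is set to \<open>0\<close> off the carrier.
\<close>

definition vdist :: "('a, 'b) ring_scheme \<Rightarrow> nat \<Rightarrow> ('a \<Rightarrow> ereal) \<Rightarrow> 'a \<Rightarrow> 'a \<Rightarrow> real" where
  "vdist F p v x y =
    (if x \<in> carrier F \<and> y \<in> carrier F then vabs p v (x \<ominus>\<^bsub>F\<^esub> y) else 0)"

definition valuation_complete :: "('a, 'b) ring_scheme \<Rightarrow> nat \<Rightarrow> ('a \<Rightarrow> ereal) \<Rightarrow> bool" where
  "valuation_complete F p v \<longleftrightarrow> Metric_space.mcomplete (carrier F) (vdist F p v)"

context rank_one_valued_field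
begin

lemma v_zero: "v \<zero> = \<infinity>"
  using v_PInf_iff by simp

lemma v_uminus_le: assumes "x \<in> carrier F" shows "v x \<le> v (\<ominus> x)"
proof -
  have 1: "v \<one> = 0"
  proof -
    have "v \<one> + v \<one> = v \<one>" using v_mult[of \<one> \<one>] by simp
    moreover have "v \<one> \<noteq> \<infinity>" "v \<one> \<noteq> -\<infinity>" using v_PInf_iff[of \<one>] v_not_MInf[of \<one>] by auto
    ultimately show ?thesis by (cases "v \<one>") auto
  qed
  have "v (\<ominus> \<one>) + v (\<ominus> \<one>) = 0"
    using v_mult[of "\<ominus> \<one>" "\<ominus> \<one>"] 1 by (simp add: l_minus r_minus)
  then have "v (\<ominus> \<one>) = 0" by (cases "v (\<ominus> \<one>)") auto
  moreover have "\<ominus> x = \<ominus> \<one> \<otimes> x" using assms by (simp add: l_minus)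
  ultimately show ?thesis using v_mult[of "\<ominus> \<one>" x] assms by simp
qed

lemma v_uminus: "x \<in> carrier F \<Longrightarrow> v (\<ominus> x) = v x"
  using v_uminus_le[of x] v_uminus_le[of "\<ominus> x"] by simp

lemma vabs_nonneg: "vabs p v x \<ge> 0"
  by (simp add: vabs_def)

lemma vabs_add:
  assumes p: "p > 1" and x: "x \<in> carrier F" and y: "y \<in> carrier F"
  shows "vabs p v (x \<oplus> y) \<le> max (vabs p v x) (vabs p v y)"
proof (cases "v (x \<oplus> y) = \<infinity>")
  case True
  then show ?thesis using vabs_nonneg[of p x] by (simp add: vabs_def)
next
  case False
  then obtain r where r: "v (x \<oplus> y) = ereal r"
    using v_not_MInf[of "x \<oplus> y"] x y by (cases "v (x \<oplus> y)") auto
  have *: "vabs p v (x \<oplus> y) \<le> vabs p v z" if "z \<in> carrier F" "v z \<le> v (x \<oplus> y)" for z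
    using that r v_not_MInf[of z] p by (cases "v z") (auto simp: vabs_def)
  show ?thesis using v_add[OF x y] *[OF x] *[OF y]
    by (auto simp: min_def max_def split: if_splits intro: order_trans)
qed

text \<open>Hence \<open>valuation_complete\<close> is the notion of completeness of the metric space library.\<close>

lemma Metric_space_vdist:
  assumes p: "p > 1"
  shows "Metric_space (carrier F) (vdist F p v)"
proof
  fix x y show "0 \<le> vdist F p v x y" by (simp add: vdist_def vabs_nonneg)
  show "vdist F p v x y = vdist F p v y x"
  proof (cases "x \<in> carrier F \<and> y \<in> carrier F")
    case True
    then have "x \<ominus> y = \<ominus> (y \<ominus> x)" by (simp add: minus_eq minus_add a_comm)
    then show ?thesis using True v_uminus[of "y \<ominus> x"] by (simp add: vdist_def vabs_def)
  qed (auto simp: vdist_def)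
next
  fix x y assume xy: "x \<in> carrier F" "y \<in> carrier F"
  then have "v (x \<ominus> y) = \<infinity> \<longleftrightarrow> x = y" using v_PInf_iff[of "x \<ominus> y"] by simp
  then show "vdist F p v x y = 0 \<longleftrightarrow> x = y"
    using xy p by (simp add: vdist_def vabs_def)
next
  fix x y z assume c: "x \<in> carrier F" "y \<in> carrier F" "z \<in> carrier F"
  have "x \<ominus> z = (x \<ominus> y) \<oplus> (y \<ominus> z)"
    using c by (simp add: minus_eq a_assoc r_neg1)
  then have "vabs p v (x \<ominus> z) \<le> max (vabs p v (x \<ominus> y)) (vabs p v (y \<ominus> z))"
    using vabs_add[OF p, of "x \<ominus> y" "y \<ominus> z"] c by simp
  then show "vdist F p v x z \<le> vdist F p v x y + vdist F p v y z"
    using c vabs_nonneg[of p "x \<ominus> y"] vabs_nonneg[of p "y \<ominus> z"] by (simp add: vdist_def)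
qed

end

text \<open>
  An ambient type for the complete field that the theorem asserts to exist, as HOL cannot quantify
  over types inside a formula.  It costs no generality: if \<open>K = Frac(R)\<close> embeds into a complete
  valued field as required, then the closure of the image of \<open>K\<close> is again such a field, and its
  elements correspond to classes of Cauchy sequences in \<open>K\<close>, i.e. to certain sets of sequences.
\<close>

type_synonym 'r completion_point = "(nat \<Rightarrow> 'r fract) set"

end

theory Submission
  imports Defs
begin

text \<open>
  Adjoin the generators one at a time, starting from the \<open>p\<close>-adic absolute value on \<open>\<int>\<close>, and keep
  a lower bound for the absolute values of nonzero elements that is exponential in the degree plus the
  logarithmic size of a representing polynomial.  A transcendental generator \<open>t\<close> is shifted by an
  integer \<open>a\<close> and receives the Gauss norm in which \<open>t - a\<close> has an absolute value \<open>\<rho> < 1\<close> independent of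
  the value group so far: the residue field is unchanged and the bound is read off one coefficient.
  For an algebraic generator the absolute value is extended by means of a maximal subring not
  containing \<open>1 / p\<close>; the powers of an element \<open>y\<close> satisfy a linear relation whose coefficients are
  controlled by elimination, and its lowest nonzero coefficient is divisible by \<open>y\<close>.  That \<open>g\<close>
  becomes a unit is arranged in the same way, by requiring finitely many nonzero elements of the
  previous ring to be units; at the bottom this excludes finitely many \<open>p\<close>.  The field sought is the
  completion.
\<close>

section \<open>Subrings and nonarchimedean absolute values\<close>

text \<open>Only numerators need a lower bound: every element of \<open>R\<close> has value at most
  1, so dividing by a denominator cannot decrease the value. Finiteness of the residue field shapes
  the transcendental step: the usual Gauss norm, of radius 1, would adjoin a transcendental to the
  residue field, whereas an independent radius enlarges only the value group, which may be
  nondiscrete. In the algebraic step the generator must become integral, so the leading coefficient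
  of its equation has to be a unit; this is a second reason, next to \<open>g\<close>, for
  prescribing units in the previous ring. The prime \<open>p\<close> keeps the value
  \<open>1 / p\<close> at all steps: it is the nonzero element of value below 1 that a maximal
  subring requires, and it normalizes \<open>v\<close>. Finally, the order of quantifiers needs
  care: the constant is a function of \<open>h\<close> alone, fixed before the excluded primes,
  while the bound obtained depends on \<open>p\<close>. So \<open>h\<close> is made to carry
  \<open>p\<close>, and \<open>p + 1\<close> is a unit because \<open>p\<close> has value below
  1.\<close>

definition is_subring :: "'a::comm_ring_1 set \<Rightarrow> bool" where
  "is_subring B \<longleftrightarrow> 1 \<in> B \<and> (\<forall>x\<in>B. \<forall>y\<in>B. x - y \<in> B \<and> x * y \<in> B)"

definition is_subfield :: "'a::field set \<Rightarrow> bool" where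
  "is_subfield K \<longleftrightarrow> is_subring K \<and> (\<forall>x\<in>K. inverse x \<in> K)"

text \<open>Since \<open>x / 0 = 0\<close>, a zero denominator only contributes \<open>0\<close>, so
  \<open>y\<close> carries no side condition.\<close>

definition fractions :: "'a::field set \<Rightarrow> 'a set" where
  "fractions R = {x / y | x y. x \<in> R \<and> y \<in> R}"

definition polys_over :: "'a::zero set \<Rightarrow> 'a poly set" where
  "polys_over R = {q. \<forall>i. Polynomial.coeff q i \<in> R}"

context
  fixes B :: "'a::comm_ring_1 set"
  assumes B: "is_subring B"
begin

lemma subring_one: "1 \<in> B"
  and subring_diff: "x \<in> B \<Longrightarrow> y \<in> B \<Longrightarrow> x - y \<in> B"
  and subring_mult: "x \<in> B \<Longrightarrow> y \<in> B \<Longrightarrow> x * y \<in> B"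
  using B by (auto simp: is_subring_def)

lemma subring_zero: "0 \<in> B"
  using subring_diff[OF subring_one subring_one] by simp

lemma subring_uminus: "x \<in> B \<Longrightarrow> - x \<in> B"
  using subring_diff[OF subring_zero, of x] by simp

lemma subring_add: "x \<in> B \<Longrightarrow> y \<in> B \<Longrightarrow> x + y \<in> B"
  using subring_diff[of x "- y"] subring_uminus[of y] by simp

lemma subring_power: "x \<in> B \<Longrightarrow> x ^ n \<in> B"
  by (induction n) (auto intro: subring_one subring_mult)

lemma subring_sum: "(\<And>i. i \<in> I \<Longrightarrow> f i \<in> B) \<Longrightarrow> sum f I \<in> B"
  by (induction I rule: infinite_finite_induct) (auto intro: subring_zero subring_add)

lemma subring_of_nat: "of_nat n \<in> B"
  by (induction n) (auto intro: subring_zero subring_one subring_add)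

lemma subring_of_int: "of_int n \<in> B"
  by (cases n rule: int_cases2) (auto intro: subring_uminus subring_of_nat)

lemma subring_poly: "q \<in> polys_over B \<Longrightarrow> x \<in> B \<Longrightarrow> poly q x \<in> B"
  unfolding poly_altdef polys_over_def
  by (auto intro!: subring_sum subring_mult subring_power)

lemma polys_over_const: "c \<in> B \<Longrightarrow> [:c:] \<in> polys_over B"
  by (auto simp: polys_over_def coeff_pCons subring_zero split: nat.split)

lemma polys_over_pCons: "c \<in> B \<Longrightarrow> q \<in> polys_over B \<Longrightarrow> pCons c q \<in> polys_over B"
  by (auto simp: polys_over_def coeff_pCons split: nat.split)

lemma polys_over_mult: "q \<in> polys_over B \<Longrightarrow> r \<in> polys_over B \<Longrightarrow> q * r \<in> polys_over B"
  by (auto simp: polys_over_def coeff_mult intro!: subring_sum subring_mult)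

lemma polys_over_add: "q \<in> polys_over B \<Longrightarrow> r \<in> polys_over B \<Longrightarrow> q + r \<in> polys_over B"
  by (auto simp: polys_over_def intro!: subring_add)

lemma polys_over_diff: "q \<in> polys_over B \<Longrightarrow> r \<in> polys_over B \<Longrightarrow> q - r \<in> polys_over B"
  by (auto simp: polys_over_def intro!: subring_diff)

lemma polys_over_smult: "c \<in> B \<Longrightarrow> q \<in> polys_over B \<Longrightarrow> smult c q \<in> polys_over B"
  by (auto simp: polys_over_def intro!: subring_mult)

lemma polys_over_0: "0 \<in> polys_over B"
  by (auto simp: polys_over_def subring_zero)

lemma polys_over_is_subring: "is_subring (polys_over B)"
  unfolding is_subring_def
  using polys_over_const[OF subring_one] polys_over_mult polys_over_diff by (auto simp: one_pCons)

lemma polys_over_pcompose: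
  assumes "q \<in> polys_over B" "r \<in> polys_over B" shows "pcompose q r \<in> polys_over B"
  using assms(1)
proof (induction q)
  case 0
  then show ?case by (simp add: polys_over_0)
next
  case (pCons a q)
  have "a \<in> B" "q \<in> polys_over B"
    using pCons.prems unfolding polys_over_def
    by (simp_all, metis coeff_pCons_0, metis coeff_pCons_Suc)
  then show ?case
    using pCons.IH assms(2) by (simp add: pcompose_pCons polys_over_add polys_over_mult polys_over_const)
qed

lemma adjoin_is_subring: "is_subring ((\<lambda>q. poly q x) ` polys_over B)"
  unfolding is_subring_def
proof (intro conjI ballI)
  show "1 \<in> (\<lambda>q. poly q x) ` polys_over B"
    using polys_over_const[OF subring_one] by (intro image_eqI[of _ _ "[:1:]"]) auto
next
  fix a b assume "a \<in> (\<lambda>q. poly q x) ` polys_over B" "b \<in> (\<lambda>q. poly q x) ` polys_over B"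
  then obtain q r where "a = poly q x" "b = poly r x" "q \<in> polys_over B" "r \<in> polys_over B" by blast
  then have "a - b = poly (q - r) x" "a * b = poly (q * r) x"
    and "q - r \<in> polys_over B" "q * r \<in> polys_over B"
    using polys_over_diff polys_over_mult by auto
  then show "a - b \<in> (\<lambda>q. poly q x) ` polys_over B" "a * b \<in> (\<lambda>q. poly q x) ` polys_over B"
    by blast+
qed

end

section \<open>Fraction fields inside the ambient field\<close>

lemma subfield_subring: "is_subfield K \<Longrightarrow> is_subring K"
  by (simp add: is_subfield_def)

lemma subfield_inverse: "is_subfield K \<Longrightarrow> x \<in> K \<Longrightarrow> inverse x \<in> K"
  by (simp add: is_subfield_def)

lemma subfield_divide: "is_subfield K \<Longrightarrow> x \<in> K \<Longrightarrow> y \<in> K \<Longrightarrow> x / y \<in> K"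
  by (simp add: divide_inverse subring_mult[OF subfield_subring] subfield_inverse)

lemma fractionsI: "x \<in> R \<Longrightarrow> y \<in> R \<Longrightarrow> z = x / y \<Longrightarrow> z \<in> fractions R"
  unfolding fractions_def by auto

lemma fractions_subfield:
  assumes R: "is_subring R"
  shows "is_subfield (fractions R)"
  unfolding is_subfield_def is_subring_def
proof (intro conjI ballI)
  show "1 \<in> fractions R" using subring_one[OF R] by (rule fractionsI[of 1 _ 1]) (auto simp: subring_one[OF R])
next
  fix a b assume "a \<in> fractions R" "b \<in> fractions R"
  then obtain x y x' y' where *: "a = x / y" "b = x' / y'" "x \<in> R" "y \<in> R" "x' \<in> R" "y' \<in> R"
    unfolding fractions_def by auto
  show "a * b \<in> fractions R"
    using * by (intro fractionsI[of "x * x'" _ "y * y'"] subring_mult[OF R]) auto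
  consider "y = 0" | "y' = 0" | "y \<noteq> 0" "y' \<noteq> 0" by blast
  then show "a - b \<in> fractions R"
  proof cases
    case 1
    then show ?thesis using * by (intro fractionsI[of "- x'" _ y'] subring_uminus[OF R]) auto
  next
    case 2
    then show ?thesis using * by (intro fractionsI[of x _ y]) auto
  next
    case 3
    then show ?thesis using *
      by (intro fractionsI[of "x * y' - x' * y" _ "y * y'"] subring_diff[OF R] subring_mult[OF R])
         (auto simp: diff_frac_eq)
  qed
next
  fix a assume "a \<in> fractions R"
  then obtain x y where "a = x / y" "x \<in> R" "y \<in> R" unfolding fractions_def by auto
  then show "inverse a \<in> fractions R" by (intro fractionsI[of y _ x]) auto
qed

lemma subset_fractions: assumes "is_subring R" shows "R \<subseteq> fractions R"
proof
  fix x assume "x \<in> R"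
  moreover have "x = x / 1" by simp
  ultimately show "x \<in> fractions R" unfolding fractions_def using subring_one[OF assms] by blast
qed

lemma fractions_mono: "R \<subseteq> R' \<Longrightarrow> fractions R \<subseteq> fractions R'"
  unfolding fractions_def by blast


text \<open>\<open>K\<close> is only a subring: values are first constructed on rings (the integers,
  polynomials) and reach their fractions through \<open>fraction_extension\<close>.\<close>

locale nonarch =
  fixes K :: "'a::field set" and f :: "'a \<Rightarrow> real"
  assumes K: "is_subring K"
    and f0: "f 0 = 0"
    and f_pos: "x \<in> K \<Longrightarrow> x \<noteq> 0 \<Longrightarrow> f x > 0"
    and f_mult: "x \<in> K \<Longrightarrow> y \<in> K \<Longrightarrow> f (x * y) = f x * f y"
    and f_add: "x \<in> K \<Longrightarrow> y \<in> K \<Longrightarrow> f (x + y) \<le> max (f x) (f y)"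
begin

lemma f_nonneg: "x \<in> K \<Longrightarrow> f x \<ge> 0"
  using f_pos[of x] f0 by (cases "x = 0") auto

lemma f_eq_0: "x \<in> K \<Longrightarrow> f x = 0 \<longleftrightarrow> x = 0"
  using f_pos[of x] f0 by (cases "x = 0") auto

lemma f_one: "f 1 = 1"
  using f_mult[of 1 1] f_pos[of 1] subring_one[OF K] by simp

lemma f_uminus: assumes "x \<in> K" shows "f (- x) = f x"
proof -
  have "f (-1) * f (-1) = 1"
    using f_mult[of "-1" "-1"] subring_uminus[OF K subring_one[OF K]] f_one by simp
  then have "f (-1) = 1"
    using f_nonneg[OF subring_uminus[OF K subring_one[OF K]]] by (metis abs_of_nonneg real_sqrt_abs2 real_sqrt_one)
  then show ?thesis using f_mult[of "-1" x] assms subring_uminus[OF K subring_one[OF K]] by simp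
qed

lemma f_diff: assumes "x \<in> K" "y \<in> K" shows "f (x - y) \<le> max (f x) (f y)"
  using f_add[of x "- y"] assms f_uminus[of y] subring_uminus[OF K] by simp

lemma f_diff_commute: assumes "x \<in> K" "y \<in> K" shows "f (x - y) = f (y - x)"
  using f_uminus[OF subring_diff[OF K assms]] by simp

lemma f_power: "x \<in> K \<Longrightarrow> f (x ^ n) = f x ^ n"
  by (induction n) (auto simp: f_one f_mult subring_power[OF K])

lemma f_sum_le: "(\<And>i. i \<in> I \<Longrightarrow> g i \<in> K \<and> f (g i) \<le> c) \<Longrightarrow> c \<ge> 0 \<Longrightarrow> f (sum g I) \<le> c"
proof (induction I rule: infinite_finite_induct)
  case (insert i I)
  have "f (g i + sum g I) \<le> max (f (g i)) (f (sum g I))"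
    using insert by (intro f_add subring_sum[OF K]) auto
  then show ?case using insert by force
qed (auto simp: f0)

lemma f_sum_less: "(\<And>i. i \<in> I \<Longrightarrow> g i \<in> K \<and> f (g i) < c) \<Longrightarrow> c > 0 \<Longrightarrow> f (sum g I) < c"
proof (induction I rule: infinite_finite_induct)
  case (insert i I)
  have "f (g i + sum g I) \<le> max (f (g i)) (f (sum g I))"
    using insert by (intro f_add subring_sum[OF K]) auto
  then show ?case using insert by force
qed (auto simp: f0)

text \<open>The strict ultrametric principle: as \<open>y = (x + y) - x\<close> and
  \<open>f x < f y\<close>, the larger term cannot cancel.\<close>

lemma f_add_eq: assumes "x \<in> K" "y \<in> K" "f x < f y" shows "f (x + y) = f y"
proof -
  have "f (x + y) \<le> f y" using f_add[of x y] assms by simp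
  moreover have "f y \<le> max (f (x + y)) (f x)"
    using f_diff[of "x + y" x] assms subring_add[OF K] by simp
  ultimately show ?thesis using assms by auto
qed

lemma f_eq_if_diff_less: assumes "x \<in> K" "y \<in> K" "f (x - y) < f y" shows "f x = f y"
  using f_add_eq[of "x - y" y] assms subring_diff[OF K] by simp

lemma f_diff_triangle:
  assumes "x \<in> K" "y \<in> K" "z \<in> K" shows "f (x - z) \<le> max (f (x - y)) (f (y - z))"
  using f_add[of "x - y" "y - z"] assms subring_diff[OF K] by simp

lemma integers_subring: "is_subring {x \<in> K. f x \<le> 1}"
  unfolding is_subring_def
  using subring_one[OF K] subring_diff[OF K] subring_mult[OF K] f_one f_mult f_nonneg
  by (auto intro: mult_le_one order_trans[OF f_diff])

lemma fraction_extension: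
  obtains f' where "nonarch (fractions K) f'" "\<And>x. x \<in> K \<Longrightarrow> f' x = f x"
proof -
  define P where "P z u \<longleftrightarrow> (\<exists>x\<in>K. \<exists>y\<in>K. y \<noteq> 0 \<and> z = x / y \<and> u = f x / f y)" for z u
  define f' where "f' z = (SOME u. P z u)" for z
  \<comment> \<open>Independence of the presentation: \<open>x / y = x' / y'\<close> gives
    \<open>x * y' = x' * y\<close>, and \<open>f\<close> is multiplicative.\<close>
  have f': "f' (x / y) = f x / f y" if "x \<in> K" "y \<in> K" "y \<noteq> 0" for x y
  proof -
    have "P (x / y) (f x / f y)" using that unfolding P_def by blast
    then have "P (x / y) (f' (x / y))" unfolding f'_def by (rule someI)
    then obtain x' y' where *: "x' \<in> K" "y' \<in> K" "y' \<noteq> 0" "x / y = x' / y'" "f' (x / y) = f x' / f y'"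
      unfolding P_def by blast
    have "x * y' = x' * y" using * that by (simp add: field_simps)
    then have "f x * f y' = f x' * f y" using f_mult * that by metis
    then have "f x / f y = f x' / f y'"
      using * that f_pos[of y] f_pos[of y'] by (simp add: frac_eq_eq)
    then show ?thesis using * by simp
  qed
  have frac: "\<exists>x\<in>K. \<exists>y\<in>K. y \<noteq> 0 \<and> z = x / y" if z: "z \<in> fractions K" for z
  proof -
    obtain x y where xy: "z = x / y" "x \<in> K" "y \<in> K" using z unfolding fractions_def by blast
    show ?thesis
    proof (cases "y = 0")
      case True
      then have "z = 0 / 1" using xy by simp
      then show ?thesis using subring_zero[OF K] subring_one[OF K] by (metis zero_neq_one)
    qed (use xy in blast)
  qed
  have "nonarch (fractions K) f'"
  proof
    show "is_subring (fractions K)" using fractions_subfield[OF K] by (rule subfield_subring)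
    show "f' 0 = 0" using f'[of 0 1] subring_zero[OF K] subring_one[OF K] f0 by simp
  next
    fix x assume "x \<in> fractions K" "x \<noteq> 0"
    then obtain a b where "a \<in> K" "b \<in> K" "b \<noteq> 0" "x = a / b" using frac by blast
    moreover then have "a \<noteq> 0" using \<open>x \<noteq> 0\<close> by auto
    ultimately show "f' x > 0" using f' f_pos by simp
  next
    fix x y assume "x \<in> fractions K" "y \<in> fractions K"
    then obtain a b a' b' where *: "a \<in> K" "b \<in> K" "b \<noteq> 0" "x = a / b" "a' \<in> K" "b' \<in> K" "b' \<noteq> 0" "y = a' / b'"
      using frac by meson
    have "f' ((a * a') / (b * b')) = f (a * a') / f (b * b')"
      using * by (intro f' subring_mult[OF K]) auto
    then show "f' (x * y) = f' x * f' y" using * f' f_mult by simp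
    have xy: "x + y = (a * b' + a' * b) / (b * b')" using * by (simp add: field_simps)
    have p: "f b > 0" "f b' > 0" using * f_pos by auto
    have "f' (x + y) = f (a * b' + a' * b) / (f b * f b')"
      unfolding xy using * f_mult by (subst f') (auto intro!: subring_add[OF K] subring_mult[OF K])
    also have "\<dots> \<le> max (f (a * b')) (f (a' * b)) / (f b * f b')"
      using * p by (intro divide_right_mono f_add subring_mult[OF K]) auto
    also have "\<dots> = max (f a / f b) (f a' / f b')"
      unfolding f_mult[OF *(1,6)] f_mult[OF *(5,2)]
      using p by (auto simp: max_def field_simps)
    also have "\<dots> = max (f' x) (f' y)" using * f' by simp
    finally show "f' (x + y) \<le> max (f' x) (f' y)" .
  qed
  moreover have "f' x = f x" if "x \<in> K" for x
    using f'[of x 1] that subring_one[OF K] f_one by simp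
  ultimately show ?thesis using that by blast
qed

end

locale nonarch_field = nonarch +
  assumes K_field: "is_subfield K"
begin

lemma f_inverse: assumes "x \<in> K" shows "f (inverse x) = inverse (f x)"
proof (cases "x = 0")
  case False
  then have "f x * f (inverse x) = 1"
    using f_mult[of x "inverse x"] f_one assms subfield_inverse[OF K_field] by simp
  then show ?thesis by (metis inverse_unique)
qed (simp add: f0)

lemma f_divide: "x \<in> K \<Longrightarrow> y \<in> K \<Longrightarrow> f (x / y) = f x / f y"
  by (simp add: divide_inverse f_mult f_inverse subfield_inverse[OF K_field])

end

section \<open>Algebraic extensions\<close>

text \<open>Zorn's lemma. Maximality appears in the form used later: for \<open>x\<close> outside
  \<open>B\<close> the ring \<open>B[x]\<close> is strictly larger, so it must contain
  \<open>z\<close>, and \<open>z\<close> is a polynomial in \<open>x\<close> over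
  \<open>B\<close>.\<close>

lemma maximal_subring:
  fixes A :: "'a::field set"
  assumes "is_subring A" "z \<notin> A"
  obtains B where "is_subring B" "A \<subseteq> B" "z \<notin> B"
    "\<And>x. x \<notin> B \<Longrightarrow> \<exists>q\<in>polys_over B. poly q x = z"
proof -
  define \<A> where "\<A> = {B. is_subring B \<and> A \<subseteq> B \<and> z \<notin> B}"
  have "\<exists>M\<in>\<A>. \<forall>D\<in>\<A>. M \<subseteq> D \<longrightarrow> D = M"
  proof (rule subset_Zorn_nonempty)
    show "\<A> \<noteq> {}" using assms unfolding \<A>_def by blast
  next
    fix \<C> assume ne: "\<C> \<noteq> {}" and ch: "subset.chain \<A> \<C>"
    have sub: "\<And>B. B \<in> \<C> \<Longrightarrow> is_subring B \<and> A \<subseteq> B \<and> z \<notin> B"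
      using ch unfolding subset.chain_def \<A>_def by blast
    have "is_subring (\<Union>\<C>)"
      unfolding is_subring_def
    proof (intro conjI ballI)
      show "1 \<in> \<Union>\<C>" using ne sub subring_one by blast
      fix x y assume "x \<in> \<Union>\<C>" "y \<in> \<Union>\<C>"
      then obtain D E where DE: "x \<in> D" "y \<in> E" "D \<in> \<C>" "E \<in> \<C>" by blast
      then have "D \<subseteq> E \<or> E \<subseteq> D" using ch unfolding subset.chain_def by blast
      then obtain Z where "x \<in> Z" "y \<in> Z" "Z \<in> \<C>" using DE by blast
      then show "x - y \<in> \<Union>\<C>" "x * y \<in> \<Union>\<C>"
        using sub subring_diff[of Z x y] subring_mult[of Z x y] by blast+
    qed
    moreover obtain D where "D \<in> \<C>" using ne by blast
    then have "A \<subseteq> \<Union>\<C>" using sub[of D] by auto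
    moreover have "z \<notin> \<Union>\<C>" using sub by auto
    ultimately show "\<Union>\<C> \<in> \<A>" unfolding \<A>_def by simp
  qed
  then obtain B where BA: "B \<in> \<A>" and Bmax: "\<forall>D\<in>\<A>. B \<subseteq> D \<longrightarrow> D = B" by (elim bexE)
  have B: "is_subring B" "A \<subseteq> B" "z \<notin> B" using BA by (simp_all add: \<A>_def)
  have max: "D = B" if "is_subring D" "z \<notin> D" "B \<subseteq> D" for D
    using Bmax that B(2) by (auto simp: \<A>_def)
  have "\<exists>q\<in>polys_over B. poly q x = z" if x: "x \<notin> B" for x
  proof (rule ccontr)
    assume neg: "\<not> ?thesis"
    let ?X = "(\<lambda>q. poly q x) ` polys_over B"
    have "B \<subseteq> ?X" using polys_over_const[OF B(1)] by force
    moreover have "z \<notin> ?X" using neg by blast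
    ultimately have "?X = B" using max adjoin_is_subring[OF B(1)] by blast
    moreover have "[:0, 1:] \<in> polys_over B"
      using polys_over_pCons[OF B(1) subring_zero[OF B(1)] polys_over_const[OF B(1) subring_one[OF B(1)]]] .
    then have "x \<in> ?X" by (intro image_eqI[of _ _ "[:0, 1:]"]) auto
    ultimately show False using x by blast
  qed
  with B show ?thesis using that by blast
qed

section \<open>Maximal subrings without \<open>1 / \<pi>\<close> are valuation rings\<close>

lemma reflect_poly_over:
  assumes "is_subring B" "q \<in> polys_over B" shows "reflect_poly q \<in> polys_over B"
  using assms subring_zero[OF assms(1)] by (auto simp: polys_over_def coeff_reflect_poly)

locale maximal_subring =
  fixes B :: "'a::field set" and \<pi> :: 'a
  assumes B: "is_subring B"
    and \<pi>: "\<pi> \<in> B" "\<pi> \<noteq> 0" "inverse \<pi> \<notin> B"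
    and maximal: "\<And>x. x \<notin> B \<Longrightarrow> \<exists>q\<in>polys_over B. poly q x = inverse \<pi>"
begin

text \<open>Puts \<open>\<pi>\<close> into the Jacobson radical. If the inverse of
  \<open>u = 1 - \<pi> * b\<close> were missing from \<open>B\<close>, then \<open>1 / \<pi>\<close>
  would be a polynomial of some degree \<open>k\<close> in \<open>1 / u\<close>; multiplying by
  \<open>u ^ k\<close> gives \<open>u ^ k / \<pi> \<in> B\<close>. As \<open>u ^ k\<close> is
  \<open>1\<close> modulo \<open>\<pi>\<close>, this would put \<open>1 / \<pi>\<close> itself into
  \<open>B\<close>.\<close>

lemma one_minus_unit:
  assumes b: "b \<in> B" shows "inverse (1 - \<pi> * b) \<in> B"
proof (rule ccontr)
  define u where "u = 1 - \<pi> * b"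
  assume "inverse (1 - \<pi> * b) \<notin> B"
  then obtain q where q: "q \<in> polys_over B" "poly q (inverse u) = inverse \<pi>"
    using maximal unfolding u_def by blast
  have uB: "u \<in> B" unfolding u_def by (intro subring_diff[OF B] subring_one[OF B] subring_mult[OF B] \<pi> b)
  have u0: "u \<noteq> 0"
  proof
    assume "u = 0"
    then have "b = inverse \<pi>" using \<pi> by (simp add: u_def field_simps)
    then show False using b \<pi> by simp
  qed
  define c where "c = poly (reflect_poly q) u"
  have cB: "c \<in> B" unfolding c_def by (intro subring_poly[OF B] reflect_poly_over[OF B] q uB)
  have c: "c = u ^ degree q * inverse \<pi>" unfolding c_def using u0 q by (simp add: poly_reflect_poly_nz)
  have pow: "\<exists>b'\<in>B. u ^ k = 1 - \<pi> * b'" for k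
  proof (induction k)
    case 0
    show ?case using subring_zero[OF B] by (intro bexI[of _ 0]) auto
  next
    case (Suc k)
    then obtain b' where b': "b' \<in> B" "u ^ k = 1 - \<pi> * b'" by blast
    have "u ^ Suc k = (1 - \<pi> * b) * (1 - \<pi> * b')" by (simp add: b'(2) flip: u_def)
    also have "\<dots> = 1 - \<pi> * (b' + b - \<pi> * b * b')" by (simp add: algebra_simps)
    finally show ?case
      using b b' \<pi> by (intro bexI[of _ "b' + b - \<pi> * b * b'"] subring_diff[OF B] subring_add[OF B] subring_mult[OF B]) auto
  qed
  then obtain b' where b': "b' \<in> B" "u ^ degree q = 1 - \<pi> * b'" by blast
  then have "\<pi> * c = 1 - \<pi> * b'" using c \<pi> by simp
  then have "\<pi> * (c + b') = 1" by (simp add: algebra_simps)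
  then have "inverse \<pi> = c + b'" by (metis inverse_unique)
  then show False using \<pi> subring_add[OF B cB b'(1)] by simp
qed

text \<open>The descent behind the valuation property. In the relation for \<open>y = 1 / x\<close>
  the factor \<open>1 - \<pi> * r0\<close> is a unit of \<open>B\<close>, so multiplication by
  \<open>x ^ n\<close> expresses \<open>x ^ n\<close> as \<open>\<pi>\<close> times a polynomial in
  \<open>x\<close> of degree below \<open>n\<close>; substituting this for the top power in
  \<open>q\<close> lowers the degree.\<close>

lemma lower_degree:
  assumes xy: "x * y = 1"
    and q: "q \<in> polys_over B" "degree q \<le> n" "\<pi> * poly q x = 1"
    and r: "r \<in> polys_over B" "degree r \<le> m" "\<pi> * poly r y = 1"
    and mn: "m \<le> n" "0 < n"
  shows "\<exists>q'\<in>polys_over B. degree q' \<le> n - 1 \<and> \<pi> * poly q' x = 1"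
proof -
  define r0 where "r0 = Polynomial.coeff r 0"
  define w where "w = inverse (1 - \<pi> * r0)"
  have rB: "Polynomial.coeff r i \<in> B" and qB: "Polynomial.coeff q i \<in> B" for i
    using q r by (auto simp: polys_over_def)
  have wB: "w \<in> B" unfolding w_def using rB one_minus_unit by (simp add: r0_def)
  have ne: "1 - \<pi> * r0 \<noteq> 0"
  proof
    assume "1 - \<pi> * r0 = 0"
    then have "r0 = inverse \<pi>" using \<pi> by (simp add: field_simps)
    then show False using rB \<pi> unfolding r0_def by metis
  qed
  \<comment> \<open>Solves the relation for the top power, giving
    \<open>x ^ n = \<pi> * poly s x\<close>. No exponent \<open>n - i\<close> is truncated because
    \<open>i \<le> m \<le> n\<close>, and \<open>i \<ge> 1\<close> keeps the degree below
    \<open>n\<close>.\<close>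
  define s where "s = (\<Sum>i=1..m. Polynomial.monom (w * Polynomial.coeff r i) (n - i))"
  have sB: "s \<in> polys_over B"
    unfolding s_def
    by (intro subring_sum[OF polys_over_is_subring[OF B]])
       (auto simp: polys_over_def intro!: subring_mult[OF B] wB rB subring_zero[OF B])
  have sdeg: "degree s \<le> n - 1"
    unfolding s_def by (intro degree_sum_le) (auto intro: order_trans[OF degree_monom_le])
  have "poly r y = (\<Sum>i\<le>m. Polynomial.coeff r i * y ^ i)"
    unfolding poly_altdef using r(2) by (intro sum.mono_neutral_left) (auto simp: coeff_eq_0)
  also have "\<dots> = r0 + (\<Sum>i=1..m. Polynomial.coeff r i * y ^ i)"
    by (simp add: r0_def atMost_atLeast0 sum.atLeast_Suc_atMost)
  finally have "1 - \<pi> * r0 = \<pi> * (\<Sum>i=1..m. Polynomial.coeff r i * y ^ i)"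
    using r(3) by (simp add: algebra_simps)
  then have "x ^ n * (1 - \<pi> * r0) = x ^ n * (\<pi> * (\<Sum>i=1..m. Polynomial.coeff r i * y ^ i))"
    by simp
  also have "\<dots> = \<pi> * (\<Sum>i=1..m. Polynomial.coeff r i * (x ^ n * y ^ i))"
    by (simp add: sum_distrib_left mult_ac)
  also have "(\<Sum>i=1..m. Polynomial.coeff r i * (x ^ n * y ^ i)) = (\<Sum>i=1..m. Polynomial.coeff r i * x ^ (n - i))"
  proof (rule sum.cong)
    fix i assume "i \<in> {1..m}"
    then have "n = (n - i) + i" using mn by auto
    then have "x ^ n * y ^ i = x ^ (n - i) * (x * y) ^ i" by (metis mult.assoc power_add power_mult_distrib)
    then show "Polynomial.coeff r i * (x ^ n * y ^ i) = Polynomial.coeff r i * x ^ (n - i)" using xy by simp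
  qed simp
  finally have "x ^ n = w * (\<pi> * (\<Sum>i=1..m. Polynomial.coeff r i * x ^ (n - i)))"
    using ne unfolding w_def by (simp add: field_simps)
  also have "\<dots> = \<pi> * poly s x"
    by (simp add: s_def poly_sum poly_monom sum_distrib_left mult_ac)
  finally have xn: "x ^ n = \<pi> * poly s x" .
  define q1 where "q1 = q - Polynomial.monom (Polynomial.coeff q n) n"
  have q1B: "q1 \<in> polys_over B" unfolding q1_def
    by (intro polys_over_diff[OF B] q) (auto simp: polys_over_def qB subring_zero[OF B])
  have q1deg: "degree q1 \<le> n - 1"
  proof (rule degree_le, intro allI impI)
    fix i assume "n - 1 < i"
    then have "i = n \<or> i > degree q" using q(2) mn by linarith
    then show "Polynomial.coeff q1 i = 0" by (auto simp: q1_def coeff_eq_0)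
  qed
  \<comment> \<open>\<open>q\<close> with \<open>x ^ n\<close> replaced by \<open>\<pi> * s\<close>;
    the value at \<open>x\<close> is unchanged.\<close>
  define q' where "q' = q1 + smult (Polynomial.coeff q n * \<pi>) s"
  have "q' \<in> polys_over B" unfolding q'_def
    by (intro polys_over_add[OF B] polys_over_smult[OF B] subring_mult[OF B] q1B sB qB \<pi>)
  moreover have "degree q' \<le> n - 1" unfolding q'_def
    using q1deg sdeg by (intro degree_add_le) (auto intro: order_trans[OF degree_smult_le])
  moreover have "poly q x = poly q1 x + Polynomial.coeff q n * x ^ n"
    by (simp add: q1_def poly_monom)
  then have "poly q' x = poly q x" by (simp add: q'_def xn)
  ultimately show ?thesis using q by auto
qed

text \<open>If \<open>x\<close> and \<open>1 / x\<close> were both missing, each would satisfy a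
  relation as in \<open>lower_degree\<close>. With both degrees minimal, the larger one (either, if
  they agree) could still be lowered.\<close>

lemma valuation_ring: "x \<in> B \<or> inverse x \<in> B"
proof (rule ccontr)
  assume neg: "\<not> ?thesis"
  then have x0: "x \<noteq> 0" using subring_zero[OF B] by auto
  define E where "E z n \<longleftrightarrow> (\<exists>q\<in>polys_over B. degree q \<le> n \<and> \<pi> * poly q z = 1)" for z n
  have ex: "\<exists>n. E z n" if z: "z \<notin> B" for z
  proof -
    obtain q where "q \<in> polys_over B" "poly q z = inverse \<pi>" using maximal[OF z] by blast
    then show ?thesis using \<pi> unfolding E_def by (intro exI[of _ "degree q"] bexI[of _ q]) auto
  qed
  \<comment> \<open>Degree 0 would make \<open>1 / \<pi>\<close> a constant from \<open>B\<close>;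
    so the minimal degrees are positive, as \<open>lower_degree\<close> requires.\<close>
  have not0: "\<not> E z 0" for z
  proof
    assume "E z 0"
    then obtain q where q: "q \<in> polys_over B" "degree q = 0" "\<pi> * poly q z = 1" unfolding E_def by auto
    then obtain c where "q = [:c:]" by (metis degree_eq_zeroE)
    then have c: "c \<in> B" "\<pi> * c = 1" using q by (auto simp: polys_over_def coeff_pCons split: nat.splits dest: spec[of _ 0])
    then show False using \<pi> by (metis inverse_unique)
  qed
  define n where "n = (LEAST n. E x n)"
  define m where "m = (LEAST m. E (inverse x) m)"
  have n: "E x n" "\<And>k. E x k \<Longrightarrow> n \<le> k" and m: "E (inverse x) m" "\<And>k. E (inverse x) k \<Longrightarrow> m \<le> k"
    unfolding n_def m_def using ex neg by (auto intro: LeastI_ex Least_le)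
  have n0: "n > 0" "m > 0" using n m not0 by (metis gr0I)+
  have *: "E z (i - 1)" if "E z i" "E y j" "j \<le> i" "0 < i" "z * y = 1" for z y i j
    using lower_degree[of z y _ i _ j] that unfolding E_def by blast
  show False
  proof (cases "m \<le> n")
    case True
    then have "E x (n - 1)" using *[of x n "inverse x" m] n m n0 x0 by simp
    then show False using n(2)[of "n - 1"] n0 by simp
  next
    case False
    then have "E (inverse x) (m - 1)" using *[of "inverse x" m x n] n m n0 x0 by simp
    then show False using m(2)[of "m - 1"] n0 by simp
  qed
qed

section \<open>Units of the valuation ring, and powers of algebraic elements\<close>

definition units :: "'a set" where "units = {u. u \<noteq> 0 \<and> u \<in> B \<and> inverse u \<in> B}"

lemma units_mult: "u \<in> units \<Longrightarrow> w \<in> units \<Longrightarrow> u * w \<in> units"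
  by (auto simp: units_def subring_mult[OF B])

lemma units_inverse: "u \<in> units \<Longrightarrow> inverse u \<in> units"
  by (auto simp: units_def)

lemma units_divide: "u \<in> units \<Longrightarrow> w \<in> units \<Longrightarrow> u / w \<in> units"
  by (simp add: divide_inverse units_mult units_inverse)

lemma units_power: "u \<in> units \<Longrightarrow> u ^ k \<in> units"
  by (auto simp: units_def subring_power[OF B] simp flip: power_inverse)

text \<open>\<open>B\<close> is local. One of \<open>y / z\<close> and \<open>z / y\<close> lies in
  \<open>B\<close>, say the first; then \<open>y + z = z * (y / z + 1)\<close>, so \<open>z\<close>
  divides a unit.\<close>

lemma unit_summand:
  assumes "y \<in> B" "z \<in> B" "y + z \<in> units" shows "y \<in> units \<or> z \<in> units"
proof -
  have *: "z \<in> units" if "y \<in> B" "z \<in> B" "y + z \<in> units" "y / z \<in> B" "z \<noteq> 0" for y z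
  proof -
    have "y + z \<noteq> 0" using that by (auto simp: units_def)
    then have "inverse z = (y / z + 1) * inverse (y + z)" using that by (simp add: field_simps)
    also have "\<dots> \<in> B"
      using that by (intro subring_mult[OF B] subring_add[OF B] subring_one[OF B]) (auto simp: units_def)
    finally show ?thesis using that by (auto simp: units_def)
  qed
  show ?thesis
  proof (cases "y = 0 \<or> z = 0")
    case False
    have "y / z \<in> B \<or> z / y \<in> B" using valuation_ring[of "y / z"] by simp
    then show ?thesis using *[of y z] *[of z y] assms False by (auto simp: add.commute)
  qed (use assms in auto)
qed

lemma unit_summand_sum:
  "finite I \<Longrightarrow> (\<And>i. i \<in> I \<Longrightarrow> y i \<in> B) \<Longrightarrow> sum y I \<in> units \<Longrightarrow> \<exists>i\<in>I. y i \<in> units"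
proof (induction I rule: finite_induct)
  case empty
  then show ?case by (simp add: units_def)
next
  case (insert i I)
  then have "y i \<in> units \<or> sum y I \<in> units"
    using unit_summand[of "y i" "sum y I"] subring_sum[OF B, of I y] by auto
  then show ?case using insert by auto
qed

text \<open>A case of integral closedness: if \<open>1 / x\<close> is in \<open>B\<close>, then so
  is \<open>x = x ^ k * (1 / x) ^ (k - 1)\<close>.\<close>

lemma root_in: assumes "x ^ k \<in> B" "k > 0" shows "x \<in> B"
proof (rule ccontr)
  assume x: "x \<notin> B"
  then have "inverse x \<in> B" "x \<noteq> 0" using valuation_ring subring_zero[OF B] by auto
  then have "x ^ k * inverse x ^ (k - 1) \<in> B" using assms
    by (intro subring_mult[OF B _ subring_power[OF B]])
  moreover have "x ^ k = x * x ^ (k - 1)" using assms by (simp add: power_eq_if)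
  then have "x ^ k * inverse x ^ (k - 1) = x"
    using \<open>x \<noteq> 0\<close> by (simp add: mult.assoc flip: power_mult_distrib)
  ultimately show False using x by simp
qed

text \<open>Divisibility in a valuation ring is a total preorder, so a finite nonempty family has a
  member dividing all the others.\<close>

lemma dominant_term:
  assumes "finite I" "I \<noteq> {}" "\<And>i. i \<in> I \<Longrightarrow> y i \<noteq> 0"
  shows "\<exists>i0\<in>I. \<forall>i\<in>I. y i / y i0 \<in> B"
  using assms
proof (induction I rule: finite_ne_induct)
  case (singleton i)
  then show ?case by (auto simp: subring_one[OF B])
next
  case (insert j I)
  then obtain i0 where i0: "i0 \<in> I" "\<forall>i\<in>I. y i / y i0 \<in> B" by blast
  have nz: "y i0 \<noteq> 0" "y j \<noteq> 0" using insert i0 by auto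
  show ?case
  proof (cases "y j / y i0 \<in> B")
    case True
    then show ?thesis using i0 by auto
  next
    case False
    then have *: "y i0 / y j \<in> B" using valuation_ring[of "y j / y i0"] by simp
    have "y i / y j \<in> B" if "i \<in> I" for i
    proof -
      have "y i / y j = (y i / y i0) * (y i0 / y j)" using nz by simp
      then show ?thesis using subring_mult[OF B] i0 that * by metis
    qed
    then show ?thesis using nz subring_one[OF B] by auto
  qed
qed

text \<open>After division by a dominant term of the equation the remaining terms lie in
  \<open>B\<close> and sum to the unit \<open>-1\<close>, so one of them is a unit. Two terms of
  degrees \<open>i < j\<close> with unit ratio present \<open>x ^ (j - i)\<close> as a unit times
  the quotient of their coefficients.\<close>

lemma algebraic_power_unit:
  assumes K: "is_subfield K" and q: "q \<in> polys_over K" "q \<noteq> 0" "poly q x = 0" and x: "x \<noteq> 0"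
  shows "\<exists>a\<in>K. \<exists>k>0. a \<noteq> 0 \<and> x ^ k / a \<in> units"
proof -
  define I where "I = {i. i \<le> degree q \<and> Polynomial.coeff q i \<noteq> 0}"
  define y where "y i = Polynomial.coeff q i * x ^ i" for i
  have qK: "Polynomial.coeff q i \<in> K" for i using q by (simp add: polys_over_def)
  have I: "finite I" "I \<noteq> {}" unfolding I_def using q(2) by (auto intro!: exI[of _ "degree q"])
  have y: "y i \<noteq> 0" if "i \<in> I" for i using that x by (auto simp: y_def I_def)
  obtain i0 where i0: "i0 \<in> I" "\<forall>i\<in>I. y i / y i0 \<in> B"
    using dominant_term[OF I, of y] y by blast
  have "poly q x = sum y I"
    unfolding poly_altdef I_def y_def by (intro sum.mono_neutral_right) auto
  then have "(\<Sum>i\<in>I. y i / y i0) = 0" using q(3) by (simp flip: sum_divide_distrib)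
  then have "(\<Sum>i\<in>I-{i0}. y i / y i0) = -1"
    using I i0(1) y[OF i0(1)] by (simp add: sum.remove[of I i0] eq_neg_iff_add_eq_0 add.commute)
  moreover have "-1 \<in> units" using subring_uminus[OF B subring_one[OF B]] by (simp add: units_def)
  ultimately obtain i where i: "i \<in> I" "i \<noteq> i0" "y i / y i0 \<in> units"
    using unit_summand_sum[of "I - {i0}" "\<lambda>i. y i / y i0"] I i0 by auto
  have *: ?thesis if ij: "i \<in> I" "j \<in> I" "i < j" "y j / y i \<in> units" for i j
  proof -
    define a where "a = Polynomial.coeff q i / Polynomial.coeff q j"
    have nz: "Polynomial.coeff q i \<noteq> 0" "Polynomial.coeff q j \<noteq> 0" using ij by (auto simp: I_def)
    have "x ^ (j - i) / a = y j / y i"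
      using ij nz x by (simp add: a_def y_def field_simps flip: power_add)
    then show ?thesis using ij nz subfield_divide[OF K qK qK]
      by (intro bexI[of _ a] exI[of _ "j - i"]) (auto simp: a_def)
  qed
  show ?thesis
  proof (cases "i < i0")
    case True
    then show ?thesis using *[of i i0] i i0 units_inverse[OF i(3)] by simp
  next
    case False
    then show ?thesis using *[of i0 i] i i0 by simp
  qed
qed

end

text \<open>The new valuation ring is a maximal subring containing the old one but not \<open>1 / \<pi>\<close>.  Over an
  algebraic extension every \<open>x\<close> has a power \<open>x\<^sup>k\<close> that is a unit times some \<open>a\<close> of the base field, which
  dictates the value \<open>f a\<close> raised to \<open>1 / k\<close>.\<close>

theorem (in nonarch_field) algebraic_extension:
  assumes \<pi>: "\<pi> \<in> K" "\<pi> \<noteq> 0" "f \<pi> < 1"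
    and K': "is_subfield K'" "K \<subseteq> K'"
    and alg: "\<And>x. x \<in> K' \<Longrightarrow> \<exists>q\<in>polys_over K. q \<noteq> 0 \<and> poly q x = 0"
  obtains f' where "nonarch_field K' f'" "\<And>x. x \<in> K \<Longrightarrow> f' x = f x"
proof -
  define A where "A = {x \<in> K. f x \<le> 1}"
  have fpi: "f \<pi> > 0" using f_pos \<pi> by simp
  have "is_subring A" unfolding A_def by (rule integers_subring)
  moreover have "inverse \<pi> \<notin> A" unfolding A_def using \<pi> fpi by (simp add: f_inverse one_less_inverse not_le)
  ultimately obtain B where B: "is_subring B" "A \<subseteq> B" "inverse \<pi> \<notin> B"
    "\<And>x. x \<notin> B \<Longrightarrow> \<exists>q\<in>polys_over B. poly q x = inverse \<pi>"
    using maximal_subring by metis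
  interpret M: maximal_subring B \<pi>
    using B \<pi> by unfold_locales (auto simp: A_def)
  \<comment> \<open>\<open>B\<close> meets \<open>K\<close> only in the old valuation ring: if
    \<open>f a > 1\<close>, then \<open>1 / (\<pi> * a ^ k)\<close> has value at most 1 for large
    \<open>k\<close>, so it lies in \<open>B\<close>, and multiplying by \<open>a ^ k\<close> would
    give \<open>1 / \<pi>\<close>.\<close>
  have BK: "f a \<le> 1" if "a \<in> B" "a \<in> K" for a
  proof (rule ccontr)
    assume "\<not> f a \<le> 1"
    then obtain k where k: "inverse (f \<pi>) < f a ^ k" using real_arch_pow[of "f a" "inverse (f \<pi>)"] by auto
    have a0: "a \<noteq> 0" using \<open>\<not> f a \<le> 1\<close> f0 by auto
    have "inverse (\<pi> * a ^ k) \<in> K" using that \<pi>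
      by (intro subfield_inverse[OF K_field] subring_mult[OF K] subring_power[OF K])
    moreover have "f (inverse (\<pi> * a ^ k)) = inverse (f \<pi> * f a ^ k)"
      using that \<pi> f_mult[of \<pi> "a ^ k"] f_inverse[of "\<pi> * a ^ k"]
      by (simp add: f_power subring_mult[OF K] subring_power[OF K])
    moreover have "1 < f \<pi> * f a ^ k" using k fpi by (simp add: field_simps)
    ultimately have "inverse (\<pi> * a ^ k) \<in> A" unfolding A_def by (simp add: inverse_le_1_iff del: inverse_mult_distrib)
    then have "a ^ k * inverse (\<pi> * a ^ k) \<in> B" using B that subring_power[OF B(1)] subring_mult[OF B(1)] by blast
    moreover have "a ^ k * inverse (\<pi> * a ^ k) = inverse \<pi>" using a0 by simp
    ultimately show False using B(3) by metis
  qed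
  have UK: "f a = 1" if "a \<in> M.units" "a \<in> K" for a
  proof -
    have "f a \<le> 1" "inverse (f a) \<le> 1" "f a > 0"
      using that BK[of a] BK[of "inverse a"] f_inverse[of a] f_pos subfield_inverse[OF K_field]
      by (auto simp: M.units_def)
    then show ?thesis by (simp add: inverse_le_1_iff)
  qed
  define P where "P x u \<longleftrightarrow> u > 0 \<and> (\<exists>a\<in>K. \<exists>k>0. a \<noteq> 0 \<and> x ^ k / a \<in> M.units \<and> u ^ k = f a)" for x u
  define f' where "f' x = (if x = 0 then 0 else SOME u. P x u)" for x
  have P_ex: "\<exists>u. P x u" if "x \<in> K'" "x \<noteq> 0" for x
  proof -
    obtain q where "q \<in> polys_over K" "q \<noteq> 0" "poly q x = 0" using alg[OF \<open>x \<in> K'\<close>] by blast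
    then obtain a k where ak: "a \<in> K" "k > 0" "a \<noteq> 0" "x ^ k / a \<in> M.units"
      using M.algebraic_power_unit[OF K_field] \<open>x \<noteq> 0\<close> by blast
    then show ?thesis
      using f_pos[of a] unfolding P_def
      by (intro exI[of _ "root k (f a)"]) (auto intro!: exI[of _ k] bexI[of _ a] simp: real_root_gt_zero)
  qed
  \<comment> \<open>Both descriptions are compared at the common power \<open>x ^ (k * l)\<close>:
    the quotient \<open>a ^ l / b ^ k\<close> is a unit of \<open>B\<close> lying in
    \<open>K\<close>, so \<open>f\<close> takes the value 1 on it.\<close>
  have P_unique: "u = u'" if p: "P x u" "P x u'" for x u u'
  proof -
    obtain a k b l where *: "a \<in> K" "k > 0" "a \<noteq> 0" "x ^ k / a \<in> M.units" "u ^ k = f a"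
      "b \<in> K" "l > 0" "b \<noteq> 0" "x ^ l / b \<in> M.units" "u' ^ l = f b" "u > 0" "u' > 0"
      using p unfolding P_def by blast
    have "x \<noteq> 0" using * by (auto simp: M.units_def)
    have "(x ^ l / b) ^ k / (x ^ k / a) ^ l \<in> M.units"
      using * by (intro M.units_divide[OF M.units_power M.units_power])
    moreover have "(x ^ l / b) ^ k / (x ^ k / a) ^ l = a ^ l / b ^ k"
      using \<open>x \<noteq> 0\<close> by (simp add: power_divide mult.commute flip: power_mult)
    ultimately have "f (a ^ l / b ^ k) = 1"
      using * by (intro UK) (auto intro!: subfield_divide[OF K_field] subring_power[OF K])
    moreover have "f (a ^ l / b ^ k) = f a ^ l / f b ^ k"
      using * by (simp add: f_divide f_power subring_power[OF K])
    ultimately have "f a ^ l = f b ^ k" using f_pos[of b] * by (simp add: field_simps)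
    then have "u ^ (k * l) = u' ^ (k * l)" using * by (metis power_mult mult.commute)
    then show ?thesis using * by (auto intro: power_eq_imp_eq_base[of u "k * l" u'])
  qed
  have f'_P: "f' x = u" if "P x u" "x \<noteq> 0" for x u
    using someI[of "P x", OF that(1)] P_unique that unfolding f'_def by auto
  have f'P: "P x (f' x)" if "x \<in> K'" "x \<noteq> 0" for x
    using P_ex[OF that] f'_P that by auto
  have f'_pos: "f' x > 0" if "x \<in> K'" "x \<noteq> 0" for x
    using f'P[OF that] unfolding P_def by blast
  have f'_mult: "f' (x * y) = f' x * f' y" if xy: "x \<in> K'" "y \<in> K'" for x y
  proof (cases "x = 0 \<or> y = 0")
    case True
    then show ?thesis by (auto simp: f'_def)
  next
    case False
    define u u' where "u = f' x" "u' = f' y"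
    obtain a k b l where *: "a \<in> K" "k > 0" "a \<noteq> 0" "x ^ k / a \<in> M.units" "u ^ k = f a"
      "b \<in> K" "l > 0" "b \<noteq> 0" "y ^ l / b \<in> M.units" "u' ^ l = f b" "u > 0" "u' > 0"
      using f'P[of x] f'P[of y] xy False unfolding P_def u_u'_def by blast
    have "(x ^ k / a) ^ l * (y ^ l / b) ^ k \<in> M.units" using * by (intro M.units_mult[OF M.units_power M.units_power])
    moreover have "(x ^ k / a) ^ l * (y ^ l / b) ^ k = (x * y) ^ (k * l) / (a ^ l * b ^ k)"
      by (simp add: power_divide power_mult_distrib mult.commute flip: power_mult)
    moreover have "(u * u') ^ (k * l) = f (a ^ l * b ^ k)"
    proof -
      have "(u * u') ^ (k * l) = (u ^ k) ^ l * (u' ^ l) ^ k"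
        by (simp add: power_mult_distrib mult.commute flip: power_mult)
      then show ?thesis using * by (simp add: f_mult f_power subring_power[OF K])
    qed
    moreover have "a ^ l * b ^ k \<in> K" "a ^ l * b ^ k \<noteq> 0" "u * u' > 0" "k * l > 0"
      using * by (auto intro!: subring_mult[OF K] subring_power[OF K])
    ultimately have "P (x * y) (u * u')" unfolding P_def by metis
    then show ?thesis using f'_P False unfolding u_u'_def by simp
  qed
  \<comment> \<open>The unit ball of \<open>f'\<close> is exactly \<open>B\<close> (on nonzero
    elements), so the ultrametric inequality below becomes closure of \<open>B\<close> under adding
    1.\<close>
  have f'_B: "f' x \<le> 1 \<longleftrightarrow> x \<in> B" if x: "x \<in> K'" "x \<noteq> 0" for x
  proof -
    define u where "u = f' x"
    obtain a k where *: "a \<in> K" "k > 0" "a \<noteq> 0" "x ^ k / a \<in> M.units" "u ^ k = f a" "u > 0"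
      using f'P[OF x] unfolding P_def u_def by blast
    have "u \<le> 1 \<longleftrightarrow> f a \<le> 1" using * by (metis power_le_one_iff less_imp_le neq0_conv)
    also have "\<dots> \<longleftrightarrow> a \<in> B" using BK B(2) * unfolding A_def by blast
    also have "\<dots> \<longleftrightarrow> x \<in> B"
    proof
      assume "a \<in> B"
      then have "a * (x ^ k / a) \<in> B" using * by (intro subring_mult[OF B(1)]) (auto simp: M.units_def)
      then show "x \<in> B" using * M.root_in[of x k] by simp
    next
      assume "x \<in> B"
      then have "x ^ k * inverse (x ^ k / a) \<in> B"
        using * by (intro subring_mult[OF B(1)] subring_power[OF B(1)]) (auto simp: M.units_def)
      moreover have "x ^ k * inverse (x ^ k / a) = a" using x * by (simp add: field_simps)
      ultimately show "a \<in> B" by simp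
    qed
    finally show ?thesis by (simp add: u_def)
  qed
  have SK: "is_subring K'" using K' by (simp add: subfield_subring)
  have "nonarch_field K' f'"
  proof
    show "is_subring K'" "is_subfield K'" "f' 0 = 0" using K' SK by (auto simp: f'_def)
    show "\<And>x. x \<in> K' \<Longrightarrow> x \<noteq> 0 \<Longrightarrow> f' x > 0" by (rule f'_pos)
    show "\<And>x y. x \<in> K' \<Longrightarrow> y \<in> K' \<Longrightarrow> f' (x * y) = f' x * f' y" by (rule f'_mult)
    have le: "f' (x + y) \<le> f' y" if xy: "x \<in> K'" "y \<in> K'" "f' x \<le> f' y" "x \<noteq> 0" "y \<noteq> 0" for x y
    proof (cases "x + y = 0")
      case True
      then show ?thesis using f'_pos[of y] xy by (simp add: f'_def)
    next
      case False
      have q: "x / y \<in> K'" using xy subfield_divide K' by blast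
      then have "f' x = f' (x / y) * f' y" using f'_mult[of "x / y" y] xy by simp
      then have "f' (x / y) \<le> 1" using xy f'_pos[of y] by simp
      then have "x / y \<in> B" using f'_B[OF q] xy by simp
      then have "x / y + 1 \<in> B" using subring_add[OF B(1)] subring_one[OF B(1)] by blast
      moreover have q1: "x / y + 1 \<in> K'" using q subring_add[OF SK] subring_one[OF SK] by blast
      moreover have eq: "x + y = (x / y + 1) * y" using xy by (simp add: field_simps)
      ultimately have "f' (x / y + 1) \<le> 1" using f'_B[OF q1] False by auto
      then show ?thesis unfolding eq using f'_mult[OF q1 xy(2)] f'_pos[of y] xy by simp
    qed
    show "f' (x + y) \<le> max (f' x) (f' y)" if "x \<in> K'" "y \<in> K'" for x y
    proof (cases "x = 0 \<or> y = 0")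
      case False
      then show ?thesis using le[of x y] le[of y x] that by (cases "f' x \<le> f' y") (auto simp: add.commute)
    qed auto
  qed
  moreover have "f' x = f x" if "x \<in> K" for x
  proof (cases "x = 0")
    case False
    have "P x (f x)" unfolding P_def using that False f_pos subring_one[OF B(1)]
      by (auto intro!: bexI[of _ x] exI[of _ 1] simp: M.units_def)
    then show ?thesis using f'_P False by simp
  qed (simp add: f'_def f0)
  ultimately show ?thesis using that by blast
qed

section \<open>Gauss norms\<close>

definition gauss_norm :: "('a::zero \<Rightarrow> real) \<Rightarrow> real \<Rightarrow> 'a poly \<Rightarrow> real" where
  "gauss_norm f \<rho> q = Max ((\<lambda>i. f (Polynomial.coeff q i) * \<rho> ^ i) ` {..degree q})"

text \<open>The assumption \<open>indep\<close> excludes ties between terms of different degree, so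
  a nonzero polynomial has a unique term of maximal value. Multiplicativity of the norm and the
  unchanged residue field both come from this term.\<close>

locale monomial_norm = nonarch +
  fixes \<rho> :: real
  assumes \<rho>: "\<rho> > 0"
    and indep: "x \<in> K \<Longrightarrow> y \<in> K \<Longrightarrow> x \<noteq> 0 \<Longrightarrow> y \<noteq> 0 \<Longrightarrow> m > 0 \<Longrightarrow> f x \<noteq> \<rho> ^ m * f y"
begin

abbreviation gauss :: "'a poly \<Rightarrow> real" where "gauss \<equiv> gauss_norm f \<rho>"

abbreviation term_norm :: "'a poly \<Rightarrow> nat \<Rightarrow> real" where
  "term_norm q i \<equiv> f (Polynomial.coeff q i) * \<rho> ^ i"

lemma gauss_attained: "\<exists>i. gauss q = term_norm q i"
proof -
  have "gauss q \<in> (\<lambda>i. term_norm q i) ` {..degree q}"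
    unfolding gauss_norm_def by (intro Max_in) auto
  then show ?thesis by blast
qed

lemma gauss_ge: assumes "q \<in> polys_over K" shows "term_norm q i \<le> gauss q"
proof (cases "i \<le> degree q")
  case True
  then show ?thesis unfolding gauss_norm_def by (intro Max_ge) auto
next
  case False
  have "0 \<le> term_norm q 0" using assms f_nonneg by (simp add: polys_over_def)
  also have "\<dots> \<le> gauss q" unfolding gauss_norm_def by (intro Max_ge imageI) auto
  finally show ?thesis using False by (simp add: coeff_eq_0 f0)
qed

lemma gauss_0: "gauss 0 = 0"
  using gauss_attained[of 0] by (auto simp: f0)

lemma gauss_pos: assumes "q \<in> polys_over K" "q \<noteq> 0" shows "gauss q > 0"
proof -
  have "0 < term_norm q (degree q)"
    using assms \<rho> f_pos[of "Polynomial.coeff q (degree q)"] by (simp add: polys_over_def)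
  then show ?thesis using gauss_ge[OF assms(1)] by (rule less_le_trans)
qed

lemma gauss_add:
  assumes "q \<in> polys_over K" "r \<in> polys_over K" shows "gauss (q + r) \<le> max (gauss q) (gauss r)"
proof -
  obtain i where "gauss (q + r) = term_norm (q + r) i" using gauss_attained by blast
  also have "\<dots> \<le> max (f (Polynomial.coeff q i)) (f (Polynomial.coeff r i)) * \<rho> ^ i"
    using assms \<rho> by (auto simp: polys_over_def intro!: mult_right_mono f_add)
  also have "\<dots> = max (term_norm q i) (term_norm r i)"
    using \<rho> by (simp add: max_mult_distrib_right)
  also have "\<dots> \<le> max (gauss q) (gauss r)" using gauss_ge assms by (intro max.mono) auto
  finally show ?thesis .
qed

definition dominant :: "'a poly \<Rightarrow> nat \<Rightarrow> bool" where
  "dominant q i \<longleftrightarrow> gauss q = term_norm q i \<and> (\<forall>k. k \<noteq> i \<longrightarrow> term_norm q k < term_norm q i)"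

text \<open>Stated for two polynomials since \<open>gauss_residue\<close> compares a numerator with
  a denominator; the case \<open>q = r\<close> gives uniqueness of the maximal term.\<close>

lemma term_norm_inj:
  assumes "q \<in> polys_over K" "r \<in> polys_over K" "term_norm q i = term_norm r k"
    "Polynomial.coeff q i \<noteq> 0" "Polynomial.coeff r k \<noteq> 0"
  shows "i = k"
proof (rule ccontr)
  have *: False if "i < k" "term_norm q i = term_norm r k"
    "Polynomial.coeff q i \<noteq> 0" "Polynomial.coeff r k \<noteq> 0" "q \<in> polys_over K" "r \<in> polys_over K" for i k q r
  proof -
    have "\<rho> ^ k = \<rho> ^ (k - i) * \<rho> ^ i" using that by (simp flip: power_add)
    then have "f (Polynomial.coeff q i) = \<rho> ^ (k - i) * f (Polynomial.coeff r k)"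
      using that \<rho> by simp
    then show False using indep that by (auto simp: polys_over_def)
  qed
  assume "i \<noteq> k"
  then show False using *[of i k q r] *[of k i r q] assms by (cases "i < k") auto
qed

lemma dominant_exists: assumes q: "q \<in> polys_over K" "q \<noteq> 0" shows "\<exists>i. dominant q i"
proof -
  obtain i where i: "gauss q = term_norm q i" using gauss_attained by blast
  then have ci: "Polynomial.coeff q i \<noteq> 0" using gauss_pos[OF q] f0 by auto
  have "term_norm q k < term_norm q i" if "k \<noteq> i" for k
  proof (cases "Polynomial.coeff q k = 0")
    case True
    then show ?thesis using gauss_pos[OF q] i f0 by simp
  next
    case False
    then show ?thesis using term_norm_inj[of q q k i] gauss_ge[of q k] i ci that q by fastforce
  qed
  then show ?thesis using i unfolding dominant_def by blast
qed

text \<open>Let \<open>i\<close> and \<open>k\<close> be the dominant degrees. In the coefficient of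
  degree \<open>i + k\<close> the product of the two dominant coefficients is strictly larger than
  every other summand, so it cannot cancel; and no term exceeds the product of the norms.\<close>

lemma gauss_mult: assumes q: "q \<in> polys_over K" and r: "r \<in> polys_over K" shows "gauss (q * r) = gauss q * gauss r"
proof (cases "q = 0 \<or> r = 0")
  case False
  then obtain i k where i: "dominant q i" and k: "dominant r k" using dominant_exists q r by blast
  have qc: "Polynomial.coeff q j \<in> K" and rc: "Polynomial.coeff r j \<in> K" for j
    using q r by (auto simp: polys_over_def)
  have tq: "term_norm q j \<ge> 0" and tr: "term_norm r j \<ge> 0" for j
    using qc rc f_nonneg \<rho> by auto
  have pos: "gauss q > 0" "gauss r > 0" using gauss_pos q r False by auto
  define P where "P = gauss q * gauss r"
  have P: "P > 0" using pos by (simp add: P_def)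
  have tprod: "f (Polynomial.coeff q a * Polynomial.coeff r b) * \<rho> ^ l = term_norm q a * term_norm r b"
    if "a + b = l" for a b l
    using that qc rc by (auto simp: f_mult power_add)
  have le: "term_norm q a * term_norm r b \<le> P" for a b
    unfolding P_def using gauss_ge[OF q] gauss_ge[OF r] tr pos by (intro mult_mono) auto
  have less: "term_norm q a * term_norm r b < P" if "a \<noteq> i \<or> b \<noteq> k" for a b
  proof -
    have "term_norm q a < gauss q \<or> term_norm r b < gauss r"
      using that i k unfolding dominant_def by metis
    then show ?thesis
      unfolding P_def using gauss_ge[OF q, of a] gauss_ge[OF r, of b] tq[of a] tr[of b] pos
        mult_less_le_imp_less[of "term_norm q a" "gauss q" "term_norm r b" "gauss r"]
        mult_le_less_imp_less[of "term_norm q a" "gauss q" "term_norm r b" "gauss r"]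
      by (metis le_less mult_strict_mono' mult_zero_left mult_zero_right mult_pos_pos not_less)
  qed
  have coefK: "Polynomial.coeff (q * r) l \<in> K" for l
    using polys_over_mult[OF K q r] by (simp add: polys_over_def)
  have upper: "term_norm (q * r) l \<le> P" for l
  proof -
    have "f (\<Sum>a\<le>l. Polynomial.coeff q a * Polynomial.coeff r (l - a)) \<le> P / \<rho> ^ l"
    proof (rule f_sum_le)
      fix a assume "a \<in> {..l}"
      then show "Polynomial.coeff q a * Polynomial.coeff r (l - a) \<in> K \<and>
          f (Polynomial.coeff q a * Polynomial.coeff r (l - a)) \<le> P / \<rho> ^ l"
        using le[of a "l - a"] tprod[of a "l - a" l] \<rho> qc rc by (simp add: pos_le_divide_eq subring_mult[OF K])
    qed (use P \<rho> in simp)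
    then show ?thesis using \<rho> by (simp add: coeff_mult pos_le_divide_eq)
  qed
  have "f (\<Sum>a\<in>{..i+k}-{i}. Polynomial.coeff q a * Polynomial.coeff r (i + k - a)) < P / \<rho> ^ (i + k)"
  proof (rule f_sum_less)
    fix a assume "a \<in> {..i+k}-{i}"
    then show "Polynomial.coeff q a * Polynomial.coeff r (i + k - a) \<in> K \<and>
        f (Polynomial.coeff q a * Polynomial.coeff r (i + k - a)) < P / \<rho> ^ (i + k)"
      using less[of a "i + k - a"] tprod[of a "i + k - a" "i + k"] \<rho> qc rc
      by (simp add: pos_less_divide_eq subring_mult[OF K])
  qed (use P \<rho> in simp)
  moreover have "f (Polynomial.coeff q i * Polynomial.coeff r k) = P / \<rho> ^ (i + k)"
    using tprod[of i k "i + k"] i k \<rho> by (simp add: P_def dominant_def field_simps)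
  moreover have "Polynomial.coeff (q * r) (i + k) =
      (\<Sum>a\<in>{..i+k}-{i}. Polynomial.coeff q a * Polynomial.coeff r (i + k - a)) +
      Polynomial.coeff q i * Polynomial.coeff r k"
    unfolding coeff_mult by (subst sum.remove[of _ i]) auto
  ultimately have "f (Polynomial.coeff (q * r) (i + k)) = P / \<rho> ^ (i + k)"
    using f_add_eq qc rc by (simp add: subring_mult[OF K] subring_sum[OF K])
  then have "term_norm (q * r) (i + k) = P" using \<rho> by simp
  then have "P \<le> gauss (q * r)" using gauss_ge[OF polys_over_mult[OF K q r], of "i + k"] by simp
  moreover have "gauss (q * r) \<le> P" using gauss_attained[of "q * r"] upper by auto
  ultimately show ?thesis by (simp add: P_def)
qed (auto simp: gauss_0)

text \<open>Equal norms force equal dominant degrees, by independence of \<open>\<rho>\<close>. With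
  \<open>a\<close>, \<open>b\<close> the dominant coefficients, the combination
  \<open>b * q - a * r\<close> cancels the dominant terms, and all others were already strictly
  smaller. Hence \<open>q / r\<close> has the residue class of \<open>a / b\<close>, which comes
  from the base.\<close>

lemma gauss_residue:
  assumes q: "q \<in> polys_over K" and r: "r \<in> polys_over K" "r \<noteq> 0" and eq: "gauss q = gauss r"
  shows "\<exists>a\<in>K. \<exists>b\<in>K. a \<noteq> 0 \<and> b \<noteq> 0 \<and> f a = f b \<and> gauss (smult b q - smult a r) < f b * gauss r"
proof -
  have pr: "gauss r > 0" using gauss_pos[OF r] .
  then have "q \<noteq> 0" using eq gauss_0 by auto
  then obtain i k where i: "dominant q i" and k: "dominant r k" using dominant_exists q r by blast
  have qc: "Polynomial.coeff q j \<in> K" and rc: "Polynomial.coeff r j \<in> K" for j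
    using q r by (auto simp: polys_over_def)
  have tn: "term_norm q i = gauss r" "term_norm r k = gauss r"
    using i k eq unfolding dominant_def by auto
  have "Polynomial.coeff q i \<noteq> 0" "Polynomial.coeff r k \<noteq> 0" using tn pr f0 by auto
  moreover then have ik: "i = k" using term_norm_inj[of q r i k] tn q r by simp
  moreover define a b where "a = Polynomial.coeff q i" "b = Polynomial.coeff r i"
  moreover from calculation have "f a * \<rho> ^ i = f b * \<rho> ^ i" using tn by simp
  ultimately have ab: "a \<in> K" "b \<in> K" "a \<noteq> 0" "b \<noteq> 0" "f a = f b"
    using qc rc \<rho> by auto
  obtain j where j: "gauss (smult b q - smult a r) = term_norm (smult b q - smult a r) j"
    using gauss_attained by blast
  have "term_norm (smult b q - smult a r) j < f b * gauss r"
  proof (cases "j = i")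
    case True
    have "f b * gauss r > 0" using ab f_pos pr by simp
    then show ?thesis using True by (simp add: a_b_def f0 mult.commute)
  next
    case False
    have lt: "term_norm q j < gauss r" "term_norm r j < gauss r"
      using False i k tn ik unfolding dominant_def by metis+
    have "term_norm (smult b q - smult a r) j \<le>
        max (f (b * Polynomial.coeff q j)) (f (a * Polynomial.coeff r j)) * \<rho> ^ j"
      using ab qc rc \<rho> by (auto intro!: mult_right_mono f_diff subring_mult[OF K])
    also have "\<dots> = f b * max (term_norm q j) (term_norm r j)"
      using ab qc rc \<rho> f_nonneg[of b] by (simp add: f_mult max_mult_distrib_right max_mult_distrib_left mult_ac)
    also have "\<dots> < f b * gauss r" using lt ab f_pos[of b] by simp
    finally show ?thesis .
  qed
  then show ?thesis using ab j by (intro bexI[of _ a] bexI[of _ b]) auto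
qed

text \<open>Transcendence of \<open>t\<close> makes the representing polynomial unique, so the norm
  of polynomials becomes one of elements.\<close>

theorem monomial_extension:
  assumes t: "\<And>q. q \<in> polys_over K \<Longrightarrow> poly q t = 0 \<Longrightarrow> q = 0"
  obtains f' where "nonarch ((\<lambda>q. poly q t) ` polys_over K) f'"
    "\<And>q. q \<in> polys_over K \<Longrightarrow> f' (poly q t) = gauss q"
proof -
  define f' where "f' x = gauss (THE q. q \<in> polys_over K \<and> poly q t = x)" for x
  have f': "f' (poly q t) = gauss q" if q: "q \<in> polys_over K" for q
  proof -
    have "(THE r. r \<in> polys_over K \<and> poly r t = poly q t) = q"
    proof (rule the_equality)
      fix r assume r: "r \<in> polys_over K \<and> poly r t = poly q t"
      then have "r - q = 0" using polys_over_diff[OF K _ q, of r] by (intro t) auto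
      then show "r = q" by simp
    qed (use q in simp)
    then show ?thesis by (simp add: f'_def)
  qed
  have "nonarch ((\<lambda>q. poly q t) ` polys_over K) f'"
  proof
    show "is_subring ((\<lambda>q. poly q t) ` polys_over K)" by (rule adjoin_is_subring[OF K])
    show "f' 0 = 0" using f'[OF polys_over_0[OF K]] gauss_0 by simp
  next
    fix x assume "x \<in> (\<lambda>q. poly q t) ` polys_over K" "x \<noteq> 0"
    then obtain q where "q \<in> polys_over K" "x = poly q t" by auto
    moreover from this \<open>x \<noteq> 0\<close> have "q \<noteq> 0" by auto
    ultimately show "f' x > 0" using f' gauss_pos by simp
  next
    fix x y assume "x \<in> (\<lambda>q. poly q t) ` polys_over K" "y \<in> (\<lambda>q. poly q t) ` polys_over K"
    then obtain q r where qr: "x = poly q t" "y = poly r t" "q \<in> polys_over K" "r \<in> polys_over K" by blast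
    show "f' (x * y) = f' x * f' y"
      using f'[OF polys_over_mult[OF K qr(3,4)]] gauss_mult f' qr by simp
    show "f' (x + y) \<le> max (f' x) (f' y)"
      using f'[OF polys_over_add[OF K qr(3,4)]] gauss_add f' qr by simp
  qed
  then show ?thesis using f' that by blast
qed

end

section \<open>Heights\<close>

text \<open>In \<open>bounded_poly \<alpha> j d H\<close>, the first \<open>j\<close> of the \<open>\<alpha> i\<close> may be used, \<open>d\<close> bounds the total degree and
  \<open>H\<close> the \<open>\<ell>\<^sup>1\<close>-norm of the coefficients.\<close>

inductive bounded_poly :: "(nat \<Rightarrow> 'a::comm_ring_1) \<Rightarrow> nat \<Rightarrow> nat \<Rightarrow> real \<Rightarrow> 'a \<Rightarrow> bool"
  for \<alpha> :: "nat \<Rightarrow> 'a" and j :: nat where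
  const: "\<bar>real_of_int n\<bar> \<le> H \<Longrightarrow> bounded_poly \<alpha> j d H (of_int n)"
| sum: "bounded_poly \<alpha> j d H x \<Longrightarrow> bounded_poly \<alpha> j d H' y \<Longrightarrow> bounded_poly \<alpha> j d (H + H') (x + y)"
| var: "bounded_poly \<alpha> j d H x \<Longrightarrow> i < j \<Longrightarrow> bounded_poly \<alpha> j (Suc d) H (\<alpha> i * x)"

lemma bounded_poly_nonneg: "bounded_poly \<alpha> j d H x \<Longrightarrow> H \<ge> 0"
  by (induction rule: bounded_poly.induct) auto

lemma bounded_poly_0: "H \<ge> 0 \<Longrightarrow> bounded_poly \<alpha> j d H 0"
  using bounded_poly.const[of 0 H \<alpha> j d] by simp

lemma bounded_poly_mono:
  assumes "bounded_poly \<alpha> j d H x" "d \<le> d'" "H \<le> H'" shows "bounded_poly \<alpha> j d' H' x"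
proof -
  have "bounded_poly \<alpha> j d' H x" using assms(1,2)
  proof (induction arbitrary: d' rule: bounded_poly.induct)
    case (var d H x i)
    then obtain e where "d' = Suc e" "d \<le> e" by (cases d') auto
    then show ?case using var by (auto intro: bounded_poly.var)
  qed (auto intro: bounded_poly.const bounded_poly.sum)
  \<comment> \<open>Adding \<open>0\<close> with the bound \<open>H' - H\<close> raises the second
    bound.\<close>
  from bounded_poly.sum[OF this bounded_poly_0, of "H' - H"] show ?thesis using assms by simp
qed

lemma bounded_poly_Suc: "bounded_poly \<alpha> j d H x \<Longrightarrow> bounded_poly \<alpha> (Suc j) d H x"
  by (induction rule: bounded_poly.induct) (auto intro: bounded_poly.intros)

lemma bounded_poly_of_int_mult:
  "bounded_poly \<alpha> j d H x \<Longrightarrow> bounded_poly \<alpha> j d (\<bar>real_of_int n\<bar> * H) (of_int n * x)"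
proof (induction rule: bounded_poly.induct)
  case (const m H d)
  have "bounded_poly \<alpha> j d (\<bar>real_of_int n\<bar> * H) (of_int (n * m))"
    using const by (intro bounded_poly.const) (auto simp: abs_mult intro!: mult_left_mono)
  then show ?case by simp
next
  case (sum d H x H' y)
  then show ?case using bounded_poly.sum by (fastforce simp: distrib_left)
next
  case (var d H x i)
  then show ?case using bounded_poly.var by (fastforce simp: mult.left_commute)
qed

lemma bounded_poly_mult:
  "bounded_poly \<alpha> j d H x \<Longrightarrow> bounded_poly \<alpha> j d' H' y \<Longrightarrow> bounded_poly \<alpha> j (d + d') (H * H') (x * y)"
proof (induction rule: bounded_poly.induct)
  case (const n H d)
  from bounded_poly_of_int_mult[OF const(2), of n]
  show ?case by (rule bounded_poly_mono) (use const bounded_poly_nonneg in \<open>auto intro!: mult_right_mono\<close>)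
next
  case (sum d H x K y')
  then show ?case using bounded_poly.sum by (fastforce simp: distrib_right)
next
  case (var d H x i)
  then show ?case using bounded_poly.var by (fastforce simp: mult.assoc)
qed

lemma bounded_poly_zero_vars:
  "bounded_poly \<alpha> 0 d H x \<Longrightarrow> \<exists>n. x = of_int n \<and> \<bar>real_of_int n\<bar> \<le> H"
proof (induction rule: bounded_poly.induct)
  case (sum d H x H' y)
  then obtain n m where "x = of_int n" "y = of_int m" "\<bar>real_of_int n\<bar> \<le> H" "\<bar>real_of_int m\<bar> \<le> H'" by blast
  then show ?case by (intro exI[of _ "n + m"]) auto
qed auto

text \<open>Collecting powers of the last generator loses nothing: each coefficient is a part of the
  same expression and inherits both bounds.\<close>

lemma bounded_poly_univariate:
  "bounded_poly \<alpha> (Suc j) d H x \<Longrightarrow>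
    \<exists>q. degree q \<le> d \<and> (\<forall>i. bounded_poly \<alpha> j d H (Polynomial.coeff q i)) \<and> poly q (\<alpha> j) = x"
proof (induction rule: bounded_poly.induct)
  case (const n H d)
  then show ?case
    by (intro exI[of _ "[:of_int n:]"])
       (auto simp: coeff_pCons intro: bounded_poly.const bounded_poly_0 split: nat.split)
next
  case (sum d H x H' y)
  then obtain q r where "degree q \<le> d" "\<forall>i. bounded_poly \<alpha> j d H (Polynomial.coeff q i)" "poly q (\<alpha> j) = x"
    "degree r \<le> d" "\<forall>i. bounded_poly \<alpha> j d H' (Polynomial.coeff r i)" "poly r (\<alpha> j) = y" by blast
  then show ?case by (intro exI[of _ "q + r"]) (auto intro: degree_add_le bounded_poly.sum)
next
  case (var d H x i)
  then obtain q where q: "degree q \<le> d" "\<forall>i. bounded_poly \<alpha> j d H (Polynomial.coeff q i)" "poly q (\<alpha> j) = x" by blast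
  show ?case
  proof (cases "i = j")
    case True
    have "bounded_poly \<alpha> j (Suc d) H (Polynomial.coeff (pCons 0 q) k)" for k
      using q bounded_poly_nonneg[of \<alpha> j d H]
      by (auto simp: coeff_pCons intro: bounded_poly_0 bounded_poly_mono split: nat.split)
    moreover have "degree (pCons 0 q) \<le> Suc d" using q(1) by (intro order_trans[OF degree_pCons_le]) simp
    ultimately show ?thesis using q True by (intro exI[of _ "pCons 0 q"]) simp
  next
    case False
    then have "i < j" using var by simp
    then show ?thesis using q
      by (intro exI[of _ "smult (\<alpha> i) q"])
         (auto intro: bounded_poly.var order_trans[OF degree_smult_le] le_SucI)
  qed
qed

text \<open>A single bound on both degree and logarithmic size, chosen so that it is additive under
  multiplication.\<close>

definition height_le :: "(nat \<Rightarrow> 'a::comm_ring_1) \<Rightarrow> nat \<Rightarrow> real \<Rightarrow> 'a \<Rightarrow> bool" where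
  "height_le \<alpha> j b x \<longleftrightarrow> b \<ge> 0 \<and> bounded_poly \<alpha> j (nat \<lfloor>b\<rfloor>) (exp b) x"

lemma height_leI:
  assumes "bounded_poly \<alpha> j d H x" "real d \<le> b" "H \<le> exp b" shows "height_le \<alpha> j b x"
  unfolding height_le_def
  using assms bounded_poly_mono[OF assms(1), of "nat \<lfloor>b\<rfloor>" "exp b"] by (auto simp: le_nat_floor)

lemma height_le_nonneg: "height_le \<alpha> j b x \<Longrightarrow> b \<ge> 0"
  by (simp add: height_le_def)

lemma height_le_mono: "height_le \<alpha> j b x \<Longrightarrow> b \<le> b' \<Longrightarrow> height_le \<alpha> j b' x"
  unfolding height_le_def by (auto intro: bounded_poly_mono nat_mono floor_mono)

lemma height_le_Suc: "height_le \<alpha> j b x \<Longrightarrow> height_le \<alpha> (Suc j) b x"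
  unfolding height_le_def using bounded_poly_Suc by blast

lemma height_le_mult:
  assumes "height_le \<alpha> j b x" "height_le \<alpha> j c y" shows "height_le \<alpha> j (b + c) (x * y)"
proof (rule height_leI)
  show "bounded_poly \<alpha> j (nat \<lfloor>b\<rfloor> + nat \<lfloor>c\<rfloor>) (exp b * exp c) (x * y)"
    using assms unfolding height_le_def by (intro bounded_poly_mult) auto
qed (use assms in \<open>auto simp: height_le_def exp_add intro!: add_mono\<close>)

lemma two_le_exp_one: "(2::real) \<le> exp 1"
  using exp_ge_add_one_self[of 1] by simp

text \<open>The \<open>1\<close> absorbs the doubling of the norm, as \<open>2 \<le> exp 1\<close>;
  the degree does not grow under addition.\<close>

lemma height_le_add:
  assumes "height_le \<alpha> j b x" "height_le \<alpha> j b y" shows "height_le \<alpha> j (b + 1) (x + y)"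
proof (rule height_leI)
  show "bounded_poly \<alpha> j (nat \<lfloor>b\<rfloor>) (exp b + exp b) (x + y)"
    using assms unfolding height_le_def by (intro bounded_poly.sum) auto
  show "real (nat \<lfloor>b\<rfloor>) \<le> b + 1" using height_le_nonneg[OF assms(1)] by linarith
  show "exp b + exp b \<le> exp (b + 1)" using two_le_exp_one by (simp add: exp_add)
qed

lemma height_le_of_int: "\<bar>real_of_int n\<bar> \<le> exp b \<Longrightarrow> b \<ge> 0 \<Longrightarrow> height_le \<alpha> j b (of_int n)"
  unfolding height_le_def by (auto intro: bounded_poly.const)

lemma height_le_0: "b \<ge> 0 \<Longrightarrow> height_le \<alpha> j b 0"
  using height_le_of_int[of 0 b \<alpha> j] by simp

lemma height_le_uminus: "height_le \<alpha> j b x \<Longrightarrow> height_le \<alpha> j b (- x)"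
  unfolding height_le_def using bounded_poly_of_int_mult[of \<alpha> j _ _ x "-1"] by auto

lemma height_le_diff:
  "height_le \<alpha> j b x \<Longrightarrow> height_le \<alpha> j b y \<Longrightarrow> height_le \<alpha> j (b + 1) (x - y)"
  using height_le_add[of \<alpha> j b x "- y"] height_le_uminus[of \<alpha> j b y] by simp

lemma height_le_sum:
  assumes "finite I" "b \<ge> 0" "\<And>i. i \<in> I \<Longrightarrow> height_le \<alpha> j b (g i)"
  shows "height_le \<alpha> j (b + card I) (sum g I)"
  using assms(1,3)
proof (induction I rule: finite_induct)
  case empty
  then show ?case using assms(2) by (simp add: height_le_0)
next
  case (insert i I)
  have "height_le \<alpha> j (b + card I) (g i)"
    by (rule height_le_mono[OF insert.prems[of i]]) auto
  then have "height_le \<alpha> j (b + card I + 1) (g i + sum g I)" using insert by (intro height_le_add) auto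
  then show ?case using insert by (simp add: add_ac)
qed

lemma height_le_power: "height_le \<alpha> j b x \<Longrightarrow> height_le \<alpha> j (real n * b) (x ^ n)"
proof (induction n)
  case 0
  then show ?case using height_le_of_int[of 1 0 \<alpha> j] by simp
next
  case (Suc n)
  then show ?case using height_le_mult[of \<alpha> j b x "real n * b" "x ^ n"] by (simp add: algebra_simps)
qed

text \<open>This is \<open>\<int>[\<alpha> 0, ..., \<alpha> (j - 1)]\<close>, defined through
  heights so that membership supplies one.\<close>

definition gen_ring :: "(nat \<Rightarrow> 'a::comm_ring_1) \<Rightarrow> nat \<Rightarrow> 'a set" where
  "gen_ring \<alpha> j = {x. \<exists>b. height_le \<alpha> j b x}"

lemma gen_ringI: "height_le \<alpha> j b x \<Longrightarrow> x \<in> gen_ring \<alpha> j"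
  by (auto simp: gen_ring_def)

lemma bounded_poly_gen_ring: assumes "bounded_poly \<alpha> j d H x" shows "x \<in> gen_ring \<alpha> j"
proof (rule gen_ringI[OF height_leI[OF assms]])
  have "H \<ge> 0" using assms by (rule bounded_poly_nonneg)
  then show "real d \<le> real d + H" "H \<le> exp (real d + H)"
    using exp_ge_add_one_self[of "real d + H"] by linarith+
qed

lemma gen_ring_subring: "is_subring (gen_ring \<alpha> j)"
  unfolding is_subring_def
proof (intro conjI ballI)
  show "1 \<in> gen_ring \<alpha> j" using height_le_of_int[of 1 0 \<alpha> j] gen_ringI[of \<alpha> j 0 1] by simp
  fix x y assume "x \<in> gen_ring \<alpha> j" "y \<in> gen_ring \<alpha> j"
  then obtain b c where bc: "height_le \<alpha> j b x" "height_le \<alpha> j c y" unfolding gen_ring_def by blast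
  then have "height_le \<alpha> j (max b c) x" "height_le \<alpha> j (max b c) y" by (auto intro: height_le_mono)
  then show "x - y \<in> gen_ring \<alpha> j" by (intro gen_ringI[OF height_le_diff])
  show "x * y \<in> gen_ring \<alpha> j" using bc by (intro gen_ringI[OF height_le_mult])
qed

lemma gen_ring_mono_Suc: "gen_ring \<alpha> j \<subseteq> gen_ring \<alpha> (Suc j)"
  unfolding gen_ring_def using height_le_Suc by blast

lemma gen_ring_generator: "i < j \<Longrightarrow> \<alpha> i \<in> gen_ring \<alpha> j"
  using bounded_poly.var[OF bounded_poly.const[of 1 1 \<alpha> j 0]] bounded_poly_gen_ring by fastforce

lemma height_le_univariate:
  assumes "height_le \<alpha> (Suc j) b x"
  obtains q where "real (degree q) \<le> b" "\<And>i. height_le \<alpha> j b (Polynomial.coeff q i)" "poly q (\<alpha> j) = x"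
proof -
  have "bounded_poly \<alpha> (Suc j) (nat \<lfloor>b\<rfloor>) (exp b) x" and b: "b \<ge> 0" using assms by (auto simp: height_le_def)
  then obtain q where q: "degree q \<le> nat \<lfloor>b\<rfloor>" "\<And>i. bounded_poly \<alpha> j (nat \<lfloor>b\<rfloor>) (exp b) (Polynomial.coeff q i)"
    "poly q (\<alpha> j) = x" using bounded_poly_univariate by blast
  have "real (degree q) \<le> b" using q(1) b by linarith
  then show ?thesis using q b that by (auto simp: height_le_def)
qed

lemma gen_ring_Suc: "gen_ring \<alpha> (Suc j) = (\<lambda>q. poly q (\<alpha> j)) ` polys_over (gen_ring \<alpha> j)"
proof
  show "gen_ring \<alpha> (Suc j) \<subseteq> (\<lambda>q. poly q (\<alpha> j)) ` polys_over (gen_ring \<alpha> j)"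
  proof
    fix x assume "x \<in> gen_ring \<alpha> (Suc j)"
    then obtain b where "height_le \<alpha> (Suc j) b x" unfolding gen_ring_def by blast
    then obtain q where "\<And>i. height_le \<alpha> j b (Polynomial.coeff q i)" "poly q (\<alpha> j) = x"
      using height_le_univariate by metis
    then show "x \<in> (\<lambda>q. poly q (\<alpha> j)) ` polys_over (gen_ring \<alpha> j)"
      by (auto simp: polys_over_def intro!: gen_ringI)
  qed
  have "\<And>q. q \<in> polys_over (gen_ring \<alpha> j) \<Longrightarrow> q \<in> polys_over (gen_ring \<alpha> (Suc j))"
    using gen_ring_mono_Suc unfolding polys_over_def by blast
  then show "(\<lambda>q. poly q (\<alpha> j)) ` polys_over (gen_ring \<alpha> j) \<subseteq> gen_ring \<alpha> (Suc j)"
    using subring_poly[OF gen_ring_subring] gen_ring_generator[of j "Suc j" \<alpha>] by blast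
qed

text \<open>Used for the radius of the Gauss norm: countably many values rule out only countably
  many radii.\<close>

lemma countable_gen_ring: "countable (gen_ring \<alpha> j)"
proof (induction j)
  case 0
  have "gen_ring \<alpha> 0 \<subseteq> range of_int"
    using bounded_poly_zero_vars unfolding gen_ring_def height_le_def by blast
  then show ?case by (rule countable_subset) simp
next
  case (Suc j)
  have "polys_over (gen_ring \<alpha> j) \<subseteq> Poly ` lists (gen_ring \<alpha> j)"
  proof
    fix q :: "'a poly" assume "q \<in> polys_over (gen_ring \<alpha> j)"
    then have "range (Polynomial.coeff q) \<subseteq> gen_ring \<alpha> j" by (simp add: polys_over_def image_subset_iff)
    then have "set (coeffs q) \<subseteq> gen_ring \<alpha> j" by (simp add: range_coeff)
    then show "q \<in> Poly ` lists (gen_ring \<alpha> j)" by (intro image_eqI[of _ _ "coeffs q"]) auto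
  qed
  then have "countable (polys_over (gen_ring \<alpha> j))"
    by (rule countable_subset) (intro countable_image countable_lists Suc)
  then show ?case unfolding gen_ring_Suc by (rule countable_image)
qed

section \<open>Linear dependencies of bounded height\<close>

text \<open>A bound in the spirit of Siegel's lemma for homogeneous systems with unknowns
  \<open>I\<close> and equations \<open>L\<close>. The set \<open>I\<close> is quantified inside
  because eliminating an unknown shrinks it, while \<open>N\<close> keeps \<open>C\<close>
  uniform.\<close>

definition elimination_bound ::
    "(nat \<Rightarrow> 'a::comm_ring_1) \<Rightarrow> nat \<Rightarrow> nat \<Rightarrow> nat set \<Rightarrow> real \<Rightarrow> bool" where
  "elimination_bound \<alpha> j N L C \<longleftrightarrow> (\<forall>b\<ge>0. \<forall>(u :: nat \<Rightarrow> nat \<Rightarrow> 'a) (I :: nat set).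
    finite I \<longrightarrow> card I \<le> N \<longrightarrow> card L < card I \<longrightarrow> (\<forall>i\<in>I. \<forall>l\<in>L. height_le \<alpha> j b (u i l)) \<longrightarrow>
    (\<exists>\<mu>. (\<forall>i\<in>I. height_le \<alpha> j (C * (1 + b)) (\<mu> i)) \<and> (\<exists>i\<in>I. \<mu> i \<noteq> 0) \<and>
         (\<forall>l\<in>L. (\<Sum>i\<in>I. \<mu> i * u i l) = 0)))"

lemma elimination_boundD:
  fixes I :: "nat set"
  assumes "elimination_bound \<alpha> j N L C" "b \<ge> 0" "finite I" "card I \<le> N" "card L < card I"
    "\<forall>i\<in>I. \<forall>l\<in>L. height_le \<alpha> j b (u i l)"
  shows "\<exists>\<mu>. (\<forall>i\<in>I. height_le \<alpha> j (C * (1 + b)) (\<mu> i)) \<and> (\<exists>i\<in>I. \<mu> i \<noteq> 0) \<and>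
         (\<forall>l\<in>L. (\<Sum>i\<in>I. \<mu> i * u i l) = 0)"
  using assms unfolding elimination_bound_def by simp

text \<open>Fraction-free Gaussian elimination: heights grow by a factor depending only on the number
  of unknowns.\<close>

lemma elimination_bound_exists:
  fixes \<alpha> :: "nat \<Rightarrow> 'a::idom"
  assumes "finite L"
  shows "\<exists>C\<ge>0. elimination_bound \<alpha> j N L C"
  using assms
proof (induction L rule: finite_induct)
  case empty
  have "elimination_bound \<alpha> j N {} 0"
    unfolding elimination_bound_def
  proof (intro allI impI)
    fix b :: real and u :: "nat \<Rightarrow> nat \<Rightarrow> 'a" and I :: "nat set"
    assume "finite I" "card {} < card I"
    then have "I \<noteq> {}" by auto
    then show "\<exists>\<mu>. (\<forall>i\<in>I. height_le \<alpha> j (0 * (1 + b)) (\<mu> i)) \<and> (\<exists>i\<in>I. \<mu> i \<noteq> 0) \<and>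
         (\<forall>l\<in>{}. (\<Sum>i\<in>I. \<mu> i * u i l) = 0)"
      using height_le_of_int[of 1 0 \<alpha> j] by (intro exI[of _ "\<lambda>_. 1"]) auto
  qed
  then show ?case by auto
next
  case (insert l L)
  then obtain C where C: "C \<ge> 0" and IH: "elimination_bound \<alpha> j N L C" by auto
  \<comment> \<open>Entries of the reduced system have height \<open>2 * b + 1\<close>, whence
    \<open>C * (2 + 2 * b)\<close> by induction; a further \<open>b\<close> comes from multiplying
    by an entry of \<open>u\<close>, and \<open>N\<close> from summing at most \<open>N\<close>
    terms.\<close>
  define C' where "C' = 2 * C + 1 + real N"
  have "elimination_bound \<alpha> j N (insert l L) C'"
    unfolding elimination_bound_def
  proof (intro allI impI)
    fix b :: real and u :: "nat \<Rightarrow> nat \<Rightarrow> 'a" and I :: "nat set"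
    assume b: "b \<ge> 0" and I: "finite I" "card I \<le> N" "card (insert l L) < card I"
      and u: "\<forall>i\<in>I. \<forall>l\<in>insert l L. height_le \<alpha> j b (u i l)"
    have cL: "card (insert l L) = Suc (card L)" using insert by simp
    have mono: "height_le \<alpha> j (C' * (1 + b)) x" if "height_le \<alpha> j (C * (2 + 2 * b) + b + real N) x" for x
    proof (rule height_le_mono[OF that])
      have "0 \<le> real N * b" using b by simp
      then show "C * (2 + 2 * b) + b + real N \<le> C' * (1 + b)" by (simp add: C'_def algebra_simps)
    qed
    show "\<exists>\<mu>. (\<forall>i\<in>I. height_le \<alpha> j (C' * (1 + b)) (\<mu> i)) \<and> (\<exists>i\<in>I. \<mu> i \<noteq> 0) \<and>
         (\<forall>l\<in>insert l L. (\<Sum>i\<in>I. \<mu> i * u i l) = 0)"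
    proof (cases "\<exists>k\<in>I. u k l \<noteq> 0")
      \<comment> \<open>Equation \<open>l\<close> has only zero coefficients, so a solution for
        \<open>L\<close> already works.\<close>
      case False
      have "card L < card I" "\<forall>i\<in>I. \<forall>m\<in>L. height_le \<alpha> j b (u i m)" using I u cL by auto
      note elim = elimination_boundD[OF IH b I(1,2) this]
      obtain \<mu> where \<mu>: "\<forall>i\<in>I. height_le \<alpha> j (C * (1 + b)) (\<mu> i)"
        "\<exists>i\<in>I. \<mu> i \<noteq> 0" "\<forall>l\<in>L. (\<Sum>i\<in>I. \<mu> i * u i l) = 0"
        using elim by (elim exE conjE) (rule that)
      have "C * (1 + b) \<le> C * (2 + 2 * b) + b + real N"
      proof -
        have "C * (1 + b) \<le> C * (2 + 2 * b)" using C b by (intro mult_left_mono) auto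
        then show ?thesis using b by simp
      qed
      then have "\<forall>i\<in>I. height_le \<alpha> j (C' * (1 + b)) (\<mu> i)" using height_le_mono[OF bspec[OF \<mu>(1)]] mono by simp
      then show ?thesis using \<mu> False by (intro exI[of _ \<mu>]) auto
    next
      case True
      then obtain k where k: "k \<in> I" "u k l \<noteq> 0" by blast
      define J where "J = I - {k}"
      \<comment> \<open>Cross-multiplication with the pivot \<open>u k l\<close> avoids division;
        column \<open>l\<close> of \<open>u'\<close> vanishes.\<close>
      define u' where "u' i m = u k l * u i m - u i l * u k m" for i m
      have J: "finite J" "card J \<le> N" "card L < card J" using I k cL by (auto simp: J_def)
      have u'h: "\<forall>i\<in>J. \<forall>m\<in>L. height_le \<alpha> j (b + b + 1) (u' i m)"
        unfolding u'_def using u k by (intro ballI height_le_diff height_le_mult) (auto simp: J_def)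
      have "b + b + 1 \<ge> 0" using b by simp
      note elim = elimination_boundD[OF IH this J u'h]
      obtain \<nu> where \<nu>: "\<forall>i\<in>J. height_le \<alpha> j (C * (1 + (b + b + 1))) (\<nu> i)"
        "\<exists>i\<in>J. \<nu> i \<noteq> 0" "\<forall>m\<in>L. (\<Sum>i\<in>J. \<nu> i * u' i m) = 0"
        using elim by (elim exE conjE) (rule that)
      \<comment> \<open>Back substitution: the other unknowns are scaled by the pivot, and
        \<open>\<mu> k\<close> is then dictated by equation \<open>l\<close>.\<close>
      define \<mu> where "\<mu> i = (if i = k then - (\<Sum>i\<in>J. \<nu> i * u i l) else \<nu> i * u k l)" for i
      have eq: "(\<Sum>i\<in>I. \<mu> i * u i m) = (\<Sum>i\<in>J. \<nu> i * u' i m)" for m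
      proof -
        have "(\<Sum>i\<in>I. \<mu> i * u i m) = \<mu> k * u k m + (\<Sum>i\<in>J. \<mu> i * u i m)"
          unfolding J_def using I k by (intro sum.remove) auto
        also have "(\<Sum>i\<in>J. \<mu> i * u i m) = (\<Sum>i\<in>J. \<nu> i * u k l * u i m)"
          by (rule sum.cong) (auto simp: \<mu>_def J_def)
        also have "(\<Sum>i\<in>J. \<nu> i * u k l * u i m) = (\<Sum>i\<in>J. \<nu> i * u' i m) + (\<Sum>i\<in>J. \<nu> i * u i l) * u k m"
          by (simp add: u'_def right_diff_distrib sum_subtractf sum_distrib_right mult.assoc)
        also have "\<mu> k * u k m + \<dots> = (\<Sum>i\<in>J. \<nu> i * u' i m)" by (simp add: \<mu>_def)
        finally show ?thesis .
      qed
      have "(\<Sum>i\<in>I. \<mu> i * u i m) = 0" if "m \<in> insert l L" for m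
        using that \<nu>(3) eq by (auto simp: u'_def mult.commute)
      moreover have "\<exists>i\<in>I. \<mu> i \<noteq> 0" using \<nu>(2) k by (auto simp: \<mu>_def J_def)
      moreover have "height_le \<alpha> j (C' * (1 + b)) (\<mu> i)" if "i \<in> I" for i
      proof (rule mono)
        have *: "height_le \<alpha> j (C * (2 + 2 * b) + b) (\<nu> i * u m l)" if "i \<in> J" "m \<in> I" for i m
          using height_le_mult[of \<alpha> j "C * (1 + (b + b + 1))" "\<nu> i" b "u m l"] that \<nu>(1) u
          by (simp add: algebra_simps)
        show "height_le \<alpha> j (C * (2 + 2 * b) + b + real N) (\<mu> i)"
        proof (cases "i = k")
          case True
          have "height_le \<alpha> j (C * (2 + 2 * b) + b + card J) (\<Sum>i\<in>J. \<nu> i * u i l)"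
            using J b C * by (intro height_le_sum) (auto simp: J_def)
          then show ?thesis using True J by (auto simp: \<mu>_def intro!: height_le_uminus intro: height_le_mono)
        next
          case False
          then have "height_le \<alpha> j (C * (2 + 2 * b) + b) (\<mu> i)" using *[of i k] k that by (simp add: \<mu>_def J_def)
          then show ?thesis by (rule height_le_mono) simp
        qed
      qed
      ultimately show ?thesis by blast
    qed
  qed
  moreover have "C' \<ge> 0" using C by (simp add: C'_def)
  ultimately show ?case by blast
qed

section \<open>Reduction modulo the equation of an algebraic generator\<close>

lemma bounded_poly_power: "bounded_poly \<alpha> j d H x \<Longrightarrow> bounded_poly \<alpha> j (n * d) (H ^ n) (x ^ n)"
proof (induction n)
  case 0
  then show ?case using bounded_poly.const[of 1 1 \<alpha> j 0] by simp
next
  case (Suc n)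
  then show ?case using bounded_poly_mult[of \<alpha> j d H x] by simp
qed

text \<open>Every variable in \<open>x\<close> is paid for by one factor \<open>c\<close>. For
  \<open>\<alpha> j\<close> this factor rewrites the overflowing power \<open>\<alpha> j ^ n\<close>
  by \<open>rel\<close>; for earlier generators it only keeps the exponent of \<open>c\<close> equal
  to \<open>d\<close>. Such a step adds at most \<open>\<delta> + 1\<close> to the degree and
  multiplies the norm by at most \<open>2 * K\<close>, as at most two products are added.\<close>

lemma algebraic_reduction:
  fixes \<alpha> :: "nat \<Rightarrow> 'a::comm_ring_1"
  assumes n: "n > 0" and c: "bounded_poly \<alpha> j \<delta> K c" and r: "\<And>l. l < n \<Longrightarrow> bounded_poly \<alpha> j \<delta> K (r l)"
    and K: "K \<ge> 1" and rel: "c * \<alpha> j ^ n = (\<Sum>l<n. r l * \<alpha> j ^ l)"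
  shows "bounded_poly \<alpha> (Suc j) d H x \<Longrightarrow>
    \<exists>u. (\<forall>l<n. bounded_poly \<alpha> j (d * (\<delta> + 1)) (H * (2 * K) ^ d) (u l)) \<and>
        c ^ d * x = (\<Sum>l<n. u l * \<alpha> j ^ l)"
proof (induction rule: bounded_poly.induct)
  case (const m H d)
  have H: "H \<ge> 0" using const by simp
  have "bounded_poly \<alpha> j (d * \<delta>) (\<bar>real_of_int m\<bar> * K ^ d) (of_int m * c ^ d)"
    by (intro bounded_poly_of_int_mult bounded_poly_power c)
  moreover have "\<bar>real_of_int m\<bar> * K ^ d \<le> H * (2 * K) ^ d"
    using const K H by (intro mult_mono power_mono) auto
  ultimately have *: "bounded_poly \<alpha> j (d * (\<delta> + 1)) (H * (2 * K) ^ d) (of_int m * c ^ d)"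
    by (rule_tac bounded_poly_mono) auto
  show ?case
  proof (intro exI[of _ "\<lambda>l. if l = 0 then of_int m * c ^ d else 0"] conjI allI impI)
    fix l show "bounded_poly \<alpha> j (d * (\<delta> + 1)) (H * (2 * K) ^ d) (if l = 0 then of_int m * c ^ d else 0)"
      using * H K by (auto intro!: bounded_poly_0)
    show "c ^ d * of_int m = (\<Sum>l<n. (if l = 0 then of_int m * c ^ d else 0) * \<alpha> j ^ l)"
      using n by (cases n) (simp_all add: sum.lessThan_Suc_shift del: sum.lessThan_Suc)
  qed
next
  case (sum d H x H' y)
  then obtain u w where "\<forall>l<n. bounded_poly \<alpha> j (d * (\<delta> + 1)) (H * (2 * K) ^ d) (u l)"
    "c ^ d * x = (\<Sum>l<n. u l * \<alpha> j ^ l)" "\<forall>l<n. bounded_poly \<alpha> j (d * (\<delta> + 1)) (H' * (2 * K) ^ d) (w l)"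
    "c ^ d * y = (\<Sum>l<n. w l * \<alpha> j ^ l)" by blast
  then show ?case
    by (intro exI[of _ "\<lambda>l. u l + w l"])
       (auto simp: distrib_left distrib_right sum.distrib intro!: bounded_poly.sum)
next
  case (var d H x i)
  then obtain u where u: "\<And>l. l < n \<Longrightarrow> bounded_poly \<alpha> j (d * (\<delta> + 1)) (H * (2 * K) ^ d) (u l)"
    and x: "c ^ d * x = (\<Sum>l<n. u l * \<alpha> j ^ l)" by blast
  have H: "H \<ge> 0" using var(1) by (rule bounded_poly_nonneg)
  define U where "U = H * (2 * K) ^ d"
  have U: "U \<ge> 0" using H K by (simp add: U_def)
  have U': "H * (2 * K) ^ Suc d = 2 * (K * U)" by (simp add: U_def)
  show ?case
  proof (cases "i = j")
    case False
    then have i: "i < j" using var by simp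
    have "bounded_poly \<alpha> j (Suc d * (\<delta> + 1)) (2 * (K * U)) (c * (\<alpha> i * u l))" if "l < n" for l
      using bounded_poly_mult[OF c bounded_poly.var[OF u[OF that, folded U_def] i]] K U
      by (rule_tac bounded_poly_mono) auto
    moreover have "c ^ Suc d * (\<alpha> i * x) = (c * \<alpha> i) * (c ^ d * x)" by (simp add: mult_ac)
    then have "c ^ Suc d * (\<alpha> i * x) = (\<Sum>l<n. c * (\<alpha> i * u l) * \<alpha> j ^ l)"
      unfolding x by (simp add: sum_distrib_left mult_ac)
    ultimately show ?thesis unfolding U' by (intro exI[of _ "\<lambda>l. c * (\<alpha> i * u l)"]) blast
  next
    case True
    obtain n' where n': "n = Suc n'" using n by (cases n) auto
    \<comment> \<open>Multiplication by \<open>c * \<alpha> j\<close> shifts the coefficients by one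
      place; the top one, \<open>u n'\<close>, overflows into degree \<open>n\<close> and returns
      through \<open>r\<close>.\<close>
    define w where "w l = (if l = 0 then 0 else c * u (l - 1)) + u n' * r l" for l
    have "bounded_poly \<alpha> j (\<delta> + d * (\<delta> + 1)) (K * U + K * U) (w l)" if l: "l < n" for l
      unfolding w_def
    proof (rule bounded_poly.sum)
      show "bounded_poly \<alpha> j (\<delta> + d * (\<delta> + 1)) (K * U) (if l = 0 then 0 else c * u (l - 1))"
        using bounded_poly_mult[OF c u[of "l - 1"]] l K U by (auto simp: U_def intro!: bounded_poly_0)
      show "bounded_poly \<alpha> j (\<delta> + d * (\<delta> + 1)) (K * U) (u n' * r l)"
        using bounded_poly_mult[OF r[OF l] u[of n']] n' by (simp add: U_def mult.commute)
    qed
    then have "bounded_poly \<alpha> j (Suc d * (\<delta> + 1)) (2 * (K * U)) (w l)" if "l < n" for l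
      using that by (rule_tac bounded_poly_mono) auto
    moreover have "c ^ Suc d * (\<alpha> i * x) = (\<Sum>l<n. w l * \<alpha> j ^ l)"
    proof -
      have "c ^ Suc d * (\<alpha> i * x) = (c * \<alpha> j) * (c ^ d * x)" using True by (simp add: mult_ac)
      also have "\<dots> = (\<Sum>l<n'. c * u l * \<alpha> j ^ Suc l) + u n' * (c * \<alpha> j ^ n)"
        unfolding x n' by (simp add: sum_distrib_left distrib_left mult_ac)
      also have "(\<Sum>l<n'. c * u l * \<alpha> j ^ Suc l) = (\<Sum>l<n. (if l = 0 then 0 else c * u (l - 1)) * \<alpha> j ^ l)"
        unfolding n' by (simp add: sum.lessThan_Suc_shift del: sum.lessThan_Suc)
      also have "u n' * (c * \<alpha> j ^ n) = (\<Sum>l<n. u n' * r l * \<alpha> j ^ l)"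
        unfolding rel by (simp add: sum_distrib_left mult_ac)
      finally show ?thesis by (simp add: w_def distrib_right sum.distrib)
    qed
    ultimately show ?thesis unfolding U' by (intro exI[of _ w]) blast
  qed
qed

text \<open>Modulo the equation for \<open>\<alpha> j\<close> the \<open>n + 1\<close> given
  elements become vectors of length \<open>n\<close> over the smaller ring, so elimination finds a
  relation. The bound stays linear in \<open>b\<close>, with \<open>n\<close> and \<open>C\<close>
  independent of the elements.\<close>

lemma algebraic_dependency:
  fixes \<alpha> :: "nat \<Rightarrow> 'a::idom"
  assumes q: "q \<in> polys_over (gen_ring \<alpha> j)" "q \<noteq> 0" "poly q (\<alpha> j) = 0"
  obtains n :: nat and C where "C \<ge> 0" "\<And>b z. b \<ge> 0 \<Longrightarrow> (\<And>i. i \<le> n \<Longrightarrow> height_le \<alpha> (Suc j) b (z i)) \<Longrightarrow>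
    \<exists>\<mu>. (\<forall>i\<le>n. height_le \<alpha> j (C * (1 + b)) (\<mu> i)) \<and> (\<exists>i\<le>n. \<mu> i \<noteq> 0) \<and> (\<Sum>i\<le>n. \<mu> i * z i) = 0"
proof -
  define n where "n = degree q"
  define c where "c = Polynomial.coeff q n"
  define r where "r l = - Polynomial.coeff q l" for l
  have c0: "c \<noteq> 0" using q by (simp add: c_def n_def)
  have n: "n > 0"
  proof (rule ccontr)
    assume "\<not> n > 0"
    then obtain a where "q = [:a:]" unfolding n_def by (metis degree_eq_zeroE gr0I)
    then show False using q by simp
  qed
  have "\<forall>l. \<exists>b. height_le \<alpha> j b (Polynomial.coeff q l)" using q(1) by (auto simp: polys_over_def gen_ring_def)
  then obtain h where h: "\<And>l. height_le \<alpha> j (h l) (Polynomial.coeff q l)" by metis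
  have h0: "h l \<ge> 0" for l using h height_le_nonneg by blast
  define \<beta> where "\<beta> = (\<Sum>l\<le>n. h l)"
  have \<beta>: "\<beta> \<ge> 0" using h0 by (simp add: \<beta>_def sum_nonneg)
  have hb: "height_le \<alpha> j \<beta> (Polynomial.coeff q l)" if "l \<le> n" for l
    using h that h0 by (intro height_le_mono[OF h[of l]]) (auto simp: \<beta>_def intro!: member_le_sum)
  define \<delta> K where "\<delta> = nat \<lfloor>\<beta>\<rfloor>" "K = exp \<beta>"
  have cB: "bounded_poly \<alpha> j \<delta> K c" using hb[of n] by (simp add: height_le_def \<delta>_K_def c_def)
  have rB: "bounded_poly \<alpha> j \<delta> K (r l)" if "l < n" for l
    using height_le_uminus[OF hb[of l]] that by (simp add: height_le_def \<delta>_K_def r_def)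
  have K: "K \<ge> 1" using \<beta> by (simp add: \<delta>_K_def)
  have rel: "c * \<alpha> j ^ n = (\<Sum>l<n. r l * \<alpha> j ^ l)"
  proof -
    have "0 = (\<Sum>l<n. Polynomial.coeff q l * \<alpha> j ^ l) + c * \<alpha> j ^ n"
      using q(3) by (simp add: poly_altdef n_def c_def lessThan_Suc_atMost[symmetric])
    then show ?thesis by (simp add: r_def sum_negf eq_neg_iff_add_eq_0 add.commute)
  qed
  obtain C where C: "C \<ge> 0" and dep: "elimination_bound \<alpha> j (n + 1) {..<n} C"
    using elimination_bound_exists[of "{..<n}" \<alpha> j "n + 1"] by auto
  have "\<exists>\<mu>. (\<forall>i\<le>n. height_le \<alpha> j (C * (\<beta> + 2) * (1 + b)) (\<mu> i)) \<and> (\<exists>i\<le>n. \<mu> i \<noteq> 0) \<and> (\<Sum>i\<le>n. \<mu> i * z i) = 0"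
    if b: "b \<ge> 0" and z: "\<And>i. i \<le> n \<Longrightarrow> height_le \<alpha> (Suc j) b (z i)" for b z
  proof -
    define d where "d = nat \<lfloor>b\<rfloor>"
    have db: "real d \<le> b" using b by (simp add: d_def)
    have "\<forall>i\<le>n. \<exists>u. (\<forall>l<n. bounded_poly \<alpha> j (d * (\<delta> + 1)) (exp b * (2 * K) ^ d) (u l)) \<and>
        c ^ d * z i = (\<Sum>l<n. u l * \<alpha> j ^ l)"
      using algebraic_reduction[OF n cB rB K rel] z unfolding height_le_def d_def by blast
    then obtain u where u: "\<And>i l. i \<le> n \<Longrightarrow> l < n \<Longrightarrow> bounded_poly \<alpha> j (d * (\<delta> + 1)) (exp b * (2 * K) ^ d) (u i l)"
      and uz: "\<And>i. i \<le> n \<Longrightarrow> c ^ d * z i = (\<Sum>l<n. u i l * \<alpha> j ^ l)" by metis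
    \<comment> \<open>\<open>b'\<close> covers the degree \<open>d * (\<delta> + 1)\<close> and the
      logarithmic size \<open>b + d * (1 + \<beta>)\<close>, by
      \<open>\<delta> \<le> \<beta>\<close>, \<open>d \<le> b\<close> and
      \<open>2 * K \<le> exp (1 + \<beta>)\<close>.\<close>
    define b' where "b' = (\<beta> + 2) * b"
    have uh: "height_le \<alpha> j b' (u i l)" if "i \<le> n" "l < n" for i l
    proof (rule height_leI[OF u[OF that]])
      have "real \<delta> \<le> \<beta>" using \<beta> by (simp add: \<delta>_K_def)
      then have "real d * (real \<delta> + 1) \<le> b * (\<beta> + 2)" using db b \<beta> by (intro mult_mono) auto
      then show "real (d * (\<delta> + 1)) \<le> b'" by (simp add: b'_def algebra_simps)
      have "2 * K \<le> exp (1 + \<beta>)" using two_le_exp_one by (simp add: \<delta>_K_def exp_add)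
      then have "(2 * K) ^ d \<le> exp (1 + \<beta>) ^ d" using K by (intro power_mono) auto
      also have "\<dots> = exp (real d * (1 + \<beta>))" by (simp add: exp_of_nat_mult)
      also have "\<dots> \<le> exp (b * (1 + \<beta>))" using db \<beta> by (simp add: mult_right_mono)
      finally have "exp b * (2 * K) ^ d \<le> exp b * exp (b * (1 + \<beta>))" by simp
      also have "\<dots> = exp b'" by (simp add: b'_def algebra_simps flip: exp_add)
      finally show "exp b * (2 * K) ^ d \<le> exp b'" .
    qed
    have b'0: "b' \<ge> 0" using b \<beta> by (simp add: b'_def)
    have "finite {..n}" "card {..n} \<le> n + 1" "card {..<n} < card {..n}"
      "\<forall>i\<in>{..n}. \<forall>l\<in>{..<n}. height_le \<alpha> j b' (u i l)" using uh by auto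
    note elim = elimination_boundD[OF dep b'0 this]
    obtain \<mu> where \<mu>: "\<forall>i\<in>{..n}. height_le \<alpha> j (C * (1 + b')) (\<mu> i)" "\<exists>i\<in>{..n}. \<mu> i \<noteq> 0"
      "\<forall>l\<in>{..<n}. (\<Sum>i\<in>{..n}. \<mu> i * u i l) = 0"
      using elim by (elim exE conjE) (rule that)
    have "C * (1 + b') \<le> C * ((\<beta> + 2) * (1 + b))"
      using C \<beta> by (intro mult_left_mono) (auto simp: b'_def algebra_simps)
    then have "\<forall>i\<le>n. height_le \<alpha> j (C * (\<beta> + 2) * (1 + b)) (\<mu> i)"
      using height_le_mono[OF bspec[OF \<mu>(1)]] by (simp add: mult.assoc)
    moreover have "(\<Sum>i\<le>n. \<mu> i * z i) = 0"
    proof -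
      \<comment> \<open>The same power \<open>c ^ d\<close> clears all the \<open>z i\<close>, and
        it can be cancelled because \<open>c\<close> is nonzero.\<close>
      have "c ^ d * (\<Sum>i\<le>n. \<mu> i * z i) = (\<Sum>i\<le>n. \<mu> i * (c ^ d * z i))"
        by (simp add: sum_distrib_left mult_ac)
      also have "\<dots> = (\<Sum>i\<le>n. \<Sum>l<n. \<mu> i * u i l * \<alpha> j ^ l)"
        by (intro sum.cong refl) (simp add: uz sum_distrib_left mult.assoc)
      also have "\<dots> = (\<Sum>l<n. (\<Sum>i\<le>n. \<mu> i * u i l) * \<alpha> j ^ l)"
        by (subst sum.swap) (simp add: sum_distrib_right)
      also have "\<dots> = 0" using \<mu>(3) by simp
      finally show ?thesis using c0 by simp
    qed
    ultimately show ?thesis using \<mu>(2) by (intro exI[of _ \<mu>]) auto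
  qed
  then show ?thesis using that[of "C * (\<beta> + 2)" n] C \<beta> by simp
qed

section \<open>Finiteness of the residue field\<close>

lemma nonarch_subring:
  assumes "nonarch K f" "is_subring R" "R \<subseteq> K" shows "nonarch R f"
proof -
  interpret nonarch K f by fact
  show ?thesis
    using assms(2,3) f0 f_pos f_mult f_add by unfold_locales (auto simp: subset_iff)
qed

lemma nonarch_fieldI: "nonarch K f \<Longrightarrow> is_subfield K \<Longrightarrow> nonarch_field K f"
  by (simp add: nonarch_field_def nonarch_field_axioms_def)

lemma lowest_index:
  fixes \<mu> :: "nat \<Rightarrow> 'a::zero"
  assumes "\<exists>i\<le>n. \<mu> i \<noteq> 0"
  obtains k where "k \<le> n" "\<mu> k \<noteq> 0" "\<And>i. i < k \<Longrightarrow> \<mu> i = 0"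
proof -
  obtain i where i: "i \<le> n" "\<mu> i \<noteq> 0" using assms by blast
  define k where "k = (LEAST i. \<mu> i \<noteq> 0)"
  have "\<mu> k \<noteq> 0" "k \<le> i" unfolding k_def using i(2) by (rule LeastI, rule Least_le)
  moreover have "\<mu> i = 0" if "i < k" for i using not_less_Least[of i "\<lambda>i. \<mu> i \<noteq> 0"] that by (simp add: k_def)
  ultimately show ?thesis using that i(1) by (metis order_trans)
qed

text \<open>Dividing the relation by \<open>x ^ k\<close> leaves \<open>\<mu> k = - (x * s)\<close>
  with \<open>s\<close> integral, so \<open>x\<close> divides \<open>\<mu> k\<close>. This carries
  lower bounds, and the property of being a unit, from the coefficients up to
  \<open>x\<close>.\<close>

lemma (in nonarch) lowest_coeff_le:
  assumes x: "x \<in> K" "f x \<le> 1" and \<mu>: "\<And>i. i \<le> n \<Longrightarrow> \<mu> i \<in> K \<and> f (\<mu> i) \<le> 1"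
    and k: "k \<le> n" and least: "\<And>i. i < k \<Longrightarrow> \<mu> i = 0"
    and rel: "(\<Sum>i\<le>n. \<mu> i * x ^ i) = 0" and x0: "x \<noteq> 0"
  shows "f (\<mu> k) \<le> f x"
proof -
  define s where "s = (\<Sum>i\<in>{Suc k..n}. \<mu> i * x ^ (i - Suc k))"
  have "(\<Sum>i\<le>n. \<mu> i * x ^ i) = (\<Sum>i\<in>{k..n}. \<mu> i * x ^ i)"
    using least by (intro sum.mono_neutral_right) auto
  also have "\<dots> = \<mu> k * x ^ k + (\<Sum>i\<in>{Suc k..n}. \<mu> i * x ^ i)"
    using k by (simp add: sum.atLeast_Suc_atMost)
  also have "(\<Sum>i\<in>{Suc k..n}. \<mu> i * x ^ i) = x ^ Suc k * s"
    unfolding s_def sum_distrib_left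
    by (intro sum.cong refl) (simp add: mult.left_commute flip: power_add power_Suc)
  finally have "x ^ k * (\<mu> k + x * s) = 0" using rel by (simp add: algebra_simps)
  then have "\<mu> k = - (x * s)" using x0 by (simp add: eq_neg_iff_add_eq_0)
  moreover have s: "s \<in> K \<and> f s \<le> 1"
  proof -
    have "s \<in> {x \<in> K. f x \<le> 1}"
      unfolding s_def
      by (intro subring_sum[OF integers_subring] subring_mult[OF integers_subring] subring_power[OF integers_subring])
         (use x \<mu> in auto)
    then show ?thesis by simp
  qed
  ultimately have "f (\<mu> k) = f x * f s" using x f_uminus[of "x * s"] f_mult[of x s] subring_mult[OF K] by simp
  also have "\<dots> \<le> f x" using s f_nonneg[OF x(1)] by (simp add: mult_left_le)
  finally show ?thesis .
qed

section \<open>Roots in the residue field, and residue fields of algebraic extensions\<close>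

lemma synthetic_div_polys_over:
  assumes "is_subring B" "c \<in> B" "q \<in> polys_over B" shows "synthetic_div q c \<in> polys_over B"
  using assms(3)
proof (induction q)
  case 0
  then show ?case by (simp add: polys_over_0[OF assms(1)])
next
  case (pCons a q)
  have "q \<in> polys_over B"
    using pCons.prems unfolding polys_over_def by (auto, metis coeff_pCons_Suc)
  then show ?case
    using pCons.IH subring_poly[OF assms(1)] assms(2) by (simp add: polys_over_pCons[OF assms(1)])
qed

text \<open>A nonzero polynomial over the residue field has finitely many roots; the argument runs
  through representatives. If \<open>y0\<close> is a root modulo the maximal ideal, dividing by
  \<open>X - y0\<close> lowers the degree.\<close>

lemma (in nonarch) finite_residue_roots:
  assumes "\<tau> \<in> polys_over {x \<in> K. f x \<le> 1}" "\<exists>i. f (Polynomial.coeff \<tau> i) = 1"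
  shows "\<exists>Y. finite Y \<and> Y \<subseteq> K \<and> (\<forall>y\<in>K. f y \<le> 1 \<longrightarrow> f (poly \<tau> y) < 1 \<longrightarrow> (\<exists>t\<in>Y. f (y - t) < 1))"
  using assms
proof (induction "degree \<tau>" arbitrary: \<tau> rule: less_induct)
  case less
  let ?O = "{x \<in> K. f x \<le> 1}"
  note O = integers_subring
  show ?case
  proof (cases "\<exists>y\<in>K. f y \<le> 1 \<and> f (poly \<tau> y) < 1")
    case False
    then show ?thesis by (intro exI[of _ "{}"]) auto
  next
    case True
    then obtain y0 where y0: "y0 \<in> K" "f y0 \<le> 1" "f (poly \<tau> y0) < 1" by blast
    have "degree \<tau> \<noteq> 0"
    proof
      assume "degree \<tau> = 0"
      then obtain a where a: "\<tau> = [:a:]" by (metis degree_eq_zeroE)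
      then have "f a \<noteq> 1" using y0 by simp
      then have "f (Polynomial.coeff \<tau> i) \<noteq> 1" for i using a f0 by (cases i) auto
      then show False using less.prems(2) by blast
    qed
    define \<sigma> where "\<sigma> = synthetic_div \<tau> y0"
    have \<sigma>O: "\<sigma> \<in> polys_over ?O"
      unfolding \<sigma>_def using y0 less.prems by (intro synthetic_div_polys_over[OF O]) auto
    have \<tau>: "\<tau> = [:- y0, 1:] * \<sigma> + [:poly \<tau> y0:]"
      unfolding \<sigma>_def by (rule synthetic_div_correct'[symmetric])
    have deg: "degree \<sigma> < degree \<tau>" using \<open>degree \<tau> \<noteq> 0\<close> by (simp add: \<sigma>_def degree_synthetic_div)
    have \<tau>y: "poly \<tau> y \<in> ?O" if "y \<in> K" "f y \<le> 1" for y
      using that less.prems by (intro subring_poly[OF O]) auto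
    \<comment> \<open>The quotient stays nonzero in the residue field: otherwise
      \<open>\<tau> = (X - y0) * \<sigma> + \<tau>(y0)\<close> would have only coefficients of value
      below 1.\<close>
    have "\<exists>i. f (Polynomial.coeff \<sigma> i) = 1"
    proof (rule ccontr)
      assume "\<nexists>i. f (Polynomial.coeff \<sigma> i) = 1"
      then have lt: "Polynomial.coeff \<sigma> i \<in> K \<and> f (Polynomial.coeff \<sigma> i) < 1" for i
        using \<sigma>O by (force simp: polys_over_def order.strict_iff_order)
      have "f (Polynomial.coeff \<tau> i) < 1" for i
      proof -
        define e where "e = (if i = 0 then poly \<tau> y0 else Polynomial.coeff \<sigma> (i - 1))"
        have "Polynomial.coeff \<tau> i = e - y0 * Polynomial.coeff \<sigma> i"
          by (subst \<tau>) (auto simp: e_def coeff_pCons split: nat.split)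
        moreover have "e \<in> K" "f e < 1" using lt y0 \<tau>y[of y0] by (auto simp: e_def)
        moreover have "f (y0 * Polynomial.coeff \<sigma> i) < 1"
        proof -
          have "f y0 * f (Polynomial.coeff \<sigma> i) \<le> f (Polynomial.coeff \<sigma> i)"
            using y0 lt f_nonneg by (simp add: mult_left_le_one_le)
          then show ?thesis using lt[of i] y0 f_mult by simp
        qed
        moreover have "y0 * Polynomial.coeff \<sigma> i \<in> K" using lt y0 subring_mult[OF K] by blast
        ultimately show ?thesis using f_diff[of e "y0 * Polynomial.coeff \<sigma> i"] by simp
      qed
      then show False using less.prems(2) by (metis less_irrefl)
    qed
    then obtain Y where Y: "finite Y" "Y \<subseteq> K"
      "\<forall>y\<in>K. f y \<le> 1 \<longrightarrow> f (poly \<sigma> y) < 1 \<longrightarrow> (\<exists>t\<in>Y. f (y - t) < 1)"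
      using less.hyps[OF deg \<sigma>O] by blast
    have "\<exists>t\<in>insert y0 Y. f (y - t) < 1" if y: "y \<in> K" "f y \<le> 1" "f (poly \<tau> y) < 1" for y
    proof (cases "f (poly \<sigma> y) < 1")
      case True
      then show ?thesis using Y y by blast
    next
      case False
      have \<sigma>y: "poly \<sigma> y \<in> K" "f (poly \<sigma> y) \<le> 1"
        using subring_poly[OF O \<sigma>O] y by auto
      then have "f (poly \<sigma> y) = 1" using False by simp
      \<comment> \<open>The second factor has value 1 and the product is small, so \<open>y\<close>
        lies in the residue class of \<open>y0\<close>.\<close>
      moreover have "(y - y0) * poly \<sigma> y = poly \<tau> y - poly \<tau> y0"
        by (subst \<tau>) (simp add: algebra_simps)
      then have "f ((y - y0) * poly \<sigma> y) < 1"
        using f_diff[of "poly \<tau> y" "poly \<tau> y0"] \<tau>y y y0 by auto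
      ultimately have "f (y - y0) < 1"
        using f_mult[of "y - y0" "poly \<sigma> y"] subring_diff[OF K] y y0 \<sigma>y by simp
      then show ?thesis by blast
    qed
    then show ?thesis using Y y0 by (intro exI[of _ "insert y0 Y"]) auto
  qed
qed

lemma finite_bounded_polys:
  fixes T :: "'a::zero set"
  assumes "finite T" shows "finite {q. degree q \<le> n \<and> q \<in> polys_over T}"
proof (rule finite_subset)
  show "{q. degree q \<le> n \<and> q \<in> polys_over T} \<subseteq> Poly ` {xs. set xs \<subseteq> T \<and> length xs = Suc n}"
  proof clarify
    fix q assume q: "degree q \<le> n" "q \<in> polys_over T"
    have "q = Poly (map (Polynomial.coeff q) [0..<Suc n])"
      using q(1) by (intro poly_eqI) (auto simp: coeff_Poly_eq nth_default_def coeff_eq_0 simp del: upt_Suc)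
    moreover have "set (map (Polynomial.coeff q) [0..<Suc n]) \<subseteq> T"
      using q(2) by (auto simp: polys_over_def)
    ultimately show "q \<in> Poly ` {xs. set xs \<subseteq> T \<and> length xs = Suc n}"
      by (intro image_eqI) (auto simp del: upt_Suc)
  qed
  show "finite (Poly ` {xs. set xs \<subseteq> T \<and> length xs = Suc n})"
    using assms by (intro finite_imageI finite_lists_length_eq)
qed

text \<open>Finiteness of the residue field phrased by representatives, so that it passes through
  extensions without quotient rings.\<close>

definition finite_residue :: "'a::field set \<Rightarrow> ('a \<Rightarrow> real) \<Rightarrow> bool" where
  "finite_residue K f \<longleftrightarrow>
    (\<exists>T. finite T \<and> T \<subseteq> K \<and> (\<forall>x\<in>K. f x \<le> 1 \<longrightarrow> (\<exists>t\<in>T. f (x - t) < 1)))"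

text \<open>Scale the relation for an integral \<open>y\<close> so that a coefficient of largest
  value becomes \<open>1\<close>, and replace the coefficients by representatives from
  \<open>T\<close>. Then \<open>y\<close> is a root, modulo the maximal ideal, of one of finitely
  many polynomials, each with finitely many residue roots.\<close>

lemma finite_residue_extension:
  assumes Kf: "nonarch_field K f" and Kf': "nonarch_field K' f'" and sub: "K \<subseteq> K'"
    and ext: "\<And>x. x \<in> K \<Longrightarrow> f' x = f x" and fin: "finite_residue K f"
    and dep: "\<And>y. y \<in> K' \<Longrightarrow> \<exists>\<mu>. (\<forall>i\<le>n. \<mu> i \<in> K) \<and> (\<exists>i\<le>n. \<mu> i \<noteq> 0) \<and> (\<Sum>i\<le>n. \<mu> i * y ^ i) = 0"
  shows "finite_residue K' f'"
proof -
  interpret A: nonarch_field K f by fact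
  interpret B: nonarch_field K' f' by fact
  let ?O = "{x \<in> K'. f' x \<le> 1}"
  obtain T where T: "finite T" "T \<subseteq> K" "\<And>x. x \<in> K \<Longrightarrow> f x \<le> 1 \<Longrightarrow> \<exists>t\<in>T. f (x - t) < 1"
    using fin unfolding finite_residue_def by auto
  \<comment> \<open>\<open>0\<close> is added to \<open>T\<close> for the coefficients beyond degree
    \<open>n\<close>.\<close>
  define Q where "Q = {q. degree q \<le> n \<and> q \<in> polys_over (insert 0 T)}"
  define Q' where "Q' = {\<tau> \<in> Q. \<tau> \<in> polys_over ?O \<and> (\<exists>i. f' (Polynomial.coeff \<tau> i) = 1)}"
  have "finite Q" unfolding Q_def using T by (intro finite_bounded_polys) simp
  then have "finite Q'" unfolding Q'_def by simp
  have "\<forall>\<tau>\<in>Q'. \<exists>Y. finite Y \<and> Y \<subseteq> K' \<and>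
      (\<forall>y\<in>K'. f' y \<le> 1 \<longrightarrow> f' (poly \<tau> y) < 1 \<longrightarrow> (\<exists>t\<in>Y. f' (y - t) < 1))"
    unfolding Q'_def using B.finite_residue_roots by auto
  then obtain Y where Y: "\<And>\<tau>. \<tau> \<in> Q' \<Longrightarrow> finite (Y \<tau>) \<and> Y \<tau> \<subseteq> K' \<and>
      (\<forall>y\<in>K'. f' y \<le> 1 \<longrightarrow> f' (poly \<tau> y) < 1 \<longrightarrow> (\<exists>t\<in>Y \<tau>. f' (y - t) < 1))" by metis
  have "\<exists>t\<in>(\<Union>\<tau>\<in>Q'. Y \<tau>). f' (y - t) < 1" if y: "y \<in> K'" "f' y \<le> 1" for y
  proof -
    obtain \<mu> where \<mu>: "\<And>i. i \<le> n \<Longrightarrow> \<mu> i \<in> K" "\<exists>i\<le>n. \<mu> i \<noteq> 0" "(\<Sum>i\<le>n. \<mu> i * y ^ i) = 0"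
      using dep[OF y(1)] by auto
    \<comment> \<open>Provides an index \<open>m\<close> of largest value; division by
      \<open>\<mu> m\<close> makes all coefficients integral and one of them equal to
      \<open>1\<close>.\<close>
    have "Max ((\<lambda>i. f (\<mu> i)) ` {..n}) \<in> (\<lambda>i. f (\<mu> i)) ` {..n}" by (intro Max_in) auto
    then obtain m where "Max ((\<lambda>i. f (\<mu> i)) ` {..n}) = f (\<mu> m)" "m \<in> {..n}" by (rule imageE)
    then have m: "m \<le> n" "f (\<mu> m) = Max ((\<lambda>i. f (\<mu> i)) ` {..n})" by simp_all
    have max: "f (\<mu> i) \<le> f (\<mu> m)" if "i \<le> n" for i unfolding m(2) using that by (intro Max_ge) auto
    have m0: "\<mu> m \<noteq> 0"
    proof
      assume "\<mu> m = 0"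
      then have "f (\<mu> i) \<le> 0" if "i \<le> n" for i using max[OF that] A.f0 by simp
      then show False using \<mu> A.f_pos by (metis not_le)
    qed
    define \<nu> where "\<nu> i = \<mu> i / \<mu> m" for i
    have \<nu>K: "\<nu> i \<in> K" if "i \<le> n" for i unfolding \<nu>_def using \<mu> m that subfield_divide[OF A.K_field] by blast
    have \<nu>1: "f (\<nu> i) \<le> 1" if "i \<le> n" for i
      unfolding \<nu>_def using A.f_divide \<mu>(1) that m max[OF that] A.f_pos[of "\<mu> m"] m0 by simp
    have "\<forall>i\<le>n. \<exists>t\<in>T. f (\<nu> i - t) < 1" using T(3) \<nu>K \<nu>1 by simp
    then obtain t where t: "\<And>i. i \<le> n \<Longrightarrow> t i \<in> T" "\<And>i. i \<le> n \<Longrightarrow> f (\<nu> i - t i) < 1" by metis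
    have tK: "t i \<in> K" if "i \<le> n" for i using t T that by blast
    have t1: "f (t i) \<le> 1" if "i \<le> n" for i
      using A.f_diff[of "\<nu> i" "\<nu> i - t i"] \<nu>K \<nu>1 tK t(2) subring_diff[OF A.K] that by fastforce
    have "f (t m) = f (\<nu> m)"
      using A.f_eq_if_diff_less[of "t m" "\<nu> m"] A.f_diff_commute[of "t m" "\<nu> m"] tK \<nu>K m t(2)[OF m(1)] m0 A.f_one subring_one[OF A.K]
      by (simp add: \<nu>_def)
    then have tm: "f (t m) = 1" using m0 A.f_one by (simp add: \<nu>_def)
    define \<tau> where "\<tau> = (\<Sum>i\<le>n. Polynomial.monom (t i) i)"
    have coeff: "Polynomial.coeff \<tau> i = (if i \<le> n then t i else 0)" for i
      by (simp add: \<tau>_def coeff_sum)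
    have "\<tau> \<in> Q'"
      unfolding Q'_def Q_def polys_over_def mem_Collect_eq
    proof (intro conjI allI)
      show "degree \<tau> \<le> n" by (intro degree_le) (simp add: coeff)
      show "\<exists>i. f' (Polynomial.coeff \<tau> i) = 1" using tm m tK ext by (intro exI[of _ m]) (simp add: coeff)
      fix i show "Polynomial.coeff \<tau> i \<in> insert 0 T" "Polynomial.coeff \<tau> i \<in> K'" "f' (Polynomial.coeff \<tau> i) \<le> 1"
        using t tK t1 ext sub subring_zero[OF B.K] B.f0 by (auto simp: coeff)
    qed
    moreover have "f' (poly \<tau> y) < 1"
    proof -
      have "(\<Sum>i\<le>n. \<nu> i * y ^ i) = (\<Sum>i\<le>n. \<mu> i * y ^ i) / \<mu> m"
        by (simp add: \<nu>_def sum_divide_distrib)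
      then have "poly \<tau> y = - (\<Sum>i\<le>n. (\<nu> i - t i) * y ^ i)"
        using \<mu>(3) by (simp add: \<tau>_def poly_sum poly_monom left_diff_distrib sum_subtractf)
      moreover have "f' (\<Sum>i\<le>n. (\<nu> i - t i) * y ^ i) < 1"
      proof (rule B.f_sum_less)
        fix i assume "i \<in> {..n}"
        then have i: "\<nu> i - t i \<in> K" "f (\<nu> i - t i) < 1" using \<nu>K tK t(2) subring_diff[OF A.K] by auto
        then have i': "\<nu> i - t i \<in> K'" using sub by blast
        have "f' (\<nu> i - t i) * f' y ^ i \<le> f' (\<nu> i - t i)"
          using y B.f_nonneg i' by (intro mult_left_le) (auto intro: power_le_one)
        then have "f' ((\<nu> i - t i) * y ^ i) < 1"
          using i i' y ext by (simp add: B.f_mult B.f_power subring_power[OF B.K])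
        then show "(\<nu> i - t i) * y ^ i \<in> K' \<and> f' ((\<nu> i - t i) * y ^ i) < 1"
          using i' y subring_mult[OF B.K] subring_power[OF B.K] by blast
      qed simp
      moreover have "(\<Sum>i\<le>n. (\<nu> i - t i) * y ^ i) \<in> K'"
        using \<nu>K tK sub y
        by (intro subring_sum[OF B.K] subring_mult[OF B.K] subring_power[OF B.K] subring_diff[OF B.K]) auto
      ultimately show ?thesis by (simp add: B.f_uminus)
    qed
    ultimately show ?thesis using Y y by blast
  qed
  moreover have "finite (\<Union>\<tau>\<in>Q'. Y \<tau>)" "(\<Union>\<tau>\<in>Q'. Y \<tau>) \<subseteq> K'" using Y \<open>finite Q'\<close> by auto
  ultimately show ?thesis unfolding finite_residue_def by blast
qed

section \<open>Adjoining one generator\<close>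

text \<open>The invariant of the induction on the number of generators. The \<open>1\<close> in
  \<open>1 + b\<close> leaves room for the fixed losses of a step, which are charged to
  \<open>A\<close> even if \<open>b = 0\<close>.\<close>

definition good_absval :: "(nat \<Rightarrow> 'a::field) \<Rightarrow> nat \<Rightarrow> nat \<Rightarrow> ('a \<Rightarrow> real) \<Rightarrow> real \<Rightarrow> bool" where
  "good_absval \<alpha> j p f A \<longleftrightarrow>
    nonarch_field (fractions (gen_ring \<alpha> j)) f \<and> f (of_nat p) = 1 / real p \<and>
    (\<forall>x\<in>gen_ring \<alpha> j. f x \<le> 1) \<and> A \<ge> 0 \<and>
    (\<forall>b x. height_le \<alpha> j b x \<longrightarrow> x \<noteq> 0 \<longrightarrow> exp (- A * (1 + b)) \<le> f x) \<and>
    finite_residue (fractions (gen_ring \<alpha> j)) f"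

text \<open>The \<open>p\<close>-adic absolute value. Its lower bound is elementary: the power of
  \<open>p\<close> dividing a nonzero integer is at most the size of that integer, hence at most the
  exponential of the height.\<close>

lemma good_absval_base:
  fixes \<alpha> :: "nat \<Rightarrow> 'a::field_char_0"
  assumes p: "Factorial_Ring.prime p" and m: "\<not> int p dvd m"
  shows "\<exists>f A. good_absval \<alpha> 0 p f A \<and> f (of_int m) = 1"
proof -
  let ?R = "gen_ring \<alpha> 0" and ?K = "fractions (gen_ring \<alpha> 0)"
  have pp: "Factorial_Ring.prime_elem (int p)" and p1: "p > 1" using p prime_gt_1_nat by auto
  have ip: "int p \<noteq> 0" "\<not> is_unit (int p)" using p1 by auto
  have R: "?R = range of_int"
  proof
    show "?R \<subseteq> range of_int"
      using bounded_poly_zero_vars unfolding gen_ring_def height_le_def by blast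
    show "range of_int \<subseteq> ?R" using subring_of_int[OF gen_ring_subring] by blast
  qed
  define h where "h n = (if n = 0 then 0 else (1 / real p) ^ multiplicity (int p) n)" for n
  define f0 where "f0 x = h (inv_into UNIV of_int x)" for x :: 'a
  have "inj (of_int :: int \<Rightarrow> 'a)" by (simp add: inj_def)
  then have f0: "f0 (of_int n) = h n" for n by (simp add: f0_def inv_into_f_f)
  have h_pos: "h n > 0" if "n \<noteq> 0" for n using that p1 by (simp add: h_def)
  have h_mult: "h (m * n) = h m * h n" for m n
    using prime_elem_multiplicity_mult_distrib[OF pp, of m n] by (auto simp: h_def power_add)
  have h_le: "h n \<le> (1 / real p) ^ k \<longleftrightarrow> int p ^ k dvd n" for n k
  proof (cases "n = 0")
    case False
    have "int p ^ k dvd n \<longleftrightarrow> k \<le> multiplicity (int p) n"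
      using False ip by (intro power_dvd_iff_le_multiplicity) auto
    also have "\<dots> \<longleftrightarrow> (1 / real p) ^ multiplicity (int p) n \<le> (1 / real p) ^ k"
      using p1 by (subst power_decreasing_iff) auto
    finally show ?thesis using False by (simp add: h_def)
  qed (simp add: h_def)
  have h_add: "h (m + n) \<le> max (h m) (h n)" for m n
  proof (cases "m = 0 \<or> n = 0")
    case False
    define k where "k = min (multiplicity (int p) m) (multiplicity (int p) n)"
    have "int p ^ k dvd m" "int p ^ k dvd n" unfolding k_def by (auto intro: multiplicity_dvd')
    then have "h (m + n) \<le> (1 / real p) ^ k" by (simp add: h_le)
    also have "\<dots> \<le> max (h m) (h n)" using False by (auto simp: k_def h_def min_def)
    finally show ?thesis .
  qed (auto simp: h_def)
  have "nonarch ?R f0"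
  proof
    show "is_subring ?R" by (rule gen_ring_subring)
    show "f0 0 = 0" using f0[of 0] by (simp add: h_def)
    show "f0 x > 0" if "x \<in> ?R" "x \<noteq> 0" for x
      using that h_pos unfolding R by (auto simp: f0)
    fix x y assume "x \<in> ?R" "y \<in> ?R"
    then obtain m n where "x = of_int m" "y = of_int n" unfolding R by blast
    then show "f0 (x * y) = f0 x * f0 y" "f0 (x + y) \<le> max (f0 x) (f0 y)"
      using h_mult h_add f0 by (simp_all flip: of_int_mult of_int_add)
  qed
  then obtain f where f: "nonarch ?K f" and "\<And>x. x \<in> ?R \<Longrightarrow> f x = f0 x"
    using nonarch.fraction_extension by blast
  then have fh: "f (of_int n) = h n" for n using f0 R by auto
  interpret nonarch_field ?K f by (intro nonarch_fieldI f fractions_subfield gen_ring_subring)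
  have K: "\<exists>a b. b \<noteq> 0 \<and> x = of_int a / of_int b" if "x \<in> ?K" for x
  proof -
    obtain a b where ab: "x = of_int a / of_int b" using \<open>x \<in> ?K\<close> unfolding fractions_def R by blast
    show ?thesis
    proof (cases "b = 0")
      case True
      then show ?thesis using ab by (intro exI[of _ 0] exI[of _ 1]) simp
    qed (use ab in blast)
  qed
  have ZK: "of_int n \<in> ?K" for n using subset_fractions[OF gen_ring_subring] R by blast
  have h1: "h n \<le> 1" for n using h_le[of n 0] by simp
  have hp: "h (int p) = 1 / real p" using p1 ip by (simp add: h_def multiplicity_self)
  have hlt: "h n < 1" if "int p dvd n" for n
  proof -
    have "h n \<le> 1 / real p" using h_le[of n 1] that by simp
    also have "\<dots> < 1" using p1 by simp
    finally show ?thesis .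
  qed
  have "finite_residue ?K f"
    unfolding finite_residue_def
  proof (intro exI[of _ "of_int ` {0..<int p}"] conjI ballI impI)
    fix x assume x: "x \<in> ?K" "f x \<le> 1"
    then obtain a b where ab: "b \<noteq> 0" "x = of_int a / of_int b" using K by blast
    have "h b > 0" using h_pos ab by simp
    moreover have "f x = h a / h b" unfolding ab by (simp add: f_divide ZK fh)
    ultimately have le: "h a \<le> h b" using x by simp
    \<comment> \<open>As \<open>x\<close> is integral, the power of \<open>p\<close> exactly
      dividing \<open>b\<close> also divides \<open>a\<close>, so the denominator can be made prime
      to \<open>p\<close>.\<close>
    define k where "k = multiplicity (int p) b"
    have "h b \<le> (1 / real p) ^ k" using ab by (simp add: h_def k_def)
    then have "int p ^ k dvd a" using le h_le order_trans by blast
    then obtain a' where a': "a = int p ^ k * a'" by blast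
    obtain b' where b': "b = int p ^ k * b'" "\<not> int p dvd b'"
      unfolding k_def using multiplicity_decompose'[of b "int p"] ab ip by blast
    have "coprime (int p) b'" using b'(2) p by (simp add: prime_imp_coprime)
    then obtain u v where uv: "int p * u + b' * v = 1"
      using bezout_int[of "int p" b'] by (metis coprime_iff_gcd_eq_1 mult.commute)
    \<comment> \<open>\<open>v\<close> inverts \<open>b'\<close> modulo \<open>p\<close>, so
      \<open>t\<close> is the residue of \<open>a' / b'\<close>.\<close>
    define t where "t = (v * a') mod int p"
    have "int p dvd v * a' - t" by (simp add: t_def minus_mod_eq_mult_div)
    then have "int p dvd b' * (v * a' - t)" by simp
    moreover have "a' - b' * t = int p * (u * a') + b' * (v * a' - t)"
    proof -
      have "a' = (int p * u + b' * v) * a'" using uv by simp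
      then show ?thesis by (simp add: algebra_simps)
    qed
    ultimately have "int p dvd a' - b' * t" by simp
    then have "h (a' - b' * t) < 1" by (rule hlt)
    moreover have "h b' = 1" using b'(2) ab b' by (auto simp: h_def not_dvd_imp_multiplicity_0)
    moreover have "b' \<noteq> 0" using b' ab by auto
    then have "x - of_int t = of_int (a' - b' * t) / of_int b'"
      using ab b'(1) a' ip by (simp add: field_simps)
    then have "f (x - of_int t) = h (a' - b' * t) / h b'"
      using f_divide[OF ZK ZK, of "a' - b' * t" b'] by (simp only: fh)
    ultimately have "f (x - of_int t) < 1" by simp
    moreover have "t \<in> {0..<int p}" using p1 by (simp add: t_def)
    ultimately show "\<exists>t\<in>of_int ` {0..<int p}. f (x - t) < 1" by blast
  qed (use ZK in auto)
  moreover have "exp (- 1 * (1 + b)) \<le> f x" if x: "height_le \<alpha> 0 b x" "x \<noteq> 0" for b x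
  proof -
    obtain n where n: "x = of_int n" "\<bar>real_of_int n\<bar> \<le> exp b"
      using bounded_poly_zero_vars x unfolding height_le_def by blast
    have n0: "n \<noteq> 0" using n x by auto
    define k where "k = multiplicity (int p) n"
    have "int p ^ k dvd n" unfolding k_def by (rule multiplicity_dvd)
    then have "int p ^ k \<le> \<bar>n\<bar>" using n0 by (intro zdvd_imp_le) auto
    then have "real p ^ k \<le> \<bar>real_of_int n\<bar>"
      by (metis of_int_abs of_int_le_iff of_int_of_nat_eq of_int_power)
    also have "\<dots> \<le> exp (1 + b)" using n by (simp add: exp_add) (smt (verit) exp_gt_zero two_le_exp_one mult_le_cancel_right1)
    finally have "inverse (exp (1 + b)) \<le> inverse (real p ^ k)" using p1 by (intro le_imp_inverse_le) auto
    then show ?thesis using n n0 fh by (simp add: h_def k_def exp_minus power_one_over inverse_eq_divide exp_diff exp_add)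
  qed
  moreover have "f (of_nat p) = 1 / real p" using fh[of "int p"] hp by simp
  moreover have "f x \<le> 1" if "x \<in> ?R" for x using that h1 fh unfolding R by auto
  moreover have "f (of_int m) = 1" using fh[of m] m by (auto simp: h_def not_dvd_imp_multiplicity_0)
  ultimately show ?thesis
    unfolding good_absval_def using nonarch_field_axioms by (intro exI[of _ f] exI[of _ 1]) auto
qed

lemma fractions_cases:
  assumes "is_subring R" "y \<in> fractions R"
  obtains a b where "a \<in> R" "b \<in> R" "b \<noteq> 0" "y = a / b"
proof -
  obtain a b where ab: "a \<in> R" "b \<in> R" "y = a / b" using assms(2) unfolding fractions_def by auto
  show ?thesis
  proof (cases "b = 0")
    case True
    then have "y = 0 / 1" using ab by simp
    then show ?thesis using that subring_zero[OF assms(1)] subring_one[OF assms(1)] zero_neq_one by metis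
  qed (use ab that in blast)
qed

text \<open>Collects the data of an algebraic generator that do not involve \<open>p\<close>: they
  must be fixed first, since the primes to avoid are computed from them.\<close>

locale algebraic_step =
  fixes \<alpha> :: "nat \<Rightarrow> 'a::field" and j :: nat and q :: "'a poly" and n :: nat and C :: real
  assumes q: "q \<in> polys_over (gen_ring \<alpha> j)" "q \<noteq> 0" "poly q (\<alpha> j) = 0"
    and C: "C \<ge> 0"
    and dep: "\<And>b z. b \<ge> 0 \<Longrightarrow> (\<And>i. i \<le> n \<Longrightarrow> height_le \<alpha> (Suc j) b (z i)) \<Longrightarrow>
      \<exists>\<mu>. (\<forall>i\<le>n. height_le \<alpha> j (C * (1 + b)) (\<mu> i)) \<and> (\<exists>i\<le>n. \<mu> i \<noteq> 0) \<and> (\<Sum>i\<le>n. \<mu> i * z i) = 0"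
begin

lemma power_dependency:
  assumes "height_le \<alpha> (Suc j) b x"
  shows "\<exists>\<mu>. (\<forall>i\<le>n. height_le \<alpha> j (C * (1 + real n * b)) (\<mu> i)) \<and> (\<exists>i\<le>n. \<mu> i \<noteq> 0) \<and> (\<Sum>i\<le>n. \<mu> i * x ^ i) = 0"
proof (rule dep)
  have b: "b \<ge> 0" using assms by (rule height_le_nonneg)
  then show "0 \<le> real n * b" by simp
  show "height_le \<alpha> (Suc j) (real n * b) (x ^ i)" if "i \<le> n" for i
    using that b by (intro height_le_mono[OF height_le_power[OF assms]] mult_right_mono) auto
qed

text \<open>Heights are available only in the ring, so the powers of \<open>y = a / d\<close> are
  first multiplied by \<open>d ^ n\<close>, which turns them into
  \<open>a ^ i * d ^ (n - i)\<close>.\<close>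

lemma fraction_dependency:
  assumes y: "y \<in> fractions (gen_ring \<alpha> (Suc j))"
  shows "\<exists>\<mu>. (\<forall>i\<le>n. \<mu> i \<in> gen_ring \<alpha> j) \<and> (\<exists>i\<le>n. \<mu> i \<noteq> 0) \<and> (\<Sum>i\<le>n. \<mu> i * y ^ i) = 0"
proof -
  obtain a d where ad: "a \<in> gen_ring \<alpha> (Suc j)" "d \<in> gen_ring \<alpha> (Suc j)" "d \<noteq> 0" "y = a / d"
    using fractions_cases[OF gen_ring_subring y] .
  then obtain b1 b2 where b12: "height_le \<alpha> (Suc j) b1 a" "height_le \<alpha> (Suc j) b2 d"
    by (auto simp: gen_ring_def)
  define b where "b = max b1 b2"
  have b: "height_le \<alpha> (Suc j) b a" "height_le \<alpha> (Suc j) b d"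
    using b12 by (auto simp: b_def intro: height_le_mono)
  then have b0: "b \<ge> 0" using height_le_nonneg by blast
  have h: "height_le \<alpha> (Suc j) (real n * b) (a ^ i * d ^ (n - i))" if "i \<le> n" for i
  proof -
    have "height_le \<alpha> (Suc j) (real i * b + real (n - i) * b) (a ^ i * d ^ (n - i))"
      using b by (intro height_le_mult height_le_power)
    then show ?thesis using that by (simp add: of_nat_diff algebra_simps)
  qed
  then obtain \<mu> where \<mu>: "\<forall>i\<le>n. height_le \<alpha> j (C * (1 + real n * b)) (\<mu> i)" "\<exists>i\<le>n. \<mu> i \<noteq> 0"
    "(\<Sum>i\<le>n. \<mu> i * (a ^ i * d ^ (n - i))) = 0"
    using dep[of "real n * b" "\<lambda>i. a ^ i * d ^ (n - i)"] b0 by auto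
  have "(\<Sum>i\<le>n. \<mu> i * (a ^ i * d ^ (n - i))) = d ^ n * (\<Sum>i\<le>n. \<mu> i * y ^ i)"
    unfolding sum_distrib_left
  proof (intro sum.cong refl)
    fix i assume "i \<in> {..n}"
    then have "d ^ n = d ^ i * d ^ (n - i)" by (simp flip: power_add)
    then show "\<mu> i * (a ^ i * d ^ (n - i)) = d ^ n * (\<mu> i * y ^ i)"
      using ad by (simp add: power_divide)
  qed
  then have "(\<Sum>i\<le>n. \<mu> i * y ^ i) = 0" using \<mu>(3) ad by simp
  then show ?thesis using \<mu>(1,2) by (auto simp: gen_ring_def)
qed

text \<open>The unit leading coefficient makes \<open>\<alpha> j\<close> integral, so the larger
  ring stays inside the valuation ring. For nonzero \<open>x\<close> of bounded height the relation
  among its powers has coefficients of bounded height, and the lowest nonzero one has value at most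
  that of \<open>x\<close>.\<close>

lemma extends:
  assumes good: "good_absval \<alpha> j p f A" and p: "p > 1" "of_nat p \<noteq> (0::'a)"
    and lead: "f (Polynomial.coeff q (degree q)) = 1"
  obtains f' A' where "good_absval \<alpha> (Suc j) p f' A'" "\<And>x. x \<in> gen_ring \<alpha> j \<Longrightarrow> f' x = f x"
proof -
  let ?R = "gen_ring \<alpha> j" and ?R' = "gen_ring \<alpha> (Suc j)"
  let ?K = "fractions ?R" and ?K' = "fractions ?R'"
  interpret A: nonarch_field ?K f using good by (simp add: good_absval_def)
  have RK: "?R \<subseteq> ?K" "?R' \<subseteq> ?K'" "?K \<subseteq> ?K'" "?R \<subseteq> ?R'"
    by (rule subset_fractions[OF gen_ring_subring] fractions_mono[OF gen_ring_mono_Suc] gen_ring_mono_Suc)+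
  have alg: "\<exists>r\<in>polys_over ?K. r \<noteq> 0 \<and> poly r y = 0" if y: "y \<in> ?K'" for y
  proof -
    obtain \<mu> where \<mu>: "\<forall>i\<le>n. \<mu> i \<in> ?R" "\<exists>i\<le>n. \<mu> i \<noteq> 0" "(\<Sum>i\<le>n. \<mu> i * y ^ i) = 0"
      using fraction_dependency[OF y] by auto
    define r where "r = (\<Sum>i\<le>n. Polynomial.monom (\<mu> i) i)"
    have coeff: "Polynomial.coeff r i = (if i \<le> n then \<mu> i else 0)" for i by (simp add: r_def coeff_sum)
    have "r \<in> polys_over ?K" using \<mu>(1) RK subring_zero[OF A.K] by (auto simp: polys_over_def coeff)
    moreover have "r \<noteq> 0" using \<mu>(2) coeff by (metis coeff_0)
    moreover have "poly r y = 0" using \<mu>(3) by (simp add: r_def poly_sum poly_monom)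
    ultimately show ?thesis by blast
  qed
  have "of_nat p \<in> ?K" by (rule subring_of_nat[OF A.K])
  moreover have "f (of_nat p) < 1" using good p by (simp add: good_absval_def)
  ultimately obtain f' where f': "nonarch_field ?K' f'" and ext: "\<And>x. x \<in> ?K \<Longrightarrow> f' x = f x"
    using A.algebraic_extension[OF _ p(2) _ fractions_subfield[OF gen_ring_subring] RK(3) alg] by metis
  interpret B: nonarch_field ?K' f' by fact
  have extR: "f' x = f x" if "x \<in> ?R" for x using ext RK that by blast
  have R1: "f x \<le> 1" if "x \<in> ?R" for x using good that by (simp add: good_absval_def)
  have qR: "Polynomial.coeff q i \<in> ?R" for i using q by (simp add: polys_over_def)
  have \<alpha>K: "\<alpha> j \<in> ?K'" using gen_ring_generator[of j "Suc j" \<alpha>] RK by auto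
  \<comment> \<open>If the value exceeded 1, the leading term, with its unit coefficient, would
    strictly dominate the rest of the equation.\<close>
  have \<alpha>1: "f' (\<alpha> j) \<le> 1"
  proof (rule ccontr)
    assume "\<not> f' (\<alpha> j) \<le> 1"
    then have gt: "f' (\<alpha> j) > 1" by simp
    define d where "d = degree q"
    have "0 = (\<Sum>i<d. Polynomial.coeff q i * \<alpha> j ^ i) + Polynomial.coeff q d * \<alpha> j ^ d"
      using q(3) by (simp add: poly_altdef d_def lessThan_Suc_atMost[symmetric])
    then have "Polynomial.coeff q d * \<alpha> j ^ d = - (\<Sum>i<d. Polynomial.coeff q i * \<alpha> j ^ i)"
      by (simp add: eq_neg_iff_add_eq_0 add.commute)
    moreover have tK: "Polynomial.coeff q i * \<alpha> j ^ i \<in> ?K'" for i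
      using qR RK \<alpha>K by (intro subring_mult[OF B.K] subring_power[OF B.K]) auto
    moreover have ft: "f' (Polynomial.coeff q i * \<alpha> j ^ i) = f (Polynomial.coeff q i) * f' (\<alpha> j) ^ i" for i
      using B.f_mult[of "Polynomial.coeff q i" "\<alpha> j ^ i"] qR[of i] RK \<alpha>K extR
      by (auto simp: B.f_power subring_power[OF B.K])
    moreover have "f' (\<Sum>i<d. Polynomial.coeff q i * \<alpha> j ^ i) < f' (\<alpha> j) ^ d"
    proof (rule B.f_sum_less)
      fix i assume "i \<in> {..<d}"
      then have "f' (\<alpha> j) ^ i < f' (\<alpha> j) ^ d" using gt by simp
      moreover have "f (Polynomial.coeff q i) * f' (\<alpha> j) ^ i \<le> 1 * f' (\<alpha> j) ^ i"
        using R1[OF qR] gt by (intro mult_right_mono) auto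
      ultimately show "Polynomial.coeff q i * \<alpha> j ^ i \<in> ?K' \<and> f' (Polynomial.coeff q i * \<alpha> j ^ i) < f' (\<alpha> j) ^ d"
        using tK ft by simp
    qed (use gt in simp)
    ultimately show False
      using lead B.f_uminus[OF subring_sum[OF B.K, of "{..<d}" "\<lambda>i. Polynomial.coeff q i * \<alpha> j ^ i"]]
        ft[of d] by (simp add: d_def)
  qed
  have R'1: "f' x \<le> 1" if x: "x \<in> ?R'" for x
  proof -
    obtain r where r: "r \<in> polys_over ?R" "x = poly r (\<alpha> j)" using x unfolding gen_ring_Suc by blast
    have "x \<in> {x \<in> ?K'. f' x \<le> 1}"
      unfolding r(2)
    proof (rule subring_poly[OF B.integers_subring])
      show "r \<in> polys_over {x \<in> ?K'. f' x \<le> 1}"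
        using r(1) RK R1 extR by (auto simp: polys_over_def)
    qed (use \<alpha>K \<alpha>1 in simp)
    then show ?thesis by simp
  qed
  \<comment> \<open>From \<open>1 + C * (1 + n * b) \<le> (1 + C + C * n) * (1 + b)\<close>, where
    \<open>C * (1 + n * b)\<close> bounds the height of the lowest coefficient.\<close>
  define A' where "A' = A * (1 + C + C * n)"
  have A: "A \<ge> 0" using good by (simp add: good_absval_def)
  have "exp (- A' * (1 + b)) \<le> f' x" if x: "height_le \<alpha> (Suc j) b x" "x \<noteq> 0" for b x
  proof -
    have b: "b \<ge> 0" using x by (simp add: height_le_nonneg)
    obtain \<mu> where \<mu>: "\<forall>i\<le>n. height_le \<alpha> j (C * (1 + real n * b)) (\<mu> i)" "\<exists>i\<le>n. \<mu> i \<noteq> 0" "(\<Sum>i\<le>n. \<mu> i * x ^ i) = 0"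
      using power_dependency[OF x(1)] by auto
    have xR: "x \<in> ?R'" using x(1) by (rule gen_ringI)
    have \<mu>R: "\<mu> i \<in> ?R" if "i \<le> n" for i using \<mu>(1) that gen_ringI by blast
    obtain k where k: "k \<le> n" "\<mu> k \<noteq> 0" "\<And>i. i < k \<Longrightarrow> \<mu> i = 0" using lowest_index[OF \<mu>(2)] by blast
    have "f' (\<mu> k) \<le> f' x"
    proof (rule B.lowest_coeff_le[OF _ _ _ k(1,3) \<mu>(3) x(2)])
      show "\<mu> i \<in> ?K' \<and> f' (\<mu> i) \<le> 1" if "i \<le> n" for i
        using \<mu>R[OF that] RK R1 extR by auto
    qed (use xR RK R'1 in auto)
    note k = k this
    have hk: "height_le \<alpha> j (C * (1 + real n * b)) (\<mu> k)" using \<mu>(1) k by blast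
    have "- A' * (1 + b) \<le> - A * (1 + C * (1 + real n * b))"
    proof -
      have "1 + C * (1 + real n * b) \<le> (1 + C + C * n) * (1 + b)" using b C by (simp add: algebra_simps)
      then have "A * (1 + C * (1 + real n * b)) \<le> A * ((1 + C + C * n) * (1 + b))" using A by (intro mult_left_mono)
      then show ?thesis by (simp add: A'_def mult.assoc)
    qed
    then have "exp (- A' * (1 + b)) \<le> exp (- A * (1 + C * (1 + real n * b)))" by simp
    also have "\<dots> \<le> f (\<mu> k)" using good hk k unfolding good_absval_def by blast
    also have "\<dots> = f' (\<mu> k)" using extR gen_ringI[OF hk] by simp
    finally show ?thesis using k by simp
  qed
  moreover have "finite_residue ?K' f'"
  proof (rule finite_residue_extension[OF A.nonarch_field_axioms f' RK(3) ext])
    show "finite_residue ?K f" using good by (simp add: good_absval_def)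
    show "\<exists>\<mu>. (\<forall>i\<le>n. \<mu> i \<in> ?K) \<and> (\<exists>i\<le>n. \<mu> i \<noteq> 0) \<and> (\<Sum>i\<le>n. \<mu> i * y ^ i) = 0" if "y \<in> ?K'" for y
      using fraction_dependency[OF that] RK by blast
  qed
  moreover have "f' (of_nat p) = 1 / real p"
    using ext[OF subring_of_nat[OF A.K]] good by (simp add: good_absval_def)
  moreover have "A' \<ge> 0" using A C by (simp add: A'_def)
  ultimately have "good_absval \<alpha> (Suc j) p f' A'" using f' R'1 by (simp add: good_absval_def)
  then show ?thesis using that extR by blast
qed

end

text \<open>Each relation to be avoided determines \<open>\<rho>\<close> as a root of a quotient of
  two values, so only countably many radii are bad, while the interval is uncountable.\<close>

lemma independent_radius:
  fixes R :: "'a set" and f :: "'a \<Rightarrow> real"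
  assumes "countable R"
  obtains \<rho> where "0 < \<rho>" "\<rho> < 1"
    "\<And>x y m. x \<in> R \<Longrightarrow> y \<in> R \<Longrightarrow> m > 0 \<Longrightarrow> f y \<noteq> 0 \<Longrightarrow> f x \<noteq> \<rho> ^ m * f y"
proof -
  define S where "S = (\<lambda>(m, x, y). root m (f x / f y)) ` (UNIV \<times> R \<times> R)"
  have "countable S" unfolding S_def using assms by (intro countable_image countable_SIGMA) auto
  then have "\<not> {0<..<1} \<subseteq> S" using uncountable_open_interval[of 0 "1::real"] countable_subset by auto
  then obtain \<rho> where "\<rho> \<in> {0<..<1}" "\<rho> \<notin> S" by blast
  then have \<rho>: "0 < \<rho>" "\<rho> < 1" "\<rho> \<notin> S" by auto
  moreover have "f x \<noteq> \<rho> ^ m * f y" if xy: "x \<in> R" "y \<in> R" "m > 0" "f y \<noteq> 0" for x y m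
  proof
    assume "f x = \<rho> ^ m * f y"
    then have "root m (f x / f y) = \<rho>" using xy \<rho>(1) by (simp add: real_root_power_cancel)
    then have "\<rho> \<in> S" unfolding S_def using xy by (auto intro!: image_eqI[of _ _ "(m, x, y)"])
    then show False using \<rho> by simp
  qed
  ultimately show ?thesis using that by blast
qed

text \<open>The radius \<open>\<rho>\<close> is independent of the value group, so distinct monomials in \<open>\<alpha> j - a\<close> have distinct
  values and the residue field does not grow.  The lower bound comes from the leading coefficient,
  which is unchanged by the shift by \<open>a\<close>.\<close>

lemma transcendental_step:
  fixes \<alpha> :: "nat \<Rightarrow> 'a::field_char_0"
  assumes trans: "\<And>q. q \<in> polys_over (gen_ring \<alpha> j) \<Longrightarrow> poly q (\<alpha> j) = 0 \<Longrightarrow> q = 0"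
    and good: "good_absval \<alpha> j p f A"
    and q: "q \<in> polys_over (gen_ring \<alpha> j)" "f (poly q (of_nat a)) = 1"
  shows "\<exists>f' A'. good_absval \<alpha> (Suc j) p f' A' \<and> f' (poly q (\<alpha> j)) = 1"
proof -
  let ?R = "gen_ring \<alpha> j" and ?R' = "gen_ring \<alpha> (Suc j)"
  let ?K = "fractions ?R" and ?K' = "fractions ?R'"
  interpret A: nonarch_field ?K f using good by (simp add: good_absval_def)
  note S = gen_ring_subring[of \<alpha> j]
  have RK: "?R \<subseteq> ?K" "?R' \<subseteq> ?K'" "?K \<subseteq> ?K'" "?R \<subseteq> ?R'"
    by (rule subset_fractions[OF gen_ring_subring] fractions_mono[OF gen_ring_mono_Suc] gen_ring_mono_Suc)+
  have R1: "f x \<le> 1" if "x \<in> ?R" for x using good that by (simp add: good_absval_def)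
  interpret R: nonarch ?R f by (rule nonarch_subring[OF A.nonarch_axioms S RK(1)])
  obtain \<rho> where \<rho>: "0 < \<rho>" "\<rho> < 1"
    and ind: "\<And>x y m. x \<in> ?R \<Longrightarrow> y \<in> ?R \<Longrightarrow> m > 0 \<Longrightarrow> f y \<noteq> 0 \<Longrightarrow> f x \<noteq> \<rho> ^ m * f y"
    using independent_radius[OF countable_gen_ring] by metis
  interpret M: monomial_norm ?R f \<rho>
    by unfold_locales (use \<rho> ind R.f_eq_0 in auto)
  \<comment> \<open>The shift makes \<open>q(a)\<close>, of value 1 by assumption, the constant
    coefficient of the expansion in powers of \<open>t\<close>; this will make
    \<open>q(\<alpha> j)\<close> a unit.\<close>
  define t where "t = \<alpha> j - of_nat a"
  have natR: "of_nat a \<in> ?R" by (rule subring_of_nat[OF S])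
  have shift: "[:c, 1:] \<in> polys_over ?R" if "c \<in> ?R" for c
    using that by (intro polys_over_pCons[OF S] polys_over_const[OF S] subring_one[OF S])
  have comp: "pcompose r [:of_nat a, 1:] \<in> polys_over ?R" "poly (pcompose r [:of_nat a, 1:]) t = poly r (\<alpha> j)"
    if "r \<in> polys_over ?R" for r
    using that by (auto intro: polys_over_pcompose[OF S] shift natR simp: poly_pcompose t_def)
  have comp': "pcompose r [:- of_nat a, 1:] \<in> polys_over ?R" "poly (pcompose r [:- of_nat a, 1:]) (\<alpha> j) = poly r t"
    if "r \<in> polys_over ?R" for r
    using that by (auto intro: polys_over_pcompose[OF S] shift subring_uminus[OF S] natR simp: poly_pcompose t_def)
  have tt: "r = 0" if r: "r \<in> polys_over ?R" "poly r t = 0" for r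
    using trans[of "pcompose r [:- of_nat a, 1:]"] comp'[OF r(1)] r(2) by (auto simp: pcompose_eq_0_iff)
  have R't: "(\<lambda>r. poly r t) ` polys_over ?R = ?R'"
    unfolding gen_ring_Suc
  proof (intro subset_antisym subsetI)
    fix x assume "x \<in> (\<lambda>r. poly r t) ` polys_over ?R"
    then show "x \<in> (\<lambda>r. poly r (\<alpha> j)) ` polys_over ?R" using comp' by force
  next
    fix x assume "x \<in> (\<lambda>r. poly r (\<alpha> j)) ` polys_over ?R"
    then show "x \<in> (\<lambda>r. poly r t) ` polys_over ?R" using comp by force
  qed
  obtain f1 where f1: "nonarch ?R' f1" "\<And>r. r \<in> polys_over ?R \<Longrightarrow> f1 (poly r t) = M.gauss r"
    using M.monomial_extension[of t] tt unfolding R't by metis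
  obtain f' where f': "nonarch ?K' f'" "\<And>x. x \<in> ?R' \<Longrightarrow> f' x = f1 x"
    using nonarch.fraction_extension[OF f1(1)] by metis
  interpret B: nonarch_field ?K' f'
    by (intro nonarch_fieldI f' fractions_subfield gen_ring_subring)
  have R'mem: "poly r t \<in> ?R'" if "r \<in> polys_over ?R" for r using R't that by blast
  then have f't: "f' (poly r t) = M.gauss r" if "r \<in> polys_over ?R" for r using f1(2) f'(2) that by simp
  have extR: "f' x = f x" if "x \<in> ?R" for x
    using f't[of "[:x:]"] polys_over_const[OF S that] by (simp add: gauss_norm_def)
  have ext: "f' x = f x" if x: "x \<in> ?K" for x
  proof -
    obtain c d where cd: "c \<in> ?R" "d \<in> ?R" "x = c / d" using x unfolding fractions_def by auto
    then have "c \<in> ?K" "d \<in> ?K" "c \<in> ?K'" "d \<in> ?K'" using RK by auto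
    then show ?thesis using cd extR A.f_divide[of c d] B.f_divide[of c d] by simp
  qed
  \<comment> \<open>Here \<open>\<rho> < 1\<close> enters: no term exceeds 1, so the new ring is
    integral.\<close>
  have gauss1: "M.gauss r \<le> 1" if r: "r \<in> polys_over ?R" for r
  proof -
    obtain i where "M.gauss r = M.term_norm r i" using M.gauss_attained by blast
    also have "\<dots> \<le> 1"
      using R1 r \<rho> R.f_nonneg by (intro mult_le_one power_le_one) (auto simp: polys_over_def)
    finally show ?thesis .
  qed
  have R'1: "f' x \<le> 1" if "x \<in> ?R'" for x using that gauss1 f't unfolding R't[symmetric] by auto
  have "finite_residue ?K f" using good by (simp add: good_absval_def)
  then obtain T where T: "finite T" "T \<subseteq> ?K" "\<And>x. x \<in> ?K \<Longrightarrow> f x \<le> 1 \<Longrightarrow> \<exists>t\<in>T. f (x - t) < 1"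
    unfolding finite_residue_def by auto
  \<comment> \<open>\<open>0\<close> serves the elements of value below 1. An element of value 1 is
    congruent to a quotient \<open>c / d\<close> of dominant coefficients, and this is represented
    in \<open>T\<close>.\<close>
  have "\<exists>u\<in>insert 0 T. f' (x - u) < 1" if x: "x \<in> ?K'" "f' x \<le> 1" for x
  proof (cases "f' x < 1")
    case False
    then have fx: "f' x = 1" using x by simp
    obtain y z where yz: "y \<in> ?R'" "z \<in> ?R'" "z \<noteq> 0" "x = y / z"
      using fractions_cases[OF gen_ring_subring x(1)] .
    then obtain r s where rs: "r \<in> polys_over ?R" "s \<in> polys_over ?R" "y = poly r t" "z = poly s t"
      unfolding R't[symmetric] by auto
    have s0: "s \<noteq> 0" using rs yz by auto
    have "f' x = M.gauss r / M.gauss s"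
      using yz rs RK B.f_divide[of y z] f't by auto
    then have "M.gauss r = M.gauss s" using fx M.gauss_pos[OF rs(2) s0] by (simp add: field_simps)
    then obtain c d where cd: "c \<in> ?R" "d \<in> ?R" "c \<noteq> 0" "d \<noteq> 0" "f c = f d"
      and less: "M.gauss (smult d r - smult c s) < f d * M.gauss s"
      using M.gauss_residue[OF rs(1,2) s0] by blast
    have pos: "f d > 0" using R.f_pos cd by simp
    have w: "smult d r - smult c s \<in> polys_over ?R"
      using rs cd by (intro polys_over_diff[OF S] polys_over_smult[OF S])
    have "x - c / d = poly (smult d r - smult c s) t / (d * z)"
      using yz rs cd by (simp add: field_simps)
    moreover have "d * z \<in> ?R'" using cd yz RK by (intro subring_mult[OF gen_ring_subring]) auto
    moreover have "f' (d * z) = f d * M.gauss s"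
      using B.f_mult[of d z] cd yz rs RK extR f't by auto
    ultimately have "f' (x - c / d) = M.gauss (smult d r - smult c s) / (f d * M.gauss s)"
      using B.f_divide[of "poly (smult d r - smult c s) t" "d * z"] R'mem[OF w] RK f't[OF w] by auto
    then have lt: "f' (x - c / d) < 1"
      using less pos M.gauss_pos[OF rs(2) s0] by simp
    have cdK: "c / d \<in> ?K" using cd by (intro fractionsI) auto
    have "f (c / d) = 1" using A.f_divide[of c d] cd RK pos by auto
    then obtain u where u: "u \<in> T" "f (c / d - u) < 1" using T(3) cdK by force
    then have "f' (c / d - u) < 1" using ext cdK T(2) subring_diff[OF A.K] by auto
    then have "f' (x - u) < 1"
      using B.f_diff_triangle[of x "c / d" u] lt x cdK u T(2) RK by force
    then show ?thesis using u by blast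
  qed simp
  then have fin: "finite_residue ?K' f'"
    unfolding finite_residue_def using T RK subring_zero[OF B.K] by (intro exI[of _ "insert 0 T"]) auto
  \<comment> \<open>The extra summand pays for \<open>\<rho> ^ degree r\<close>, as the degree is at
    most \<open>b\<close>.\<close>
  define A' where "A' = A + ln (1 / \<rho>)"
  have A: "A \<ge> 0" using good by (simp add: good_absval_def)
  have l0: "ln (1 / \<rho>) \<ge> 0" using \<rho> by simp
  have "exp (- A' * (1 + b)) \<le> f' x" if x: "height_le \<alpha> (Suc j) b x" "x \<noteq> 0" for b x
  proof -
    have b: "b \<ge> 0" using x by (simp add: height_le_nonneg)
    obtain r where r: "real (degree r) \<le> b" "\<And>i. height_le \<alpha> j b (Polynomial.coeff r i)" "poly r (\<alpha> j) = x"
      using height_le_univariate[OF x(1)] by blast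
    have rR: "r \<in> polys_over ?R" using gen_ringI[OF r(2)] by (simp add: polys_over_def)
    have r0: "r \<noteq> 0" using r x by auto
    define s where "s = pcompose r [:of_nat a, 1:]"
    have s: "s \<in> polys_over ?R" "poly s t = x" using comp[OF rR] r by (auto simp: s_def)
    have "degree s = degree r" unfolding s_def by (simp add: degree_pcompose)
    moreover have "lead_coeff s = lead_coeff r" unfolding s_def by (subst lead_coeff_comp) simp_all
    ultimately have tn: "M.term_norm s (degree r) = f (lead_coeff r) * \<rho> ^ degree r" by simp
    have "exp (- A' * (1 + b)) = exp (- A * (1 + b)) * exp (- ln (1 / \<rho>) * (1 + b))"
      by (simp add: A'_def algebra_simps flip: exp_add)
    also have "\<dots> \<le> f (lead_coeff r) * \<rho> ^ degree r"
    proof (intro mult_mono)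
      show "exp (- A * (1 + b)) \<le> f (lead_coeff r)" using good r(2) r0 unfolding good_absval_def by simp
      have "- ln (1 / \<rho>) * (1 + b) \<le> - ln (1 / \<rho>) * real (degree r)"
        using r(1) l0 by (intro mult_left_mono_neg) auto
      then have "exp (- ln (1 / \<rho>) * (1 + b)) \<le> exp (real (degree r) * ln \<rho>)"
        using \<rho> by (simp add: ln_div mult.commute)
      then show "exp (- ln (1 / \<rho>) * (1 + b)) \<le> \<rho> ^ degree r" using \<rho> by (simp add: exp_of_nat_mult)
    qed (use R.f_nonneg rR in \<open>auto simp: polys_over_def\<close>)
    also have "\<dots> \<le> f' x" using M.gauss_ge[OF s(1), of "degree r"] f't[OF s(1)] s(2) tn by simp
    finally show ?thesis .
  qed
  moreover have "f' (of_nat p) = 1 / real p"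
    using ext[OF subring_of_nat[OF A.K]] good by (simp add: good_absval_def)
  moreover have "A' \<ge> 0" using A l0 by (simp add: A'_def)
  ultimately have "good_absval \<alpha> (Suc j) p f' A'"
    using B.nonarch_field_axioms R'1 fin by (simp add: good_absval_def)
  moreover have "f' (poly q (\<alpha> j)) = 1"
  proof (rule antisym)
    define s where "s = pcompose q [:of_nat a, 1:]"
    have s: "s \<in> polys_over ?R" "poly s t = poly q (\<alpha> j)" using comp[OF q(1)] by (auto simp: s_def)
    then show "f' (poly q (\<alpha> j)) \<le> 1" using f't[OF s(1)] gauss1[OF s(1)] by simp
    have "Polynomial.coeff s 0 = poly q (of_nat a)" by (simp add: s_def poly_pcompose flip: poly_0_coeff_0)
    then show "1 \<le> f' (poly q (\<alpha> j))" using M.gauss_ge[OF s(1), of 0] f't[OF s(1)] s(2) q(2) by simp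
  qed
  ultimately show ?thesis by blast
qed

text \<open>Generality in \<open>g\<close> drives the induction: asking that \<open>g\<close> be a
  unit becomes a condition on one nonzero element of the previous ring. Two conditions are combined
  in a product, since factors of value at most 1 with product of value 1 have value 1 themselves.
  For an integer the condition is that \<open>p\<close> does not divide it.\<close>

theorem good_absval_exists:
  fixes \<alpha> :: "nat \<Rightarrow> 'a::field_char_0"
  assumes "g \<in> gen_ring \<alpha> j" "g \<noteq> 0"
  shows "\<exists>N>0. \<forall>p. Factorial_Ring.prime p \<longrightarrow> \<not> p dvd N \<longrightarrow> (\<exists>f A. good_absval \<alpha> j p f A \<and> f g = 1)"
  using assms
proof (induction j arbitrary: g)
  case 0
  then obtain m where m: "g = of_int m"
    using bounded_poly_zero_vars unfolding gen_ring_def height_le_def by blast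
  have "\<exists>f A. good_absval \<alpha> 0 p f A \<and> f g = 1" if "Factorial_Ring.prime p" "\<not> p dvd nat \<bar>m\<bar>" for p
    using good_absval_base[OF that(1), of m] that(2) m by (simp add: int_dvd_int_iff[symmetric])
  moreover have "nat \<bar>m\<bar> > 0" using m 0 by auto
  ultimately show ?case by blast
next
  case (Suc j)
  let ?R = "gen_ring \<alpha> j"
  show ?case
  proof (cases "\<exists>q\<in>polys_over ?R. q \<noteq> 0 \<and> poly q (\<alpha> j) = 0")
    case True
    then obtain q where q: "q \<in> polys_over ?R" "q \<noteq> 0" "poly q (\<alpha> j) = 0" by blast
    obtain n :: nat and C where "algebraic_step \<alpha> j q n C"
    proof (rule algebraic_dependency[OF q])
      fix n :: nat and C :: real
      assume C: "C \<ge> 0" and dep: "\<And>b z. b \<ge> 0 \<Longrightarrow> (\<And>i. i \<le> n \<Longrightarrow> height_le \<alpha> (Suc j) b (z i)) \<Longrightarrow>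
        \<exists>\<mu>. (\<forall>i\<le>n. height_le \<alpha> j (C * (1 + b)) (\<mu> i)) \<and> (\<exists>i\<le>n. \<mu> i \<noteq> 0) \<and> (\<Sum>i\<le>n. \<mu> i * z i) = 0"
      have "algebraic_step \<alpha> j q n C" by (rule algebraic_step.intro[OF q C]) (rule dep)
      then show ?thesis by (rule that)
    qed
    then interpret algebraic_step \<alpha> j q n C .
    obtain b where b: "height_le \<alpha> (Suc j) b g" using Suc.prems unfolding gen_ring_def by blast
    obtain \<mu> where \<mu>: "\<forall>i\<le>n. height_le \<alpha> j (C * (1 + real n * b)) (\<mu> i)" "\<exists>i\<le>n. \<mu> i \<noteq> 0" "(\<Sum>i\<le>n. \<mu> i * g ^ i) = 0"
      using power_dependency[OF b] by auto
    have \<mu>R: "\<mu> i \<in> ?R" if "i \<le> n" for i using \<mu>(1) that gen_ringI by blast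
    obtain k where k: "k \<le> n" "\<mu> k \<noteq> 0" "\<And>i. i < k \<Longrightarrow> \<mu> i = 0" using lowest_index[OF \<mu>(2)] by blast
    define c where "c = Polynomial.coeff q (degree q)"
    have c: "c \<in> ?R" "c \<noteq> 0" using q by (auto simp: c_def polys_over_def)
    \<comment> \<open>\<open>c\<close> has to be a unit so that \<open>\<alpha> j\<close> becomes
      integral, and \<open>\<mu> k\<close> so that \<open>g\<close>, which divides it, becomes a
      unit.\<close>
    have "c * \<mu> k \<in> ?R" by (intro subring_mult[OF gen_ring_subring] c \<mu>R k)
    moreover have "c * \<mu> k \<noteq> 0" using c k by simp
    ultimately obtain N where N: "N > 0" "\<And>p. Factorial_Ring.prime p \<Longrightarrow> \<not> p dvd N \<Longrightarrow>
        \<exists>f A. good_absval \<alpha> j p f A \<and> f (c * \<mu> k) = 1" using Suc.IH by metis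
    have "\<exists>f A. good_absval \<alpha> (Suc j) p f A \<and> f g = 1" if p: "Factorial_Ring.prime p" "\<not> p dvd N" for p
    proof -
      obtain f A where good: "good_absval \<alpha> j p f A" and f1: "f (c * \<mu> k) = 1" using N(2)[OF p] by blast
      interpret A: nonarch_field "fractions ?R" f using good by (simp add: good_absval_def)
      have sub: "?R \<subseteq> fractions ?R" by (rule subset_fractions[OF gen_ring_subring])
      have le: "f c \<le> 1" "f (\<mu> k) \<le> 1" using good c \<mu>R k by (auto simp: good_absval_def)
      have prod: "f c * f (\<mu> k) = 1" using A.f_mult[of c "\<mu> k"] c \<mu>R k sub f1 by auto
      have nn: "f c \<ge> 0" "f (\<mu> k) \<ge> 0" using A.f_nonneg c \<mu>R k sub by auto
      have "1 \<le> f c" using mult_left_mono[OF le(2) nn(1)] prod by simp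
      then have fc: "f c = 1" using le by simp
      then have fk: "f (\<mu> k) = 1" using prod by simp
      have p1: "p > 1" "of_nat p \<noteq> (0::'a)" using prime_gt_1_nat[OF p(1)] by auto
      obtain f' A' where good': "good_absval \<alpha> (Suc j) p f' A'" and ext: "\<And>x. x \<in> ?R \<Longrightarrow> f' x = f x"
        using extends[OF good p1] fc unfolding c_def by metis
      interpret B: nonarch_field "fractions (gen_ring \<alpha> (Suc j))" f' using good' by (simp add: good_absval_def)
      have sub': "gen_ring \<alpha> (Suc j) \<subseteq> fractions (gen_ring \<alpha> (Suc j))" by (rule subset_fractions[OF gen_ring_subring])
      have le': "f' x \<le> 1" if "x \<in> gen_ring \<alpha> (Suc j)" for x using good' that by (simp add: good_absval_def)
      have "f' (\<mu> k) \<le> f' g"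
      proof (rule B.lowest_coeff_le[OF _ _ _ k(1,3) \<mu>(3) Suc.prems(2)])
        show "\<mu> i \<in> fractions (gen_ring \<alpha> (Suc j)) \<and> f' (\<mu> i) \<le> 1" if "i \<le> n" for i
          using \<mu>R[OF that] gen_ring_mono_Suc[of \<alpha> j] sub' le' by blast
      qed (use Suc.prems sub' le' in auto)
      then have "f' g = 1" using ext \<mu>R[OF k(1)] fk le' Suc.prems by force
      then show ?thesis using good' by blast
    qed
    then show ?thesis using N(1) by blast
  next
    case False
    then have trans: "\<And>q. q \<in> polys_over ?R \<Longrightarrow> poly q (\<alpha> j) = 0 \<Longrightarrow> q = 0" by blast
    obtain q where q: "q \<in> polys_over ?R" "g = poly q (\<alpha> j)" using Suc.prems unfolding gen_ring_Suc by blast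
    then have "q \<noteq> 0" using Suc.prems by auto
    \<comment> \<open>Finitely many roots leave some natural number \<open>a\<close> that is not
      one; it is the centre of the Gauss norm.\<close>
    then have "finite {x. poly q x = 0}" by (rule poly_roots_finite)
    moreover have "infinite (range (of_nat :: nat \<Rightarrow> 'a))" by (intro range_inj_infinite) (rule inj_of_nat)
    ultimately have "\<not> range of_nat \<subseteq> {x. poly q x = 0}" using finite_subset by blast
    then obtain a :: nat where a: "poly q (of_nat a) \<noteq> 0" by auto
    have "poly q (of_nat a) \<in> ?R"
      using q by (intro subring_poly[OF gen_ring_subring] subring_of_nat[OF gen_ring_subring])
    then obtain N where N: "N > 0" "\<And>p. Factorial_Ring.prime p \<Longrightarrow> \<not> p dvd N \<Longrightarrow>
        \<exists>f A. good_absval \<alpha> j p f A \<and> f (poly q (of_nat a)) = 1" using Suc.IH a by metis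
    have "\<exists>f A. good_absval \<alpha> (Suc j) p f A \<and> f g = 1" if p: "Factorial_Ring.prime p" "\<not> p dvd N" for p
    proof -
      obtain f A where "good_absval \<alpha> j p f A" "f (poly q (of_nat a)) = 1" using N(2)[OF p] by blast
      from transcendental_step[OF trans this(1) q(1) this(2)] show ?thesis unfolding q(2) by simp
    qed
    then show ?thesis using N(1) by blast
  qed
qed

section \<open>Completion\<close>

locale completion = nonarch_field UNIV f for f :: "'a::field \<Rightarrow> real" +
  fixes p :: nat
  assumes p: "p > 1" and f_p: "f (of_nat p) = 1 / real p"
begin

lemmas norm_mult = f_mult[OF UNIV_I UNIV_I]
  and norm_nonneg = f_nonneg[OF UNIV_I]
  and norm_eq_0 = f_eq_0[OF UNIV_I]
  and norm_add = f_add[OF UNIV_I UNIV_I]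
  and norm_diff = f_diff[OF UNIV_I UNIV_I]
  and norm_diff_commute = f_diff_commute[OF UNIV_I UNIV_I]
  and norm_uminus = f_uminus[OF UNIV_I]
  and norm_inverse = f_inverse[OF UNIV_I]

lemma norm_abs_diff: "\<bar>f x - f y\<bar> \<le> f (x - y)"
proof -
  have "f x \<le> f y + f (x - y)" for x y
    using norm_add[of y "x - y"] norm_nonneg[of y] norm_nonneg[of "x - y"] by simp
  from this[of x y] this[of y x] show ?thesis using norm_diff_commute[of x y] by linarith
qed

section \<open>Cauchy sequences and null sequences\<close>

definition cauchy :: "(nat \<Rightarrow> 'a) \<Rightarrow> bool" where
  "cauchy u \<longleftrightarrow> (\<forall>e>0. \<exists>N. \<forall>m\<ge>N. \<forall>n\<ge>N. f (u m - u n) < e)"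

definition null :: "(nat \<Rightarrow> 'a) \<Rightarrow> bool" where
  "null u \<longleftrightarrow> (\<lambda>n. f (u n)) \<longlonglongrightarrow> 0"

definition seq_ring :: "(nat \<Rightarrow> 'a) ring" where
  "seq_ring = \<lparr>carrier = {u. cauchy u}, monoid.mult = (\<lambda>u w n. u n * w n), one = (\<lambda>_. 1),
     ring.zero = (\<lambda>_. 0), add = (\<lambda>u w n. u n + w n)\<rparr>"

lemma seq_ring_simps [simp]:
  "carrier seq_ring = {u. cauchy u}" "u \<otimes>\<^bsub>seq_ring\<^esub> w = (\<lambda>n. u n * w n)" "\<one>\<^bsub>seq_ring\<^esub> = (\<lambda>_. 1)"
  "\<zero>\<^bsub>seq_ring\<^esub> = (\<lambda>_. 0)" "u \<oplus>\<^bsub>seq_ring\<^esub> w = (\<lambda>n. u n + w n)"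
  by (simp_all add: seq_ring_def)

lemma cauchyD: "cauchy u \<Longrightarrow> e > 0 \<Longrightarrow> \<exists>N. \<forall>m\<ge>N. \<forall>n\<ge>N. f (u m - u n) < e"
  by (simp add: cauchy_def)

lemma cauchy_const: "cauchy (\<lambda>_. c)"
  by (simp add: cauchy_def f0)

lemma cauchy_add: assumes u: "cauchy u" and w: "cauchy w" shows "cauchy (\<lambda>n. u n + w n)"
  unfolding cauchy_def
proof (intro allI impI)
  fix e :: real assume "e > 0"
  then obtain N M where *: "\<forall>m\<ge>N. \<forall>n\<ge>N. f (u m - u n) < e" "\<forall>m\<ge>M. \<forall>n\<ge>M. f (w m - w n) < e"
    using cauchyD u w by meson
  have "f (u m + w m - (u n + w n)) < e" if "m \<ge> max N M" "n \<ge> max N M" for m n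
    using norm_add[of "u m - u n" "w m - w n"] *(1)[rule_format, of m n] *(2)[rule_format, of m n] that
    by (simp add: algebra_simps)
  then show "\<exists>N. \<forall>m\<ge>N. \<forall>n\<ge>N. f (u m + w m - (u n + w n)) < e" by blast
qed

lemma cauchy_uminus: "cauchy u \<Longrightarrow> cauchy (\<lambda>n. - u n)"
  unfolding cauchy_def using norm_diff_commute by (simp add: minus_diff_commute)

lemma cauchy_norm_convergent: assumes "cauchy u" shows "convergent (\<lambda>n. f (u n))"
proof -
  have "Cauchy (\<lambda>n. f (u n))"
    unfolding Cauchy_def dist_real_def
    using assms norm_abs_diff unfolding cauchy_def by (meson le_less_trans)
  then show ?thesis by (simp add: Cauchy_convergent_iff)
qed

lemma cauchy_bounded: assumes "cauchy u" shows "\<exists>B>0. \<forall>n. f (u n) \<le> B"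
proof -
  obtain B where "B > 0" "\<forall>n. norm (f (u n)) \<le> B"
    using convergent_imp_Bseq[OF cauchy_norm_convergent[OF assms]] unfolding Bseq_def by blast
  then show ?thesis by (intro exI[of _ B]) (auto simp: abs_le_iff)
qed

lemma cauchy_mult: assumes u: "cauchy u" and w: "cauchy w" shows "cauchy (\<lambda>n. u n * w n)"
  unfolding cauchy_def
proof (intro allI impI)
  obtain B C where B: "B > 0" "\<forall>n. f (u n) \<le> B" and C: "C > 0" "\<forall>n. f (w n) \<le> C"
    using cauchy_bounded u w by meson
  fix e :: real assume e: "e > 0"
  then have "e / B > 0" "e / C > 0" using B C by auto
  then obtain N M where *: "\<forall>m\<ge>N. \<forall>n\<ge>N. f (u m - u n) < e / C" "\<forall>m\<ge>M. \<forall>n\<ge>M. f (w m - w n) < e / B"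
    using cauchyD u w by meson
  have "f (u m * w m - u n * w n) < e" if mn: "m \<ge> max N M" "n \<ge> max N M" for m n
  proof -
    have "f (u m - u n) * f (w m) \<le> f (u m - u n) * C" "f (u n) * f (w m - w n) \<le> B * f (w m - w n)"
      using B C norm_nonneg by (auto intro: mult_left_mono mult_right_mono)
    moreover have "f (u m - u n) * C < e" "B * f (w m - w n) < e"
      using *(1)[rule_format, of m n] *(2)[rule_format, of m n] mn B C
      by (simp_all add: pos_less_divide_eq mult.commute)
    moreover have "u m * w m - u n * w n = (u m - u n) * w m + u n * (w m - w n)" by (simp add: algebra_simps)
    ultimately show ?thesis
      using norm_add[of "(u m - u n) * w m" "u n * (w m - w n)"] by (simp add: norm_mult)
  qed
  then show "\<exists>N. \<forall>m\<ge>N. \<forall>n\<ge>N. f (u m * w m - u n * w n) < e" by blast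
qed

lemma cauchy_diff: "cauchy u \<Longrightarrow> cauchy w \<Longrightarrow> cauchy (\<lambda>n. u n - w n)"
  using cauchy_add[of u "\<lambda>n. - w n"] cauchy_uminus[of w] by simp

lemma null_cauchy: assumes "null u" shows "cauchy u"
  unfolding cauchy_def
proof (intro allI impI)
  fix e :: real assume "e > 0"
  then obtain N where N: "\<forall>n\<ge>N. f (u n) < e"
    using assms norm_nonneg unfolding null_def lim_sequentially dist_real_def by fastforce
  have "f (u m - u n) < e" if "m \<ge> N" "n \<ge> N" for m n
    using norm_diff[of "u m" "u n"] N that by (meson le_less_trans max_less_iff_conj)
  then show "\<exists>N. \<forall>m\<ge>N. \<forall>n\<ge>N. f (u m - u n) < e" by blast
qed

lemma null_add: assumes "null u" "null w" shows "null (\<lambda>n. u n + w n)"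
  unfolding null_def
proof (rule tendsto_sandwich[OF _ _ tendsto_const])
  show "(\<lambda>n. f (u n) + f (w n)) \<longlonglongrightarrow> 0" using tendsto_add[OF assms[unfolded null_def]] by simp
  show "\<forall>\<^sub>F n in sequentially. f (u n + w n) \<le> f (u n) + f (w n)"
    by (intro always_eventually allI) (smt (verit) norm_add norm_nonneg max_def)
qed (simp add: norm_nonneg)

lemma null_mult: assumes u: "cauchy u" and w: "null w" shows "null (\<lambda>n. u n * w n)"
proof -
  obtain L where "(\<lambda>n. f (u n)) \<longlonglongrightarrow> L" using cauchy_norm_convergent[OF u] unfolding convergent_def by blast
  from tendsto_mult[OF this w[unfolded null_def]] show ?thesis by (simp add: null_def norm_mult)
qed

lemma null_uminus: "null u \<Longrightarrow> null (\<lambda>n. - u n)"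
  by (simp add: null_def norm_uminus)

lemma seq_ring_cring: "cring seq_ring"
proof (rule cringI)
  show "abelian_group seq_ring"
  proof (rule abelian_groupI)
    fix u assume "u \<in> carrier seq_ring"
    then show "\<exists>w\<in>carrier seq_ring. w \<oplus>\<^bsub>seq_ring\<^esub> u = \<zero>\<^bsub>seq_ring\<^esub>"
      by (intro bexI[of _ "\<lambda>n. - u n"]) (auto simp: cauchy_uminus)
  qed (auto simp: cauchy_add cauchy_const add_ac)
  show "comm_monoid seq_ring"
    by (rule comm_monoidI) (auto simp: cauchy_mult cauchy_const mult_ac)
qed (auto simp: distrib_right)

sublocale S: cring seq_ring
  by (rule seq_ring_cring)

lemma seq_ring_uminus: assumes "cauchy u" shows "\<ominus>\<^bsub>seq_ring\<^esub> u = (\<lambda>n. - u n)"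
  using assms cauchy_uminus[OF assms] by (intro S.minus_equality) auto

abbreviation null_seqs :: "(nat \<Rightarrow> 'a) set" where "null_seqs \<equiv> {u. null u}"

lemma null_ideal: "ideal null_seqs seq_ring"
proof (rule idealI)
  show "ring seq_ring" by (rule S.ring_axioms)
  show "subgroup null_seqs (add_monoid seq_ring)"
  proof (rule S.add.subgroupI)
    fix u assume u: "u \<in> null_seqs"
    then show "\<ominus>\<^bsub>seq_ring\<^esub> u \<in> null_seqs"
      using u by (simp add: seq_ring_uminus null_cauchy null_uminus)
  next
    have "(\<lambda>_. 0) \<in> null_seqs" by (simp add: null_def f0)
    then show "null_seqs \<noteq> {}" by blast
  qed (auto simp: null_cauchy null_add)
next
  fix u w assume "u \<in> null_seqs" "w \<in> carrier seq_ring"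
  then show "w \<otimes>\<^bsub>seq_ring\<^esub> u \<in> null_seqs" "u \<otimes>\<^bsub>seq_ring\<^esub> w \<in> null_seqs"
    using null_mult[of w u] by (auto simp: mult.commute)
qed

sublocale I: ideal null_seqs seq_ring
  by (rule null_ideal)

section \<open>The quotient by null sequences and its norm\<close>

definition completed :: "(nat \<Rightarrow> 'a) set ring" where
  "completed = seq_ring Quot null_seqs"

definition cls :: "(nat \<Rightarrow> 'a) \<Rightarrow> (nat \<Rightarrow> 'a) set" where
  "cls u = null_seqs +>\<^bsub>seq_ring\<^esub> u"

lemma cls_hom: "ring_hom_cring seq_ring completed cls"
  using I.rcos_ring_hom_cring[OF seq_ring_cring] by (simp add: completed_def cls_def[abs_def])

sublocale H: ring_hom_cring seq_ring completed cls
  by (rule cls_hom)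

lemma carrier_completed: "carrier completed = cls ` {u. cauchy u}"
  by (auto simp: completed_def FactRing_def A_RCOSETS_def' cls_def)

lemma cls_in: "cauchy u \<Longrightarrow> cls u \<in> carrier completed"
  by (auto simp: carrier_completed)

lemma cls_mem: "z \<in> cls u \<longleftrightarrow> null (\<lambda>n. z n - u n)"
proof -
  have "z \<in> cls u \<longleftrightarrow> (\<exists>N. null N \<and> z = (\<lambda>n. N n + u n))"
    by (auto simp: cls_def a_r_coset_def')
  also have "\<dots> \<longleftrightarrow> null (\<lambda>n. z n - u n)"
    by (auto intro!: exI[of _ "\<lambda>n. z n - u n"])
  finally show ?thesis .
qed

lemma cls_mult: "cauchy u \<Longrightarrow> cauchy w \<Longrightarrow> cls u \<otimes>\<^bsub>completed\<^esub> cls w = cls (\<lambda>n. u n * w n)"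
  and cls_add: "cauchy u \<Longrightarrow> cauchy w \<Longrightarrow> cls u \<oplus>\<^bsub>completed\<^esub> cls w = cls (\<lambda>n. u n + w n)"
  and cls_one: "\<one>\<^bsub>completed\<^esub> = cls (\<lambda>_. 1)"
  and cls_zero: "\<zero>\<^bsub>completed\<^esub> = cls (\<lambda>_. 0)"
  using H.hom_mult[of u w] H.hom_add[of u w] H.hom_one H.hom_zero by auto

lemma cls_diff:
  assumes "cauchy u" "cauchy w" shows "cls u \<ominus>\<^bsub>completed\<^esub> cls w = cls (\<lambda>n. u n - w n)"
proof -
  have "\<ominus>\<^bsub>completed\<^esub> cls w = cls (\<ominus>\<^bsub>seq_ring\<^esub> w)" using assms H.hom_a_inv[of w] by simp
  then show ?thesis using assms by (simp add: a_minus_def cls_add seq_ring_uminus cauchy_uminus)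
qed

lemma cls_eq: assumes uw: "cauchy u" "cauchy w" "null (\<lambda>n. u n - w n)" shows "cls u = cls w"
proof -
  have *: "z \<in> cls w" if z: "z \<in> cls u" and n: "null (\<lambda>n. u n - w n)" for z u w
    using null_add[OF z[unfolded cls_mem] n] by (simp add: cls_mem)
  show ?thesis
    using *[of _ u w] *[of _ w u] uw(3) null_uminus[OF uw(3)] by auto
qed

text \<open>Uses an arbitrary representative; \<open>cnorm_tendsto\<close> shows that any Cauchy
  representative has the same limit.\<close>

definition cnorm :: "(nat \<Rightarrow> 'a) set \<Rightarrow> real" where
  "cnorm C = lim (\<lambda>n. f ((SOME u. u \<in> C) n))"

lemma cnorm_tendsto: assumes "cauchy u" shows "(\<lambda>n. f (u n)) \<longlonglongrightarrow> cnorm (cls u)"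
proof -
  define z where "z = (SOME z. z \<in> cls u)"
  have "u \<in> cls u" by (simp add: cls_mem null_def f0)
  then have "z \<in> cls u" unfolding z_def by (rule someI[of "\<lambda>z. z \<in> cls u"])
  then have "(\<lambda>n. f (z n - u n)) \<longlonglongrightarrow> 0" by (simp add: cls_mem null_def)
  then have "(\<lambda>n. f (z n) - f (u n)) \<longlonglongrightarrow> 0"
    by (rule Lim_null_comparison[rotated]) (use norm_abs_diff in simp)
  moreover obtain L where L: "(\<lambda>n. f (u n)) \<longlonglongrightarrow> L"
    using cauchy_norm_convergent[OF assms] unfolding convergent_def by blast
  ultimately have "(\<lambda>n. f (z n)) \<longlonglongrightarrow> L" using tendsto_add by fastforce
  then have "cnorm (cls u) = L" unfolding cnorm_def z_def by (rule limI)
  then show ?thesis using L by simp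
qed

lemma cnorm_eqI: "cauchy u \<Longrightarrow> (\<lambda>n. f (u n)) \<longlonglongrightarrow> L \<Longrightarrow> cnorm (cls u) = L"
  using LIMSEQ_unique[OF cnorm_tendsto] .

lemma cnorm_nonneg: assumes "C \<in> carrier completed" shows "cnorm C \<ge> 0"
proof -
  obtain u where "cauchy u" "C = cls u" using assms by (auto simp: carrier_completed)
  then show ?thesis using LIMSEQ_le_const[OF cnorm_tendsto] norm_nonneg by blast
qed

lemma cnorm_mult:
  assumes "C \<in> carrier completed" "D \<in> carrier completed"
  shows "cnorm (C \<otimes>\<^bsub>completed\<^esub> D) = cnorm C * cnorm D"
proof -
  obtain u w where uw: "cauchy u" "C = cls u" "cauchy w" "D = cls w" using assms by (auto simp: carrier_completed)
  then show ?thesis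
    using tendsto_mult[OF cnorm_tendsto cnorm_tendsto, of u w]
    by (auto simp: cls_mult norm_mult cauchy_mult intro!: cnorm_eqI)
qed

lemma cnorm_add:
  assumes "C \<in> carrier completed" "D \<in> carrier completed"
  shows "cnorm (C \<oplus>\<^bsub>completed\<^esub> D) \<le> max (cnorm C) (cnorm D)"
proof -
  obtain u w where uw: "cauchy u" "C = cls u" "cauchy w" "D = cls w" using assms by (auto simp: carrier_completed)
  have "(\<lambda>n. f (u n + w n)) \<longlonglongrightarrow> cnorm (C \<oplus>\<^bsub>completed\<^esub> D)"
    using uw cnorm_tendsto[OF cauchy_add[of u w]] by (simp add: cls_add)
  moreover have "(\<lambda>n. max (f (u n)) (f (w n))) \<longlonglongrightarrow> max (cnorm C) (cnorm D)"
    using uw cnorm_tendsto by (intro tendsto_max) auto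
  ultimately show ?thesis by (rule LIMSEQ_le) (use norm_add in blast)
qed

lemma cnorm_eq_0:
  assumes "C \<in> carrier completed" shows "cnorm C = 0 \<longleftrightarrow> C = \<zero>\<^bsub>completed\<^esub>"
proof
  obtain u where u: "cauchy u" "C = cls u" using assms by (auto simp: carrier_completed)
  assume "cnorm C = 0"
  then have "null u" using u cnorm_tendsto[of u] by (simp add: null_def)
  then show "C = \<zero>\<^bsub>completed\<^esub>" unfolding u(2) cls_zero using u(1) by (intro cls_eq cauchy_const) auto
next
  assume "C = \<zero>\<^bsub>completed\<^esub>"
  then show "cnorm C = 0" unfolding cls_zero by (auto intro!: cnorm_eqI cauchy_const simp: f0)
qed

definition emb :: "'a \<Rightarrow> (nat \<Rightarrow> 'a) set" where "emb x = cls (\<lambda>_. x)"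

lemma emb_in: "emb x \<in> carrier completed"
  by (simp add: emb_def cls_in cauchy_const)

lemma emb_mult: "emb (x * y) = emb x \<otimes>\<^bsub>completed\<^esub> emb y"
  and emb_add: "emb (x + y) = emb x \<oplus>\<^bsub>completed\<^esub> emb y"
  and emb_diff: "emb (x - y) = emb x \<ominus>\<^bsub>completed\<^esub> emb y"
  and emb_one: "emb 1 = \<one>\<^bsub>completed\<^esub>"
  and emb_zero: "emb 0 = \<zero>\<^bsub>completed\<^esub>"
  by (simp_all add: emb_def cls_mult cls_add cls_diff cls_one cls_zero cauchy_const)

lemma cnorm_emb: "cnorm (emb x) = f x"
  unfolding emb_def by (rule cnorm_eqI) (auto simp: cauchy_const)

lemma emb_inj: "inj emb"
proof (rule injI)
  fix x y assume "emb x = emb y"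
  then have "emb (x - y) = emb (y - y)" by (simp only: emb_diff)
  then have "f (x - y) = 0" using cnorm_emb[of "x - y"] cnorm_emb[of 0] f0 by simp
  then show "x = y" by (simp add: norm_eq_0)
qed

lemma emb_hom: "emb \<in> ring_hom ring_of_type_algebra completed"
  by (rule ring_hom_memI) (auto simp: ring_of_type_algebra_def emb_in emb_mult emb_add emb_one)

text \<open>The values \<open>f (u n)\<close> converge to a positive limit \<open>L\<close>, so they
  eventually exceed \<open>L / 2\<close>; the finitely many earlier terms, where
  \<open>inverse 0 = 0\<close> may occur, do not matter.\<close>

lemma cauchy_inverse:
  assumes u: "cauchy u" and n0: "cnorm (cls u) \<noteq> 0"
  shows "cauchy (\<lambda>n. inverse (u n))" "\<forall>\<^sub>F n in sequentially. u n \<noteq> 0"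
proof -
  define L where "L = cnorm (cls u)"
  have L: "L > 0" using cnorm_nonneg[OF cls_in[OF u]] n0 by (simp add: L_def)
  have "\<forall>\<^sub>F n in sequentially. f (u n) > L / 2"
    using cnorm_tendsto[OF u] L by (intro order_tendstoD(1)[of _ "cnorm (cls u)"]) (auto simp: L_def)
  then obtain M where M: "\<And>n. n \<ge> M \<Longrightarrow> f (u n) > L / 2" by (auto simp: eventually_sequentially)
  then have nz: "u n \<noteq> 0" if "n \<ge> M" for n using that L f0 by fastforce
  then show "\<forall>\<^sub>F n in sequentially. u n \<noteq> 0" by (auto simp: eventually_sequentially)
  show "cauchy (\<lambda>n. inverse (u n))"
    unfolding cauchy_def
  proof (intro allI impI)
    fix e :: real assume "e > 0"
    \<comment> \<open>Suited to \<open>1 / u m - 1 / u n = (u n - u m) / (u m * u n)\<close>, whose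
      denominator has value above \<open>(L / 2) * (L / 2)\<close>.\<close>
    then have "e * ((L / 2) * (L / 2)) > 0" using L by simp
    then obtain N where N: "\<forall>m\<ge>N. \<forall>n\<ge>N. f (u m - u n) < e * ((L / 2) * (L / 2))" using cauchyD[OF u] by blast
    have "f (inverse (u m) - inverse (u n)) < e" if mn: "m \<ge> max N M" "n \<ge> max N M" for m n
    proof -
      have nz': "u m \<noteq> 0" "u n \<noteq> 0" using nz mn by auto
      have eq: "inverse (u m) - inverse (u n) = (u n - u m) * inverse (u m * u n)"
        using nz' by (simp add: field_simps)
      have "f (inverse (u m) - inverse (u n)) = f (u n - u m) / (f (u m) * f (u n))"
        unfolding eq by (simp add: norm_mult norm_inverse divide_inverse)
      also have "\<dots> < e"
      proof -
        have "L / 2 * (L / 2) < f (u m) * f (u n)" using M[of m] M[of n] mn L by (intro mult_strict_mono) auto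
        then have "e * (L / 2 * (L / 2)) < e * (f (u m) * f (u n))" using \<open>e > 0\<close> by simp
        moreover have "f (u n - u m) < e * (L / 2 * (L / 2))" using N mn by simp
        moreover have "f (u m) * f (u n) > 0" using nz' f_pos by simp
        ultimately show ?thesis by (simp add: pos_divide_less_eq)
      qed
      finally show ?thesis .
    qed
    then show "\<exists>N. \<forall>m\<ge>N. \<forall>n\<ge>N. f (inverse (u m) - inverse (u n)) < e" by blast
  qed
qed

lemma completed_field: "field completed"
proof (rule H.S.cring_fieldI2)
  show "\<zero>\<^bsub>completed\<^esub> \<noteq> \<one>\<^bsub>completed\<^esub>"
    using emb_inj emb_one emb_zero by (metis injD zero_neq_one)
  fix C assume C: "C \<in> carrier completed" "C \<noteq> \<zero>\<^bsub>completed\<^esub>"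
  then obtain u where u: "cauchy u" "C = cls u" by (auto simp: carrier_completed)
  have n0: "cnorm (cls u) \<noteq> 0" using C u cnorm_eq_0 by auto
  note inv = cauchy_inverse[OF u(1) n0]
  have "C \<otimes>\<^bsub>completed\<^esub> cls (\<lambda>n. inverse (u n)) = cls (\<lambda>n. u n * inverse (u n))"
    using u inv by (simp add: cls_mult)
  also have "\<dots> = \<one>\<^bsub>completed\<^esub>"
    unfolding cls_one
  proof (rule cls_eq)
    \<comment> \<open>The products equal 1 only from some index on, which suffices for a null
      difference.\<close>
    show "null (\<lambda>n. u n * inverse (u n) - 1)"
      unfolding null_def
      by (rule tendsto_eventually) (use inv(2) in \<open>auto elim!: eventually_mono simp: f0\<close>)
  qed (use u inv in \<open>auto intro: cauchy_mult cauchy_const\<close>)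
  finally show "\<exists>D\<in>carrier completed. C \<otimes>\<^bsub>completed\<^esub> D = \<one>\<^bsub>completed\<^esub>"
    using cls_in[OF inv(1)] by blast
qed

section \<open>The valuation of the completion, and its completeness\<close>

definition val :: "(nat \<Rightarrow> 'a) set \<Rightarrow> ereal" where
  "val C = (if cnorm C = 0 then \<infinity> else ereal (- log p (cnorm C)))"

lemma vabs_val: assumes "C \<in> carrier completed" shows "vabs p val C = cnorm C"
  using cnorm_nonneg[OF assms] p by (auto simp: vabs_def val_def)

lemma val_emb: "x \<noteq> 0 \<Longrightarrow> val (emb x) = ereal (- log p (f x))"
  by (simp add: val_def cnorm_emb norm_eq_0)

lemma emb_nat: "[n] \<cdot>\<^bsub>completed\<^esub> \<one>\<^bsub>completed\<^esub> = emb (of_nat n)"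
  by (induction n) (simp_all add: emb_zero emb_add emb_one H.S.a_comm emb_in)

lemma val_p: "val ([p] \<cdot>\<^bsub>completed\<^esub> \<one>\<^bsub>completed\<^esub>) = 1"
proof -
  have "of_nat p \<noteq> (0::'a)" using f_p p f0 by auto
  then show ?thesis using p by (simp add: emb_nat val_emb f_p log_divide)
qed

lemma completed_valued_field: "rank_one_valued_field completed val"
proof -
  interpret F: Ring.field completed by (rule completed_field)
  show ?thesis
  proof
    fix C assume C: "C \<in> carrier completed"
    show "val C \<noteq> -\<infinity>" by (simp add: val_def)
    show "val C = \<infinity> \<longleftrightarrow> C = \<zero>\<^bsub>completed\<^esub>" using cnorm_eq_0[OF C] by (simp add: val_def)
    fix D assume D: "D \<in> carrier completed"
    show "val (C \<otimes>\<^bsub>completed\<^esub> D) = val C + val D"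
      using cnorm_mult[OF C D] cnorm_nonneg[OF C] cnorm_nonneg[OF D] p
      by (auto simp: val_def log_mult)
    show "min (val C) (val D) \<le> val (C \<oplus>\<^bsub>completed\<^esub> D)"
    proof (cases "cnorm (C \<oplus>\<^bsub>completed\<^esub> D) = 0")
      case False
      have le: "val E \<le> val (C \<oplus>\<^bsub>completed\<^esub> D)" if "cnorm (C \<oplus>\<^bsub>completed\<^esub> D) \<le> cnorm E" for E
      proof -
        have "cnorm (C \<oplus>\<^bsub>completed\<^esub> D) > 0" using False cnorm_nonneg[of "C \<oplus>\<^bsub>completed\<^esub> D"] C D by simp
        then show ?thesis using that p False by (auto simp: val_def)
      qed
      then show ?thesis using cnorm_add[OF C D] by (metis le_max_iff_disj min.coboundedI1 min.coboundedI2)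
    qed (simp add: val_def)
  next
    have "val \<zero>\<^bsub>completed\<^esub> = \<infinity>" using cnorm_eq_0[of "\<zero>\<^bsub>completed\<^esub>"] by (simp add: val_def)
    then have "[p] \<cdot>\<^bsub>completed\<^esub> \<one>\<^bsub>completed\<^esub> \<noteq> \<zero>\<^bsub>completed\<^esub>" using val_p by auto
    then show "\<exists>x\<in>carrier completed - {\<zero>\<^bsub>completed\<^esub>}. val x \<noteq> 0"
      using val_p by (intro bexI[of _ "[p] \<cdot>\<^bsub>completed\<^esub> \<one>\<^bsub>completed\<^esub>"]) (simp_all del: H.S.add.nat_pow_one)
  qed
qed

sublocale V: rank_one_valued_field completed val
  by (rule completed_valued_field)

sublocale M: Metric_space "carrier completed" "vdist completed p val"
  by (rule V.Metric_space_vdist[OF p])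

lemma vdist_cls: "cauchy u \<Longrightarrow> cauchy w \<Longrightarrow> vdist completed p val (cls u) (cls w) = cnorm (cls (\<lambda>n. u n - w n))"
  by (simp add: vdist_def cls_in vabs_val cls_diff cauchy_diff)

lemma vdist_emb: "vdist completed p val (emb x) (emb y) = f (x - y)"
  unfolding emb_def by (subst vdist_cls) (auto simp: cauchy_const cnorm_emb[unfolded emb_def])

lemma vdist_cls_emb_le:
  assumes u: "cauchy u" and N: "\<And>m. m \<ge> N \<Longrightarrow> f (u m - x) \<le> e"
  shows "vdist completed p val (cls u) (emb x) \<le> e"
proof -
  have "(\<lambda>n. f (u n - x)) \<longlonglongrightarrow> vdist completed p val (cls u) (emb x)"
    unfolding emb_def using u cnorm_tendsto[OF cauchy_diff[OF u cauchy_const]]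
    by (simp add: vdist_cls cauchy_const)
  then show ?thesis by (rule LIMSEQ_le_const2) (use N in blast)
qed

lemma emb_dense: assumes "C \<in> carrier completed" "e > 0" shows "\<exists>x. vdist completed p val C (emb x) < e"
proof -
  obtain u where u: "cauchy u" "C = cls u" using assms by (auto simp: carrier_completed)
  have "e / 2 > 0" using assms by simp
  then obtain N where "\<forall>m\<ge>N. \<forall>n\<ge>N. f (u m - u n) < e / 2" using cauchyD[OF u(1)] by blast
  then have "vdist completed p val C (emb (u N)) \<le> e / 2"
    unfolding u(2) by (intro vdist_cls_emb_le[OF u(1), of N]) (auto intro: less_imp_le)
  then show ?thesis using assms by (intro exI[of _ "u N"]) simp
qed

text \<open>Since \<open>emb\<close> has dense image, each \<open>\<sigma> n\<close> can be
  approximated by some \<open>emb (x n)\<close> within \<open>1 / (n + 1)\<close>. Then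
  \<open>x\<close> is a Cauchy sequence, and its class is the limit of
  \<open>\<sigma>\<close>.\<close>

lemma completed_complete: "valuation_complete completed p val"
  unfolding valuation_complete_def M.mcomplete_def
proof (intro allI impI)
  fix \<sigma> assume \<sigma>: "M.MCauchy \<sigma>"
  then have \<sigma>c: "\<sigma> n \<in> carrier completed" for n by (auto simp: M.MCauchy_def)
  have "\<exists>x. vdist completed p val (\<sigma> n) (emb x) < inverse (real (Suc n))" for n
    using emb_dense[OF \<sigma>c] by simp
  then obtain x where x: "\<And>n. vdist completed p val (\<sigma> n) (emb (x n)) < inverse (real (Suc n))" by metis
  have small: "\<exists>N. \<forall>n\<ge>N. vdist completed p val (\<sigma> n) (emb (x n)) < e" if e: "e > 0" for e
  proof -
    obtain N where N: "inverse (real (Suc N)) < e" using reals_Archimedean[OF e] by blast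
    have "vdist completed p val (\<sigma> n) (emb (x n)) < e" if "n \<ge> N" for n
    proof -
      have "inverse (real (Suc n)) \<le> inverse (real (Suc N))" using that by simp
      then show ?thesis using x[of n] N by linarith
    qed
    then show ?thesis by blast
  qed
  have cx: "cauchy x"
    unfolding cauchy_def
  proof (intro allI impI)
    fix e :: real assume "e > 0"
    then have e3: "e / 3 > 0" by simp
    obtain N where N: "\<forall>n\<ge>N. vdist completed p val (\<sigma> n) (emb (x n)) < e / 3" using small[OF e3] by blast
    obtain M where M: "\<forall>m n. M \<le> m \<longrightarrow> M \<le> n \<longrightarrow> vdist completed p val (\<sigma> m) (\<sigma> n) < e / 3"
      using \<sigma> e3 unfolding M.MCauchy_def by blast
    have "f (x m - x n) < e" if mn: "m \<ge> max N M" "n \<ge> max N M" for m n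
    proof -
      have "vdist completed p val (emb (x m)) (emb (x n)) \<le>
          vdist completed p val (emb (x m)) (\<sigma> m) + vdist completed p val (\<sigma> m) (emb (x n))"
        using M.triangle emb_in \<sigma>c by blast
      also have "vdist completed p val (\<sigma> m) (emb (x n)) \<le>
          vdist completed p val (\<sigma> m) (\<sigma> n) + vdist completed p val (\<sigma> n) (emb (x n))"
        using M.triangle emb_in \<sigma>c by blast
      finally have "f (x m - x n) \<le> vdist completed p val (\<sigma> m) (emb (x m)) +
          (vdist completed p val (\<sigma> m) (\<sigma> n) + vdist completed p val (\<sigma> n) (emb (x n)))"
        by (simp add: vdist_emb M.commute[of "emb (x m)"])
      then show ?thesis using N[rule_format, of m] N[rule_format, of n] M[rule_format, of m n] mn by linarith
    qed
    then show "\<exists>N. \<forall>m\<ge>N. \<forall>n\<ge>N. f (x m - x n) < e" by blast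
  qed
  have "limitin M.mtopology \<sigma> (cls x) sequentially"
    unfolding M.limitin_metric
  proof (intro conjI allI impI)
    show "cls x \<in> carrier completed" using cx by (rule cls_in)
    fix e :: real assume "e > 0"
    then have e3: "e / 3 > 0" by simp
    obtain N where N: "\<forall>n\<ge>N. vdist completed p val (\<sigma> n) (emb (x n)) < e / 3" using small[OF e3] by blast
    obtain M where M: "\<forall>m\<ge>M. \<forall>n\<ge>M. f (x m - x n) < e / 3" using cauchyD[OF cx e3] by blast
    have "vdist completed p val (\<sigma> n) (cls x) < e" if n: "n \<ge> max N M" for n
    proof -
      have "vdist completed p val (cls x) (emb (x n)) \<le> e / 3"
        using M n by (intro vdist_cls_emb_le[OF cx, of M]) (auto intro: less_imp_le)
      moreover have "vdist completed p val (\<sigma> n) (cls x) \<le>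
          vdist completed p val (\<sigma> n) (emb (x n)) + vdist completed p val (emb (x n)) (cls x)"
        using M.triangle emb_in \<sigma>c cls_in[OF cx] by blast
      ultimately show ?thesis
        using N[rule_format, of n] n \<open>e > 0\<close> M.commute[of "emb (x n)" "cls x"] by auto
    qed
    then show "\<forall>\<^sub>F n in sequentially. \<sigma> n \<in> carrier completed \<and> vdist completed p val (\<sigma> n) (cls x) < e"
      using \<sigma>c by (intro eventually_sequentiallyI[of "max N M"]) auto
  qed
  then show "\<exists>C. limitin M.mtopology \<sigma> C sequentially" by blast
qed

section \<open>Valuation ring and residue field of the completion\<close>

lemma emb_valuation_ring: "emb x \<in> carrier (valuation_ring completed p val) \<longleftrightarrow> f x \<le> 1"
  by (simp add: valuation_ring_def emb_in vabs_val cnorm_emb)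

lemma emb_unit: assumes "f x = 1" shows "emb x \<in> Units (valuation_ring completed p val)"
proof -
  have x0: "x \<noteq> 0" using assms f0 by auto
  have "emb x \<otimes>\<^bsub>completed\<^esub> emb (inverse x) = \<one>\<^bsub>completed\<^esub>" "emb (inverse x) \<otimes>\<^bsub>completed\<^esub> emb x = \<one>\<^bsub>completed\<^esub>"
    using x0 by (simp_all flip: emb_mult emb_one)
  moreover have "emb x \<in> carrier (valuation_ring completed p val)"
    "emb (inverse x) \<in> carrier (valuation_ring completed p val)"
    using assms by (auto simp: emb_valuation_ring norm_inverse)
  ultimately show ?thesis unfolding Units_def by (auto simp: valuation_ring_def)
qed

text \<open>Completion adds no residue classes: by density an integral \<open>C\<close> is congruent
  to some \<open>emb x\<close>, and then to \<open>emb t\<close> with \<open>t\<close> in the finite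
  set \<open>T\<close>.\<close>

lemma finite_residue_field:
  assumes T: "finite T" "\<And>x. f x \<le> 1 \<Longrightarrow> \<exists>t\<in>T. f (x - t) < 1"
  shows "finite (carrier (residue_field completed p val))"
proof -
  let ?V = "valuation_ring completed p val" and ?I = "valuation_ideal completed p val"
  have I: "C \<in> ?I \<longleftrightarrow> C \<in> carrier completed \<and> cnorm C < 1" for C
    by (auto simp: valuation_ideal_def vabs_val)
  have coset: "?I +>\<^bsub>?V\<^esub> C = (\<lambda>D. D \<oplus>\<^bsub>completed\<^esub> C) ` ?I" for C
    by (auto simp: a_r_coset_def' valuation_ring_def)
  have sub: "?I +>\<^bsub>?V\<^esub> C \<subseteq> ?I +>\<^bsub>?V\<^esub> D"
    if CD: "C \<in> carrier completed" "D \<in> carrier completed" "cnorm (C \<ominus>\<^bsub>completed\<^esub> D) < 1" for C D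
    unfolding coset
  proof (rule image_subsetI)
    fix E assume E: "E \<in> ?I"
    have "E \<oplus>\<^bsub>completed\<^esub> C = (E \<oplus>\<^bsub>completed\<^esub> (C \<ominus>\<^bsub>completed\<^esub> D)) \<oplus>\<^bsub>completed\<^esub> D"
      using CD E I by (simp add: a_minus_def H.S.a_assoc H.S.l_neg)
    moreover have "E \<oplus>\<^bsub>completed\<^esub> (C \<ominus>\<^bsub>completed\<^esub> D) \<in> ?I"
      using CD E by (auto simp: I intro!: le_less_trans[OF cnorm_add])
    ultimately show "E \<oplus>\<^bsub>completed\<^esub> C \<in> (\<lambda>E. E \<oplus>\<^bsub>completed\<^esub> D) ` ?I" by blast
  qed
  have comm: "cnorm (D \<ominus>\<^bsub>completed\<^esub> C) = cnorm (C \<ominus>\<^bsub>completed\<^esub> D)"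
    if "C \<in> carrier completed" "D \<in> carrier completed" for C D
    using M.commute[of C D] that by (simp add: vdist_def vabs_val)
  have eq: "?I +>\<^bsub>?V\<^esub> C = ?I +>\<^bsub>?V\<^esub> D"
    if "C \<in> carrier completed" "D \<in> carrier completed" "cnorm (C \<ominus>\<^bsub>completed\<^esub> D) < 1" for C D
    using sub[of C D] sub[of D C] comm that by auto
  have "carrier (residue_field completed p val) \<subseteq> (\<lambda>t. ?I +>\<^bsub>?V\<^esub> emb t) ` T"
  proof
    fix R assume "R \<in> carrier (residue_field completed p val)"
    then obtain C where C: "C \<in> carrier ?V" "R = ?I +>\<^bsub>?V\<^esub> C"
      by (auto simp: residue_field_def FactRing_def A_RCOSETS_def')
    then have Cc: "C \<in> carrier completed" "cnorm C \<le> 1" by (auto simp: valuation_ring_def vabs_val)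
    obtain x where "vdist completed p val C (emb x) < 1" using emb_dense[OF Cc(1), of 1] by auto
    then have Cx: "cnorm (C \<ominus>\<^bsub>completed\<^esub> emb x) < 1" using Cc emb_in by (simp add: vdist_def vabs_val)
    \<comment> \<open>Since \<open>emb x\<close> differs from the integral \<open>C\<close> by an
      element of value below 1, it is integral too, which gives access to \<open>T\<close>.\<close>
    have "emb x = C \<oplus>\<^bsub>completed\<^esub> (emb x \<ominus>\<^bsub>completed\<^esub> C)"
      using Cc emb_in[of x] by (simp add: a_minus_def H.S.a_comm[of "emb x"] H.S.r_neg1 H.S.r_neg2)
    then have "f x \<le> max (cnorm C) (cnorm (emb x \<ominus>\<^bsub>completed\<^esub> C))"
      using cnorm_add[of C "emb x \<ominus>\<^bsub>completed\<^esub> C"] Cc emb_in[of x] cnorm_emb[of x] by simp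
    then have "f x \<le> 1" using Cc Cx comm[OF Cc(1) emb_in, of x] by simp
    then obtain t where t: "t \<in> T" "f (x - t) < 1" using T by blast
    have "R = ?I +>\<^bsub>?V\<^esub> emb x" unfolding C(2) using eq Cc Cx emb_in by simp
    also have "\<dots> = ?I +>\<^bsub>?V\<^esub> emb t" using eq emb_in t(2) by (simp add: cnorm_emb flip: emb_diff)
    finally show "R \<in> (\<lambda>t. ?I +>\<^bsub>?V\<^esub> emb t) ` T" using t(1) by blast
  qed
  then show ?thesis using T(1) finite_subset by blast
qed

end

section \<open>Presentation complexity\<close>

text \<open>The adjunction of generators takes place in a field type of characteristic zero and is
  applied to \<open>Frac(R)\<close>.\<close>

instance fract :: ("{idom, ring_char_0}") field_char_0
proof
  have "of_nat n = Fraction_Field.Fract (of_nat n :: 'a) 1" for n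
    by (induction n) (simp_all add: Zero_fract_def One_fract_def)
  then show "inj (of_nat :: nat \<Rightarrow> 'a fract)"
    by (auto simp: inj_def eq_fract)
qed

section \<open>From polynomials over the integers to heights in the fraction field\<close>

context
  fixes \<alpha> :: "nat \<Rightarrow> 'r::idom"
begin

lemma Fract_sum: "Fraction_Field.Fract (sum g I) 1 = (\<Sum>i\<in>I. Fraction_Field.Fract (g i) 1)"
  for g :: "'b \<Rightarrow> 'r"
proof (induction I rule: infinite_finite_induct)
  case (insert i I)
  have "Fraction_Field.Fract (g i + sum g I) 1 = Fraction_Field.Fract (g i) 1 + Fraction_Field.Fract (sum g I) 1"
    by simp
  then show ?case using insert by simp
qed (simp_all add: Zero_fract_def)

lemma Fract_prod: "Fraction_Field.Fract (prod g I) 1 = (\<Prod>i\<in>I. Fraction_Field.Fract (g i) 1)"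
  for g :: "'b \<Rightarrow> 'r"
proof (induction I rule: infinite_finite_induct)
  case (insert i I)
  have "Fraction_Field.Fract (g i * prod g I) 1 = Fraction_Field.Fract (g i) 1 * Fraction_Field.Fract (prod g I) 1"
    by simp
  then show ?case using insert by simp
qed (simp_all add: One_fract_def)

lemma Fract_power: "Fraction_Field.Fract (x ^ n) 1 = Fraction_Field.Fract x 1 ^ n" for x :: 'r
proof (induction n)
  case (Suc n)
  have "Fraction_Field.Fract (x * x ^ n) 1 = Fraction_Field.Fract x 1 * Fraction_Field.Fract (x ^ n) 1" by simp
  then show ?case using Suc by simp
qed (simp add: One_fract_def)

lemma Fract_of_nat: "Fraction_Field.Fract (of_nat n :: 'r) 1 = of_nat n"
proof (induction n)
  case (Suc n)
  have "Fraction_Field.Fract (1 + of_nat n :: 'r) 1 = Fraction_Field.Fract 1 1 + Fraction_Field.Fract (of_nat n) 1"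
    by simp
  then show ?case using Suc by (simp add: One_fract_def)
qed (simp add: Zero_fract_def)

lemma Fract_of_int: "Fraction_Field.Fract (of_int n :: 'r) 1 = of_int n"
proof (cases n rule: int_cases2)
  case (nonpos m)
  have "Fraction_Field.Fract (- of_nat m :: 'r) 1 = - Fraction_Field.Fract (of_nat m) 1" by simp
  then show ?thesis using nonpos by (simp only: Fract_of_nat of_int_minus of_int_of_nat_eq)
qed (simp add: Fract_of_nat)

abbreviation (input) \<alpha>' :: "nat \<Rightarrow> 'r fract" where "\<alpha>' i \<equiv> Fraction_Field.Fract (\<alpha> i) 1"

lemma bounded_poly_monomial:
  assumes "finite I" "I \<subseteq> {..<s}"
  shows "bounded_poly \<alpha>' s (\<Sum>i\<in>I. e i) 1 (\<Prod>i\<in>I. \<alpha>' i ^ e i)"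
  using assms
proof (induction I rule: finite_induct)
  case empty
  then show ?case using bounded_poly.const[of 1 1 \<alpha>' s 0] by simp
next
  case (insert i I)
  have "bounded_poly \<alpha>' s (Suc 0) 1 (\<alpha>' i * of_int 1)"
    using insert by (intro bounded_poly.var bounded_poly.const) auto
  then have "bounded_poly \<alpha>' s (e i * 1) (1 ^ e i) (\<alpha>' i ^ e i)" using bounded_poly_power by fastforce
  then have "bounded_poly \<alpha>' s (e i * 1 + (\<Sum>i\<in>I. e i)) (1 ^ e i * 1) (\<alpha>' i ^ e i * (\<Prod>i\<in>I. \<alpha>' i ^ e i))"
    using insert by (intro bounded_poly_mult) auto
  then show ?case using insert by simp
qed

lemma bounded_poly_sum:
  assumes "finite I" "\<And>i. i \<in> I \<Longrightarrow> bounded_poly \<beta> s d (H i) (g i)"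
  shows "bounded_poly \<beta> s d (sum H I) (sum g I)"
  using assms by (induction I rule: finite_induct) (auto intro: bounded_poly_0 bounded_poly.sum)

lemma bounded_poly_mpoly_eval:
  assumes "P \<in> mpolys s"
  shows "bounded_poly \<alpha>' s (tot_deg P) (real_of_int (l1_norm P)) (Fraction_Field.Fract (mpoly_eval \<alpha> P) 1)"
proof -
  define c where "c m = Poly_Mapping.lookup P m" for m
  have "Fraction_Field.Fract (mpoly_eval \<alpha> P) 1 = (\<Sum>m\<in>Poly_Mapping.keys P. of_int (c m) *
      (\<Prod>i\<in>Poly_Mapping.keys m. \<alpha>' i ^ Poly_Mapping.lookup m i))"
    unfolding mpoly_eval_def Fract_sum
  proof (rule sum.cong)
    fix m
    have "Fraction_Field.Fract (of_int (c m) * (\<Prod>i\<in>Poly_Mapping.keys m. \<alpha> i ^ Poly_Mapping.lookup m i)) 1 =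
        Fraction_Field.Fract (of_int (c m)) 1 *
        Fraction_Field.Fract (\<Prod>i\<in>Poly_Mapping.keys m. \<alpha> i ^ Poly_Mapping.lookup m i) 1"
      by simp
    then show "Fraction_Field.Fract (of_int (Poly_Mapping.lookup P m) *
        (\<Prod>i\<in>Poly_Mapping.keys m. \<alpha> i ^ Poly_Mapping.lookup m i)) 1 =
        of_int (c m) * (\<Prod>i\<in>Poly_Mapping.keys m. \<alpha>' i ^ Poly_Mapping.lookup m i)"
      by (simp only: Fract_of_int Fract_prod Fract_power c_def)
  qed simp
  moreover have "bounded_poly \<alpha>' s (tot_deg P) (\<Sum>m\<in>Poly_Mapping.keys P. \<bar>real_of_int (c m)\<bar>) \<dots>"
  proof (rule bounded_poly_sum)
    fix m assume m: "m \<in> Poly_Mapping.keys P"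
    have "mono_deg m \<le> tot_deg P" unfolding tot_deg_def using m by (intro Max_ge) auto
    moreover have "bounded_poly \<alpha>' s (mono_deg m) (\<bar>real_of_int (c m)\<bar> * 1)
        (of_int (c m) * (\<Prod>i\<in>Poly_Mapping.keys m. \<alpha>' i ^ Poly_Mapping.lookup m i))"
      using assms m unfolding mono_deg_def mpolys_def
      by (intro bounded_poly_of_int_mult bounded_poly_monomial) auto
    ultimately show "bounded_poly \<alpha>' s (tot_deg P) \<bar>real_of_int (c m)\<bar>
        (of_int (c m) * (\<Prod>i\<in>Poly_Mapping.keys m. \<alpha>' i ^ Poly_Mapping.lookup m i))"
      by (rule_tac bounded_poly_mono) auto
  qed simp
  ultimately show ?thesis by (simp add: l1_norm_def c_def)
qed

lemma height_le_mpoly_eval: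
  assumes "P \<in> mpolys s"
  shows "height_le \<alpha>' s (real (tot_deg P) + ln (1 + real_of_int (l1_norm P))) (Fraction_Field.Fract (mpoly_eval \<alpha> P) 1)"
proof (rule height_leI[OF bounded_poly_mpoly_eval[OF assms]])
  have l: "real_of_int (l1_norm P) \<ge> 0" unfolding l1_norm_def by (simp add: sum_nonneg)
  then show "real (tot_deg P) \<le> real (tot_deg P) + ln (1 + real_of_int (l1_norm P))" by simp
  have "1 + real_of_int (l1_norm P) = exp (ln (1 + real_of_int (l1_norm P)))" using l by simp
  also have "\<dots> \<le> exp (real (tot_deg P) + ln (1 + real_of_int (l1_norm P)))" by simp
  finally show "real_of_int (l1_norm P) \<le> exp (real (tot_deg P) + ln (1 + real_of_int (l1_norm P)))" by simp
qed

text \<open>Compares complexity with height: \<open>ln (2 + d) \<ge> ln 2\<close> serves the degree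
  part and \<open>ln 2 \<le> 1\<close> the norm part.\<close>

lemma poly_size_ge:
  "ln 2 * (1 + (real (tot_deg P) + ln (1 + real_of_int (l1_norm P)))) \<le> poly_size P"
proof -
  define L where "L = ln (1 + real_of_int (l1_norm P))"
  have "real_of_int (l1_norm P) \<ge> 0" unfolding l1_norm_def by (simp add: sum_nonneg)
  then have L: "L \<ge> 0" by (simp add: L_def)
  have "ln 2 \<le> (1::real)" using ln_le_minus_one[of "2::real"] by simp
  then have "ln 2 * L \<le> L" using L by (simp add: mult_left_le_one_le)
  moreover have "ln 2 * (1 + real (tot_deg P)) \<le> (1 + real (tot_deg P)) * ln (2 + real (tot_deg P))"
    by (subst mult.commute) (intro mult_left_mono, auto)
  ultimately show ?thesis unfolding poly_size_def L_def[symmetric] by (simp add: algebra_simps)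
qed

lemma gen_ring_eq:
  assumes R: "Z_adjoin s \<alpha> = UNIV"
  shows "Fraction_Field.Fract a 1 \<in> gen_ring \<alpha>' s" "fractions (gen_ring \<alpha>' s) = UNIV"
proof -
  show *: "Fraction_Field.Fract a 1 \<in> gen_ring \<alpha>' s" for a
  proof -
    obtain P where "P \<in> mpolys s" "a = mpoly_eval \<alpha> P" using R unfolding Z_adjoin_def by blast
    then show ?thesis using gen_ringI[OF height_le_mpoly_eval] by simp
  qed
  have "\<xi> \<in> fractions (gen_ring \<alpha>' s)" for \<xi>
  proof -
    obtain a b where "\<xi> = Fraction_Field.Fract a b" "b \<noteq> 0" by (cases \<xi>) auto
    then show ?thesis using * by (intro fractionsI[of "Fraction_Field.Fract a 1" _ "Fraction_Field.Fract b 1"]) auto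
  qed
  then show "fractions (gen_ring \<alpha>' s) = UNIV" by blast
qed

text \<open>In an optimal presentation \<open>x / y\<close> the denominator has value at most 1, so
  the lower bound for the numerator is one for the quotient. Division by \<open>ln 2\<close>
  converts complexity into height.\<close>

lemma absval_lower_bound:
  assumes R: "Z_adjoin s \<alpha> = UNIV" and good: "good_absval \<alpha>' s p f B" and \<xi>: "\<xi> \<noteq> 0"
  shows "exp (- (B / ln 2) * comp_R s \<alpha> \<xi>) \<le> f \<xi>"
proof -
  have UN: "fractions (gen_ring \<alpha>' s) = UNIV" using gen_ring_eq(2)[OF R] .
  interpret nonarch_field UNIV f using good by (simp add: good_absval_def UN)
  have B: "B \<ge> 0" using good by (simp add: good_absval_def)
  obtain P Q where PQ: "(P, Q) \<in> presentations s \<alpha> \<xi>" "comp_R s \<alpha> \<xi> = max (poly_size P) (poly_size Q)"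
    using comp_R_is_minimum(1)[OF R \<xi>] by blast
  define x y where "x = Fraction_Field.Fract (mpoly_eval \<alpha> P) 1" "y = Fraction_Field.Fract (mpoly_eval \<alpha> Q) 1"
  have P: "P \<in> mpolys s" and xy: "\<xi> = x / y" and y0: "y \<noteq> 0"
    using PQ(1) by (auto simp: presentations_def x_y_def Zero_fract_def eq_fract)
  define b where "b = real (tot_deg P) + ln (1 + real_of_int (l1_norm P))"
  have "ln 2 * (1 + b) \<le> comp_R s \<alpha> \<xi>" using poly_size_ge[of P] PQ(2) by (simp add: b_def)
  then have "1 + b \<le> comp_R s \<alpha> \<xi> / ln 2" by (simp add: pos_le_divide_eq mult.commute)
  then have "B * (1 + b) \<le> B * (comp_R s \<alpha> \<xi> / ln 2)" using B by (rule mult_left_mono)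
  then have "exp (- (B / ln 2) * comp_R s \<alpha> \<xi>) \<le> exp (- B * (1 + b))" by simp
  also have "\<dots> \<le> f x"
  proof -
    have "height_le \<alpha>' s b x" unfolding b_def x_y_def by (rule height_le_mpoly_eval[OF P])
    moreover have "x \<noteq> 0" using \<xi> xy by auto
    ultimately show ?thesis using good unfolding good_absval_def by blast
  qed
  also have "\<dots> \<le> f \<xi>"
  proof -
    have "y \<in> gen_ring \<alpha>' s" unfolding x_y_def by (rule gen_ring_eq(1)[OF R])
    then have "f y \<le> 1" "f y > 0" using good f_pos y0 by (auto simp: good_absval_def)
    then show ?thesis using f_nonneg[of x] unfolding xy by (simp add: f_divide le_divide_eq mult_left_le)
  qed
  finally show ?thesis .
qed

end

theorem proposition3p4:
  fixes s :: nat
    and \<alpha> :: "nat \<Rightarrow> 'r :: {idom, ring_char_0}"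
    and g :: 'r
  assumes R: "Z_adjoin s \<alpha> = UNIV"
    and g: "g \<noteq> 0"
  shows "\<exists>A :: 'r \<Rightarrow> real. (\<forall>h. A h > 0) \<and>
    (\<forall>excluded :: nat set. finite excluded \<and> (\<forall>q \<in> excluded. Factorial_Ring.prime q) \<longrightarrow>
      (\<exists>(h :: 'r) (p :: nat) (F :: 'r completion_point ring) (v :: 'r completion_point \<Rightarrow> ereal)
         (\<iota> :: 'r fract \<Rightarrow> 'r completion_point).
         h \<noteq> 0 \<and>
         Factorial_Ring.prime p \<and> p \<ge> 3 \<and> p \<notin> excluded \<and>
         rank_one_valued_field F v \<and>
         valuation_complete F p v \<and>
         v ([p] \<cdot>\<^bsub>F\<^esub> \<one>\<^bsub>F\<^esub>) = 1 \<and>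
         finite (carrier (residue_field F p v)) \<and>
         \<iota> \<in> ring_hom ring_of_type_algebra F \<and> inj \<iota> \<and>
         \<iota> ` localization (g * h) \<subseteq> carrier (valuation_ring F p v) \<and>
         (\<forall>\<xi>. \<xi> \<noteq> 0 \<longrightarrow> v (\<iota> \<xi>) \<le> ereal (A h * comp_R s \<alpha> \<xi>)) \<and>
         \<iota> (Fraction_Field.Fract g 1) \<in> Units (valuation_ring F p v) \<and>
         \<iota> (Fraction_Field.Fract h 1) \<in> Units (valuation_ring F p v) \<and>
         (\<forall>n. \<iota> (Fraction_Field.Fract ((g * h) ^ n) 1) \<in> Units (valuation_ring F p v))))"
proof -
  let ?\<alpha> = "\<lambda>i. Fraction_Field.Fract (\<alpha> i) 1"
  let ?g = "Fraction_Field.Fract g 1"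
  have UN: "fractions (gen_ring ?\<alpha> s) = UNIV" by (rule gen_ring_eq(2)[OF R])
  have g0: "?g \<noteq> 0" using g by (simp add: Zero_fract_def eq_fract)
  \<comment> \<open>\<open>N\<close> is obtained from \<open>g\<close> and the generators before the
    excluded primes are given, so the family \<open>B\<close> can be fixed in advance.\<close>
  obtain N where N: "N > 0" "\<And>p. Factorial_Ring.prime p \<Longrightarrow> \<not> p dvd N \<Longrightarrow>
      \<exists>f B. good_absval ?\<alpha> s p f B \<and> f ?g = 1"
    using good_absval_exists[OF gen_ring_eq(1)[OF R] g0] by auto
  then obtain f B where fB: "\<And>p. Factorial_Ring.prime p \<Longrightarrow> \<not> p dvd N \<Longrightarrow>
      good_absval ?\<alpha> s p (f p) (B p) \<and> f p ?g = 1" by metis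
  \<comment> \<open>Since \<open>p \<mapsto> p + 1\<close> is injective into \<open>R\<close>, taking \<open>h = p + 1\<close> lets a function of \<open>h\<close> depend on \<open>p\<close>.\<close>
  define A where "A h = \<bar>B (THE p. h = (of_nat (p + 1) :: 'r))\<bar> / ln 2 + 1" for h
  have A: "A (of_nat (p + 1)) = \<bar>B p\<bar> / ln 2 + 1" for p
  proof -
    have "(THE q. (of_nat (p + 1) :: 'r) = of_nat (q + 1)) = p"
      by (rule the_equality) (simp_all only: of_nat_eq_iff)
    then show ?thesis by (simp only: A_def)
  qed
  show ?thesis
  proof (intro exI[of _ A] conjI allI impI)
    \<comment> \<open>The absolute value and the \<open>1\<close> give positivity at every
      \<open>h\<close>, also where \<open>B\<close> is unspecified.\<close>
    show "A h > 0" for h by (simp add: A_def add_nonneg_pos)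
    fix excluded :: "nat set" assume ex: "finite excluded \<and> (\<forall>q\<in>excluded. Factorial_Ring.prime q)"
    \<comment> \<open>This size puts \<open>p\<close> outside \<open>excluded\<close>, prevents it
      from dividing \<open>N\<close>, and gives \<open>p \<ge> 3\<close>, hence
      \<open>ln p \<ge> 1\<close>.\<close>
    obtain p where pr: "Factorial_Ring.prime p" "p > N + 3 + \<Sum>excluded" using bigger_prime by blast
    have "\<not> p dvd N" using pr N(1) by (auto dest: dvd_imp_le)
    then have good: "good_absval ?\<alpha> s p (f p) (B p)" and fg: "f p ?g = 1" using fB pr by auto
    have p_ex: "p \<notin> excluded"
    proof
      assume "p \<in> excluded"
      then have "p \<le> \<Sum>excluded" using ex by (intro member_le_sum) auto
      then show False using pr by simp
    qed
    define h :: 'r where "h = of_nat (p + 1)"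
    interpret completion "f p" p
    proof -
      interpret nonarch_field UNIV "f p" using good by (simp add: good_absval_def UN)
      show "completion (f p) p"
        by unfold_locales (use good prime_gt_1_nat[OF pr(1)] in \<open>auto simp: good_absval_def\<close>)
    qed
    have le1: "f p (Fraction_Field.Fract a 1) \<le> 1" for a
      using good gen_ring_eq(1)[OF R] by (simp add: good_absval_def)
    \<comment> \<open>\<open>h = p + 1\<close> has the value of \<open>1\<close>, because
      \<open>p\<close> has value below 1.\<close>
    have fh: "f p (Fraction_Field.Fract h 1) = 1"
    proof -
      have "Fraction_Field.Fract h 1 = of_nat (p + 1)" unfolding h_def by (rule Fract_of_nat)
      also have "\<dots> = of_nat p + 1" by simp
      finally show ?thesis using f_add_eq[of "of_nat p" 1] f_one f_p p by simp
    qed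
    have fgh: "f p (Fraction_Field.Fract ((g * h) ^ n) 1) = 1" for n
    proof -
      have "Fraction_Field.Fract (g * h) 1 = ?g * Fraction_Field.Fract h 1" by simp
      then have "f p (Fraction_Field.Fract (g * h) 1) = 1" using fg fh by (simp only: norm_mult)
      then show ?thesis by (simp add: Fract_power f_power)
    qed
    have h0: "h \<noteq> 0" unfolding h_def of_nat_eq_0_iff by simp
    have v: "val (emb \<xi>) \<le> ereal (A h * comp_R s \<alpha> \<xi>)" if \<xi>: "\<xi> \<noteq> 0" for \<xi>
    proof -
      define c where "c = comp_R s \<alpha> \<xi>"
      have Bp: "B p \<ge> 0" using good by (simp add: good_absval_def)
      have lb: "exp (- (B p / ln 2) * c) \<le> f p \<xi>" unfolding c_def by (rule absval_lower_bound[OF R good \<xi>])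
      have f\<xi>: "f p \<xi> > 0" using f_pos \<xi> by simp
      then have l: "- ln (f p \<xi>) \<le> B p / ln 2 * c" using lb by (simp add: ln_ge_iff flip: ln_ge_iff)
      have c: "c \<ge> 0"
      proof -
        obtain P Q where PQ: "c = max (poly_size P) (poly_size Q)"
          using comp_R_is_minimum(1)[OF R \<xi>] unfolding c_def by blast
        have "real_of_int (l1_norm P) \<ge> 0" unfolding l1_norm_def by (simp add: sum_nonneg)
        then have "poly_size P \<ge> 0" unfolding poly_size_def by (intro add_nonneg_nonneg mult_nonneg_nonneg) auto
        then show ?thesis using PQ by simp
      qed
      \<comment> \<open>Passing from the natural logarithm to base \<open>p\<close> divides a
        nonnegative bound by \<open>ln p \<ge> 1\<close>, so the bound survives.\<close>
      have lp: "ln (real p) \<ge> 1"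
        using pr exp_le by (subst ln_ge_iff) (auto intro: order_trans)
      have Bc: "B p / ln 2 * c \<ge> 0" using Bp c by simp
      have "- log p (f p \<xi>) = - ln (f p \<xi>) / ln (real p)" by (simp add: log_def)
      also have "\<dots> \<le> (B p / ln 2 * c) / ln (real p)" using l lp by (intro divide_right_mono) auto
      also have "\<dots> \<le> B p / ln 2 * c" using mult_left_mono[OF lp Bc] lp by (subst pos_divide_le_eq) auto
      also have "\<dots> \<le> A h * c" unfolding h_def A using Bp c by (simp add: algebra_simps)
      finally show ?thesis using \<xi> by (simp add: val_emb c_def)
    qed
    have loc: "emb ` localization (g * h) \<subseteq> carrier (valuation_ring completed p val)"
    proof clarify
      fix \<xi> assume "\<xi> \<in> localization (g * h)"
      then obtain a n where "\<xi> = Fraction_Field.Fract a ((g * h) ^ n)" unfolding localization_def by blast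
      then have "\<xi> = Fraction_Field.Fract a 1 / Fraction_Field.Fract ((g * h) ^ n) 1" by simp
      then have "f p \<xi> = f p (Fraction_Field.Fract a 1) / f p (Fraction_Field.Fract ((g * h) ^ n) 1)"
        by (simp only: f_divide UNIV_I)
      then have "f p \<xi> \<le> 1" using le1[of a] by (simp only: fgh div_by_1)
      then show "emb \<xi> \<in> carrier (valuation_ring completed p val)" by (simp add: emb_valuation_ring)
    qed
    obtain T where T: "finite T" "\<And>x. f p x \<le> 1 \<Longrightarrow> \<exists>t\<in>T. f p (x - t) < 1"
      using good by (auto simp: good_absval_def finite_residue_def UN)
    show "\<exists>(h :: 'r) (p :: nat) (F :: 'r completion_point ring) (v :: 'r completion_point \<Rightarrow> ereal)
         (\<iota> :: 'r fract \<Rightarrow> 'r completion_point).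
         h \<noteq> 0 \<and>
         Factorial_Ring.prime p \<and> p \<ge> 3 \<and> p \<notin> excluded \<and>
         rank_one_valued_field F v \<and>
         valuation_complete F p v \<and>
         v ([p] \<cdot>\<^bsub>F\<^esub> \<one>\<^bsub>F\<^esub>) = 1 \<and>
         finite (carrier (residue_field F p v)) \<and>
         \<iota> \<in> ring_hom ring_of_type_algebra F \<and> inj \<iota> \<and>
         \<iota> ` localization (g * h) \<subseteq> carrier (valuation_ring F p v) \<and>
         (\<forall>\<xi>. \<xi> \<noteq> 0 \<longrightarrow> v (\<iota> \<xi>) \<le> ereal (A h * comp_R s \<alpha> \<xi>)) \<and>
         \<iota> (Fraction_Field.Fract g 1) \<in> Units (valuation_ring F p v) \<and>
         \<iota> (Fraction_Field.Fract h 1) \<in> Units (valuation_ring F p v) \<and>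
         (\<forall>n. \<iota> (Fraction_Field.Fract ((g * h) ^ n) 1) \<in> Units (valuation_ring F p v))"
    proof (intro exI conjI allI impI)
      show "h \<noteq> 0" by (rule h0)
      show "Factorial_Ring.prime p" "3 \<le> p" "p \<notin> excluded" using pr p_ex by auto
      show "rank_one_valued_field completed val" by (rule completed_valued_field)
      show "valuation_complete completed p val" by (rule completed_complete)
      show "val ([p] \<cdot>\<^bsub>completed\<^esub> \<one>\<^bsub>completed\<^esub>) = 1" by (rule val_p)
      show "finite (carrier (residue_field completed p val))" by (rule finite_residue_field[OF T])
      show "emb \<in> ring_hom ring_of_type_algebra completed" by (rule emb_hom)
      show "inj emb" by (rule emb_inj)
      show "emb ` localization (g * h) \<subseteq> carrier (valuation_ring completed p val)" by (rule loc)
      show "\<And>\<xi>. \<xi> \<noteq> 0 \<Longrightarrow> val (emb \<xi>) \<le> ereal (A h * comp_R s \<alpha> \<xi>)" by (rule v)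
      show "emb (Fraction_Field.Fract g 1) \<in> Units (valuation_ring completed p val)"
        "emb (Fraction_Field.Fract h 1) \<in> Units (valuation_ring completed p val)"
        "\<And>n. emb (Fraction_Field.Fract ((g * h) ^ n) 1) \<in> Units (valuation_ring completed p val)"
        using fg fh fgh by (auto intro: emb_unit)
    qed
  qed
qed

end
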